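(* Let $n\ge1$, let $(\nu,\mu)\in\mathbb{R}^2$ with $\mu>0$, and let $\lambda\in\mathbb{C}$. Then the eigenspace $A^2_\lambda(\Delta_{\nu,\mu})$ is a non-zero (Hilbert) space if and only if $\lambda=l$ for some integer $l\in\{0,1,2,\dots\}$. Moreover, the spaces $A^2_l(\Delta_{\nu,\mu})$, $l=0,1,2,\dots$, are pairwise orthogonal in $L^2(\mathbb{C}^n,dm)$ and one has the orthogonal Hilbert space decomposition $$L^2(\mathbb{C}^n,dm)=\bigoplus_{l=0}^{\infty}A^2_l(\Delta_{\nu,\mu}).$$
   Context: The operator $\Delta_{\nu,\mu}$ on $\mathbb{C}^n=\mathbb{R}^{2n}$ is $$\Delta_{\nu,\mu}=4\sum_{j=1}^n\frac{\partial^2}{\partial z_j\partial\bar z_j}+2i\nu(E+\overline{E}+n)+2\mu(E-\overline{E})-(\nu^2+\mu^2)|z|^2,$$ with $E=\sum_{j=1}^n z_j\frac{\partial}{\partial z_j}$ and $\overline{E}=\sum_{j=1}^n\bar z_j\frac{\partial}{\partial\bar z_j}$. $L^2(\mathbb{C}^n,dm)$ is the Hilbert space of complex-valued square integrable functions with respect to Lebesgue measure $dm$ on $\mathbb{C}^n=\mathbb{R}^{2n}$. For $\lambda\in\mathbb{C}$, $$A^2_\lambda(\Delta_{\nu,\mu})=\{F\in L^2(\mathbb{C}^n,dm)\cap\mathcal{C}^\infty(\mathbb{C}^n):\ \Delta_{\nu,\mu}F=-2\mu(2\lambda+n)F\}.$$ *)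

theory Defs
  imports "HOL-Analysis.Analysis"
begin

section \<open>Smooth functions and Wirtinger derivatives\<close>

text \<open>All derivatives below are real derivatives, with \<^typ>\<open>complex^'n\<close> regarded as a real
  vector space of dimension \<open>2n\<close>, where \<open>n = CARD('n)\<close>.\<close>

primrec C_k :: "nat \<Rightarrow> ('a::real_normed_vector \<Rightarrow> 'b::real_normed_vector) \<Rightarrow> bool" where
  "C_k 0 f \<longleftrightarrow> continuous_on UNIV f"
| "C_k (Suc k) f \<longleftrightarrow>
     (\<forall>x. f differentiable (at x)) \<and> (\<forall>v. C_k k (\<lambda>x. frechet_derivative f (at x) v))"

definition smooth :: "('a::real_normed_vector \<Rightarrow> 'b::real_normed_vector) \<Rightarrow> bool" where
  "smooth f \<longleftrightarrow> (\<forall>k. C_k k f)"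

text \<open>Writing \<open>z\<^sub>j = x\<^sub>j + i y\<^sub>j\<close>, the derivative in direction \<^term>\<open>axis j 1\<close> is
  \<open>\<partial>/\<partial>x\<^sub>j\<close>, and the one in direction \<^term>\<open>axis j \<i>\<close> is \<open>\<partial>/\<partial>y\<^sub>j\<close>.\<close>

definition d_z :: "'n::finite \<Rightarrow> (complex^'n \<Rightarrow> complex) \<Rightarrow> complex^'n \<Rightarrow> complex" where
  "d_z j F = (\<lambda>z. (frechet_derivative F (at z) (axis j 1)
                 - \<i> * frechet_derivative F (at z) (axis j \<i>)) / 2)"

definition d_zbar :: "'n::finite \<Rightarrow> (complex^'n \<Rightarrow> complex) \<Rightarrow> complex^'n \<Rightarrow> complex" where
  "d_zbar j F = (\<lambda>z. (frechet_derivative F (at z) (axis j 1)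
                    + \<i> * frechet_derivative F (at z) (axis j \<i>)) / 2)"

definition euler :: "(complex^'n::finite \<Rightarrow> complex) \<Rightarrow> complex^'n \<Rightarrow> complex" where
  "euler F = (\<lambda>z. \<Sum>j\<in>UNIV. z $ j * d_z j F z)"

definition euler_bar :: "(complex^'n::finite \<Rightarrow> complex) \<Rightarrow> complex^'n \<Rightarrow> complex" where
  "euler_bar F = (\<lambda>z. \<Sum>j\<in>UNIV. cnj (z $ j) * d_zbar j F z)"

definition Delta ::
    "real \<Rightarrow> real \<Rightarrow> (complex^'n::finite \<Rightarrow> complex) \<Rightarrow> complex^'n \<Rightarrow> complex" where
  "Delta \<nu> \<mu> F = (\<lambda>z.
      4 * (\<Sum>j\<in>UNIV. d_z j (d_zbar j F) z)
      + 2 * \<i> * of_real \<nu> * (euler F z + euler_bar F z + of_nat CARD('n) * F z)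
      + 2 * of_real \<mu> * (euler F z - euler_bar F z)
      - of_real ((\<nu>\<^sup>2 + \<mu>\<^sup>2) * (norm z)\<^sup>2) * F z)"

section \<open>Square integrable functions\<close>

text \<open>Elements of \<open>L\<^sup>2\<close> are represented by functions; equality in \<open>L\<^sup>2\<close> is equality almost
  everywhere, that is, vanishing of \<open>L2_dist\<close>.\<close>

definition L2 :: "('a::euclidean_space \<Rightarrow> complex) set" where
  "L2 = {f. f \<in> borel_measurable lebesgue \<and> integrable lebesgue (\<lambda>x. (norm (f x))\<^sup>2)}"

definition L2_inner :: "('a::euclidean_space \<Rightarrow> complex) \<Rightarrow> ('a \<Rightarrow> complex) \<Rightarrow> complex" where
  "L2_inner f g = (LINT x|lebesgue. f x * cnj (g x))"

definition L2_norm :: "('a::euclidean_space \<Rightarrow> complex) \<Rightarrow> real" where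
  "L2_norm f = sqrt (LINT x|lebesgue. (norm (f x))\<^sup>2)"

definition L2_dist :: "('a::euclidean_space \<Rightarrow> complex) \<Rightarrow> ('a \<Rightarrow> complex) \<Rightarrow> real" where
  "L2_dist f g = L2_norm (\<lambda>x. f x - g x)"

text \<open>A set of functions that is a Hilbert space for the \<open>L\<^sup>2\<close> inner product.  The condition
  \<^const>\<open>Metric_space\<close> entails that distinct members of \<open>V\<close> are not equal almost everywhere, so
  \<open>V\<close> embeds into the space of equivalence classes.\<close>

definition L2_Hilbert_space :: "('a::euclidean_space \<Rightarrow> complex) set \<Rightarrow> bool" where
  "L2_Hilbert_space V \<longleftrightarrow>
     V \<subseteq> L2 \<and> (\<lambda>x. 0) \<in> V \<and>
     (\<forall>f\<in>V. \<forall>g\<in>V. (\<lambda>x. f x + g x) \<in> V) \<and>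
     (\<forall>c. \<forall>f\<in>V. (\<lambda>x. c * f x) \<in> V) \<and>
     Metric_space V L2_dist \<and> Metric_space.mcomplete V L2_dist"

definition L2_orthogonal ::
    "('a::euclidean_space \<Rightarrow> complex) set \<Rightarrow> ('a \<Rightarrow> complex) set \<Rightarrow> bool" where
  "L2_orthogonal V W \<longleftrightarrow> (\<forall>f\<in>V. \<forall>g\<in>W. L2_inner f g = 0)"

text \<open>The Hilbert sum of a sequence of pairwise orthogonal Hilbert subspaces \<open>V l\<close>: the set of all
  sums \<open>\<Sum>\<^sub>l F\<^sub>l\<close>, convergent in \<open>L\<^sup>2\<close>, with \<open>F\<^sub>l \<in> V l\<close> and \<open>\<Sum>\<^sub>l \<parallel>F\<^sub>l\<parallel>\<^sup>2 < \<infinity>\<close>.\<close>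

definition L2_Hilbert_sum ::
    "(nat \<Rightarrow> ('a::euclidean_space \<Rightarrow> complex) set) \<Rightarrow> ('a \<Rightarrow> complex) set" where
  "L2_Hilbert_sum V =
     {f \<in> L2. \<exists>F. (\<forall>l. F l \<in> V l) \<and> summable (\<lambda>l. (L2_norm (F l))\<^sup>2) \<and>
                  (\<lambda>N. L2_dist f (\<lambda>x. \<Sum>l<N. F l x)) \<longlonglongrightarrow> 0}"

section \<open>The eigenspaces\<close>

definition A2 :: "real \<Rightarrow> real \<Rightarrow> complex \<Rightarrow> (complex^'n::finite \<Rightarrow> complex) set" where
  "A2 \<nu> \<mu> lam = {F \<in> L2. smooth F \<and>
     (\<forall>z. Delta \<nu> \<mu> F z = - 2 * of_real \<mu> * (2 * lam + of_nat CARD('n)) * F z)}"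

end

theory Submission
  imports Defs "HOL-Probability.Distributions" "HOL-Real_Asymp.Real_Asymp"
begin

text \<open>The operator \<Delta> commutes with the twisted translations of \<open>\<complex>\<^sup>n\<close>.  Everything below therefore runs
  through integral operators whose kernel is a fixed unimodular phase times a function \<open>q\<close> of
  \<open>|z - w|\<^sup>2\<close>; they are written \<open>tint \<nu> \<mu> q\<close>.  On such kernels \<Delta> acts as an ordinary
  differential operator on \<open>q\<close> (\<open>Delta_tker\<close>), and since the kernels are hermitian and \<Delta> is
  symmetric, every square integrable eigenfunction \<open>F\<close> with eigenvalue \<open>\<kappa>\<close> satisfies
  \<open>tint (D q) F = \<kappa> tint q F\<close>, where \<open>D\<close> is that ordinary differential operator
  (\<open>eigenfunction_radial\<close>).  This needs no information on the derivatives of \<open>F\<close>, because only \<open>q\<close>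
  has to be cut off.
  
  Two families of profiles \<open>q\<close> are tested.  For the Gaussians \<open>q s = exp (- \<mu> a s)\<close> the identity becomes a
  first order linear differential equation in \<open>a\<close>.  Its solution is explicit up to a constant, and the
  constant is found by letting \<open>a\<close> tend to infinity, where the Gaussians concentrate.  With
  \<open>r = (a - 1/2) / (a + 1/2)\<close> and \<open>M\<^sub>r\<close> the normalised Gaussian operator this says
  \<open>M\<^sub>r F = r\<^sup>\<lambda> F\<close> (\<open>eigenfunction_gauss_int\<close>).  For the Laguerre functions
  \<open>q s = exp (- \<mu> s / 2) L\<^sub>l (\<mu> s)\<close> the profile is itself an eigenfunction of \<open>D\<close>; the corresponding
  operator, suitably normalised, is called \<open>P\<^sub>l\<close>.  It maps \<open>L\<^sup>2\<close> into the eigenspace of \<open>l\<close>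
  (\<open>tint_lagq_in_A2\<close>) and kills every eigenfunction whose parameter \<open>\<lambda>\<close> is not \<open>l\<close>
  (\<open>A2_tint_lagq_zero\<close>).
  
  The two families are tied together by the generating function of the Laguerre polynomials, which
  reads \<open>M\<^sub>r = \<Sum>\<^sub>l r\<^sup>l P\<^sub>l\<close>.  Comparing both formulas for \<open>M\<^sub>r F\<close> at one value \<open>r = 1/4\<close>, small enough
  for the series to converge on all of \<open>L\<^sup>2\<close>, gives \<open>F = 0\<close> unless \<open>\<lambda>\<close> is a natural number \<open>l\<close>
  (\<open>A2_trivial\<close>), and \<open>P\<^sub>l F = F\<close> in that case (\<open>A2_reproducing\<close>).
  
  Hence the eigenspace of \<open>l\<close> is the range of \<open>P\<^sub>l\<close>, and the \<open>P\<^sub>l\<close> are self-adjoint idempotents that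
  annihilate each other.  Orthogonality is immediate; completeness of the eigenspaces holds because
  \<open>F \<mapsto> P\<^sub>l F z\<close> is \<open>L\<^sup>2\<close>-continuous for each \<open>z\<close>.  That the spaces exhaust \<open>L\<^sup>2\<close> is Parseval's identity
  \<open>\<parallel>g\<parallel>\<^sup>2 = \<Sum>\<^sub>l \<parallel>P\<^sub>l g\<parallel>\<^sup>2\<close>.  It is first shown for continuous \<open>g\<close> of compact support, by letting \<open>r\<close> tend
  to \<open>1\<close> in \<open>\<langle>M\<^sub>r g, g\<rangle> = \<Sum>\<^sub>l r\<^sup>l \<parallel>P\<^sub>l g\<parallel>\<^sup>2\<close> (\<open>Parseval_compact_support\<close>), and then carried over to
  \<open>L\<^sup>2\<close> by density (\<open>landau_sum_tendsto\<close>).\<close>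

section \<open>Calculus of smooth functions\<close>

lemma frechet_derivative_eqI:
  "(f has_derivative f') (at x) \<Longrightarrow> frechet_derivative f (at x) = f'"
  by (metis frechet_derivative_at)

lemma C_k_SucI:
  assumes "\<And>x. (f has_derivative f' x) (at x)" "\<And>v. C_k k (\<lambda>x. f' x v)"
  shows "C_k (Suc k) f"
  using assms by (auto simp: frechet_derivative_eqI[OF assms(1)] differentiable_def)

lemma C_k_SucD_has_derivative:
  "C_k (Suc k) f \<Longrightarrow> (f has_derivative frechet_derivative f (at x)) (at x)"
  by (simp add: frechet_derivative_works[symmetric])

lemma C_k_pred: "C_k (Suc k) f \<Longrightarrow> C_k k f"
proof (induction k arbitrary: f)
  case 0
  then show ?case
    by (auto intro!: differentiable_imp_continuous_on simp: differentiable_on_def differentiable_at_withinI)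
next
  case (Suc k)
  then show ?case by (metis C_k.simps(2))
qed

lemma C_k_continuous: "C_k k f \<Longrightarrow> continuous_on UNIV f"
  by (induction k) (use C_k_pred in auto)

lemma C_k_const: "C_k k (\<lambda>x. c)"
proof (induction k arbitrary: c)
  case (Suc k)
  show ?case by (rule C_k_SucI[where f' = "\<lambda>_ _. 0"]) (auto intro: Suc)
qed simp

lemma C_k_bounded_linear: "bounded_linear f \<Longrightarrow> C_k k f"
proof (cases k)
  case (Suc m)
  assume "bounded_linear f"
  then show ?thesis unfolding Suc
    by (intro C_k_SucI[where f' = "\<lambda>_. f"] C_k_const bounded_linear_imp_has_derivative)
qed (simp add: linear_continuous_on)

lemma C_k_linear_comp: "bounded_linear L \<Longrightarrow> C_k k f \<Longrightarrow> C_k k (\<lambda>x. L (f x))"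
proof (induction k arbitrary: f)
  case 0
  then show ?case by (auto intro: continuous_on_compose2[OF linear_continuous_on])
next
  case (Suc k)
  show ?case
  proof (rule C_k_SucI[where f' = "\<lambda>x v. L (frechet_derivative f (at x) v)"])
    show "((\<lambda>x. L (f x)) has_derivative (\<lambda>v. L (frechet_derivative f (at x) v))) (at x)" for x
      by (rule bounded_linear.has_derivative[OF Suc.prems(1) C_k_SucD_has_derivative[OF Suc.prems(2)]])
    show "C_k k (\<lambda>x. L (frechet_derivative f (at x) v))" for v
      by (rule Suc.IH[OF Suc.prems(1)]) (use Suc.prems(2) in simp)
  qed
qed

lemma C_k_add: "C_k k f \<Longrightarrow> C_k k g \<Longrightarrow> C_k k (\<lambda>x. f x + g x)"
proof (induction k arbitrary: f g)
  case 0
  then show ?case by (auto intro: continuous_on_add)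
next
  case (Suc k)
  show ?case
  proof (rule C_k_SucI[where f' = "\<lambda>x v. frechet_derivative f (at x) v + frechet_derivative g (at x) v"])
    show "((\<lambda>x. f x + g x) has_derivative (\<lambda>v. frechet_derivative f (at x) v + frechet_derivative g (at x) v)) (at x)" for x
      by (rule has_derivative_add[OF Suc.prems[THEN C_k_SucD_has_derivative]])
    show "C_k k (\<lambda>x. frechet_derivative f (at x) v + frechet_derivative g (at x) v)" for v
      by (rule Suc.IH) (use Suc.prems in simp_all)
  qed
qed

lemma C_k_mult:
  fixes f g :: "'a::real_normed_vector \<Rightarrow> 'b::real_normed_algebra"
  shows "C_k k f \<Longrightarrow> C_k k g \<Longrightarrow> C_k k (\<lambda>x. f x * g x)"
proof (induction k arbitrary: f g)
  case 0
  then show ?case by (auto intro: continuous_on_mult)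
next
  case (Suc k)
  show ?case
  proof (rule C_k_SucI[where f' = "\<lambda>x v. f x * frechet_derivative g (at x) v + frechet_derivative f (at x) v * g x"])
    show "((\<lambda>x. f x * g x) has_derivative
       (\<lambda>v. f x * frechet_derivative g (at x) v + frechet_derivative f (at x) v * g x)) (at x)" for x
      by (rule has_derivative_mult[OF Suc.prems[THEN C_k_SucD_has_derivative]])
    show "C_k k (\<lambda>x. f x * frechet_derivative g (at x) v + frechet_derivative f (at x) v * g x)" for v
      by (rule C_k_add; rule Suc.IH)
        (use Suc.prems Suc.prems[THEN C_k_pred] in simp_all)
  qed
qed

lemma C_k_sum: "(\<And>i. i \<in> I \<Longrightarrow> C_k k (f i)) \<Longrightarrow> C_k k (\<lambda>x. \<Sum>i\<in>I. f i x)"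
  by (induction I rule: infinite_finite_induct) (auto intro: C_k_const C_k_add)

lemma has_derivative_exp_complex:
  fixes f :: "'a::real_normed_vector \<Rightarrow> complex"
  assumes "(f has_derivative f') (at x)"
  shows "((\<lambda>x. exp (f x)) has_derivative (\<lambda>v. exp (f x) * f' v)) (at x)"
  using has_derivative_compose[OF assms DERIV_exp[THEN has_field_derivative_imp_has_derivative]]
  by simp

lemma C_k_exp:
  fixes f :: "'a::real_normed_vector \<Rightarrow> complex"
  shows "C_k k f \<Longrightarrow> C_k k (\<lambda>x. exp (f x))"
proof (induction k)
  case 0
  then show ?case by (auto intro: continuous_on_exp)
next
  case (Suc k)
  show ?case
  proof (rule C_k_SucI[where f' = "\<lambda>x v. exp (f x) * frechet_derivative f (at x) v"])
    show "((\<lambda>x. exp (f x)) has_derivative (\<lambda>v. exp (f x) * frechet_derivative f (at x) v)) (at x)" for x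
      by (rule has_derivative_exp_complex[OF C_k_SucD_has_derivative[OF Suc.prems]])
    show "C_k k (\<lambda>x. exp (f x) * frechet_derivative f (at x) v)" for v
      by (rule C_k_mult[OF Suc.IH[OF C_k_pred[OF Suc.prems]]]) (use Suc.prems in simp)
  qed
qed

text \<open>The chain rule is split off one derivative at a time, so that the outer function need only have as
  many derivatives as are available; the cutoff functions used later are not smooth.\<close>

lemma C_k_real_comp:
  fixes f :: "'a::real_normed_vector \<Rightarrow> real" and q q1 :: "real \<Rightarrow> real"
  assumes "C_k (Suc k) f" "\<And>x. (q has_real_derivative q1 x) (at x)" "C_k k (\<lambda>x. q1 (f x))"
  shows "C_k (Suc k) (\<lambda>x. q (f x))"
proof (rule C_k_SucI[where f' = "\<lambda>x v. q1 (f x) * frechet_derivative f (at x) v"])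
  show "((\<lambda>x. q (f x)) has_derivative (\<lambda>v. q1 (f x) * frechet_derivative f (at x) v)) (at x)" for x
    by (rule has_derivative_compose[OF C_k_SucD_has_derivative[OF assms(1)]
        assms(2)[THEN has_field_derivative_imp_has_derivative]])
  show "C_k k (\<lambda>x. q1 (f x) * frechet_derivative f (at x) v)" for v
    by (rule C_k_mult[OF assms(3)]) (use assms(1) in simp)
qed

lemma smooth_rules:
  "smooth (\<lambda>x. c)"
  "smooth f \<Longrightarrow> smooth g \<Longrightarrow> smooth (\<lambda>x. f x + g x)"
  "bounded_linear L \<Longrightarrow> smooth L"
  "bounded_linear L \<Longrightarrow> smooth f \<Longrightarrow> smooth (\<lambda>x. L (f x))"
  by (auto simp: smooth_def intro: C_k_const C_k_add C_k_bounded_linear C_k_linear_comp)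

lemma smooth_mult:
  fixes f g :: "'a::real_normed_vector \<Rightarrow> 'b::real_normed_algebra"
  shows "smooth f \<Longrightarrow> smooth g \<Longrightarrow> smooth (\<lambda>x. f x * g x)"
  by (auto simp: smooth_def intro: C_k_mult)

lemma smooth_exp:
  fixes f :: "'a::real_normed_vector \<Rightarrow> complex"
  shows "smooth f \<Longrightarrow> smooth (\<lambda>x. exp (f x))"
  by (auto simp: smooth_def intro: C_k_exp)

lemma smooth_sum: "(\<And>i. i \<in> I \<Longrightarrow> smooth (f i)) \<Longrightarrow> smooth (\<lambda>x. \<Sum>i\<in>I. f i x)"
  by (auto simp: smooth_def intro: C_k_sum)

lemma smooth_continuous: "smooth f \<Longrightarrow> continuous_on UNIV f"
  using C_k_continuous by (auto simp: smooth_def)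

lemma smooth_has_derivative: "smooth f \<Longrightarrow> (f has_derivative frechet_derivative f (at x)) (at x)"
  by (auto simp: smooth_def intro: C_k_SucD_has_derivative)

lemma smooth_derivative: "smooth f \<Longrightarrow> smooth (\<lambda>x. frechet_derivative f (at x) v)"
  unfolding smooth_def using C_k.simps(2) by blast

section \<open>Wirtinger calculus\<close>

lemma d_z_eqI:
  "(F has_derivative F') (at z) \<Longrightarrow> d_z j F z = (F' (axis j 1) - \<i> * F' (axis j \<i>)) / 2"
  "(F has_derivative F') (at z) \<Longrightarrow> d_zbar j F z = (F' (axis j 1) + \<i> * F' (axis j \<i>)) / 2"
  by (simp_all add: d_z_def d_zbar_def frechet_derivative_eqI)

lemma d_z_mult:
  assumes "F differentiable (at z)" "G differentiable (at z)"
  shows "d_z j (\<lambda>z. F z * G z) z = F z * d_z j G z + d_z j F z * G z"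
    and "d_zbar j (\<lambda>z. F z * G z) z = F z * d_zbar j G z + d_zbar j F z * G z"
  using frechet_derivative_eqI[OF has_derivative_mult[OF assms[unfolded frechet_derivative_works]]]
  by (simp_all add: d_z_def d_zbar_def field_simps)

lemma d_z_add:
  assumes "F differentiable (at z)" "G differentiable (at z)"
  shows "d_z j (\<lambda>z. F z + G z) z = d_z j F z + d_z j G z"
    and "d_zbar j (\<lambda>z. F z + G z) z = d_zbar j F z + d_zbar j G z"
  using frechet_derivative_eqI[OF has_derivative_add[OF assms[unfolded frechet_derivative_works]]]
  by (simp_all add: d_z_def d_zbar_def field_simps)

lemma d_z_const [simp]: "d_z j (\<lambda>z. c) z = 0" "d_zbar j (\<lambda>z. c) z = 0"
  using d_z_eqI[OF has_derivative_const] by auto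

lemma d_z_cnj:
  assumes "F differentiable (at z)"
  shows "d_z j (\<lambda>z. cnj (F z)) z = cnj (d_zbar j F z)"
    and "d_zbar j (\<lambda>z. cnj (F z)) z = cnj (d_z j F z)"
  using frechet_derivative_eqI[OF has_derivative_cnj[OF assms[unfolded frechet_derivative_works]]]
  by (simp_all add: d_z_def d_zbar_def)

lemma bounded_linear_cnj_nth: "bounded_linear (\<lambda>z::complex^'n. cnj (z $ j))"
  by (rule bounded_linear_compose[OF bounded_linear_cnj bounded_linear_vec_nth])

lemma d_z_coordinate:
  "d_z j (\<lambda>z. z $ j) (z::complex^'n::finite) = 1" "d_zbar j (\<lambda>z. z $ j) z = 0"
  "d_z j (\<lambda>z. cnj (z $ j)) z = 0" "d_zbar j (\<lambda>z. cnj (z $ j)) z = 1"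
  using d_z_eqI[OF bounded_linear_imp_has_derivative[OF bounded_linear_vec_nth, of j "at z"], of j]
    d_z_eqI[OF bounded_linear_imp_has_derivative[OF bounded_linear_cnj_nth, of j "at z"], of j]
  by (auto simp: axis_def)

section \<open>Hermitian form, phase and twisted radial kernels\<close>

text \<open>The hermitian form is kept complex valued because the exponents below are not functions of the real
  inner product \<open>z \<bullet> w\<close> alone: \<open>Im (herm z w)\<close> is the symplectic form.\<close>

definition herm :: "complex^'n::finite \<Rightarrow> complex^'n \<Rightarrow> complex" where
  "herm z w = (\<Sum>j\<in>UNIV. z $ j * cnj (w $ j))"

lemma herm_simps:
  "herm (x + y) w = herm x w + herm y w" "herm w (x + y) = herm w x + herm w y"
  "herm (x - y) w = herm x w - herm y w" "herm w (x - y) = herm w x - herm w y"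
  by (simp_all add: herm_def algebra_simps sum.distrib sum_subtractf)

lemma cnj_herm [simp]: "cnj (herm z w) = herm w z"
  by (simp add: herm_def mult.commute)

lemma herm_axis [simp]: "herm (axis j c) w = c * cnj (w $ j)" "herm w (axis j c) = w $ j * cnj c"
proof -
  have "(\<Sum>i\<in>UNIV. axis j c $ i * cnj (w $ i)) = (\<Sum>i\<in>UNIV. if i = j then c * cnj (w $ i) else 0)"
    by (intro sum.cong) (auto simp: axis_def)
  then show "herm (axis j c) w = c * cnj (w $ j)" by (simp add: herm_def)
  have "(\<Sum>i\<in>UNIV. w $ i * cnj (axis j c $ i)) = (\<Sum>i\<in>UNIV. if i = j then w $ i * cnj c else 0)"
    by (intro sum.cong) (auto simp: axis_def)
  then show "herm w (axis j c) = w $ j * cnj c" by (simp add: herm_def)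
qed

lemma Re_herm: "Re (herm z w) = z \<bullet> w"
  by (simp add: herm_def inner_vec_def inner_complex_def)

lemma herm_self: "herm z z = of_real ((norm z)\<^sup>2)"
proof -
  have "Im (herm z z) = 0"
    using arg_cong[OF cnj_herm[of z z], of Im] by (simp del: cnj_herm)
  then show ?thesis
    by (simp add: complex_eq_iff Re_herm power2_norm_eq_inner del: of_real_power)
qed

lemma bounded_linear_herm: "bounded_linear (\<lambda>z. herm z w)" "bounded_linear (\<lambda>z. herm w z)"
  unfolding herm_def
  by (intro bounded_linear_sum bounded_linear_mult_const bounded_linear_const_mult
      bounded_linear_vec_nth bounded_linear_cnj_nth)+

lemma norm_herm_le: "norm (herm z w) \<le> norm z * norm w"
proof -
  have "norm (herm z w) \<le> (\<Sum>j\<in>UNIV. norm (z $ j) * norm (w $ j))"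
    unfolding herm_def by (rule order_trans[OF norm_sum]) (simp add: norm_mult)
  also have "\<dots> \<le> norm z * norm w"
    unfolding norm_vec_def using L2_set_mult_ineq[of "\<lambda>j. norm (z $ j)" "\<lambda>j. norm (w $ j)" UNIV] by simp
  finally show ?thesis .
qed

lemma continuous_on_herm [continuous_intros]:
  "continuous_on A f \<Longrightarrow> continuous_on A g \<Longrightarrow> continuous_on A (\<lambda>x. herm (f x) (g x))"
  unfolding herm_def by (intro continuous_intros)

text \<open>The first summand is the gauge change that removes \<nu> from \<Delta>.  The second equals
  \<open>\<i> \<mu> Im (herm z w)\<close>, the phase of the twisted translations that commute with the operator for
  \<open>\<nu> = 0\<close>.\<close>

definition theta :: "real \<Rightarrow> real \<Rightarrow> complex^'n::finite \<Rightarrow> complex^'n \<Rightarrow> complex" where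
  "theta \<nu> \<mu> z w = - (\<i> * of_real \<nu> / 2) * (herm z z - herm w w)
     + (of_real \<mu> / 2) * (herm z w - herm w z)"

definition phase :: "real \<Rightarrow> real \<Rightarrow> complex^'n::finite \<Rightarrow> complex^'n \<Rightarrow> complex" where
  "phase \<nu> \<mu> z w = exp (theta \<nu> \<mu> z w)"

definition tker :: "real \<Rightarrow> real \<Rightarrow> (real \<Rightarrow> real) \<Rightarrow> complex^'n::finite \<Rightarrow> complex^'n \<Rightarrow> complex" where
  "tker \<nu> \<mu> q z w = phase \<nu> \<mu> z w * of_real (q ((norm (z - w))\<^sup>2))"

lemma cnj_theta: "cnj (theta \<nu> \<mu> z w) = theta \<nu> \<mu> w z"
  by (simp add: theta_def algebra_simps)

lemma cnj_phase: "cnj (phase \<nu> \<mu> z w) = phase \<nu> \<mu> w z"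
  by (simp add: phase_def exp_cnj cnj_theta)

lemma theta_antisym: "theta \<nu> \<mu> w z = - theta \<nu> \<mu> z w"
  by (simp add: theta_def field_simps)

lemma norm_phase [simp]: "norm (phase \<nu> \<mu> z w) = 1"
proof -
  have "Re (theta \<nu> \<mu> z w) = 0"
    using arg_cong[OF cnj_theta[of \<nu> \<mu> z w], of Re] by (simp add: theta_antisym[of \<nu> \<mu> w z])
  then show ?thesis by (simp add: phase_def)
qed

lemma phase_self [simp]: "phase \<nu> \<mu> z z = 1"
  by (simp add: phase_def theta_def)

lemma cnj_tker: "cnj (tker \<nu> \<mu> q z w) = tker \<nu> \<mu> q w z"
  by (simp add: tker_def cnj_phase norm_minus_commute)

lemma norm_tker: "norm (tker \<nu> \<mu> q z w) = \<bar>q ((norm (z - w))\<^sup>2)\<bar>"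
  by (simp add: tker_def norm_mult)

lemma bounded_bilinear_herm: "bounded_bilinear herm"
proof
  show "\<exists>K. \<forall>a b. norm (herm a b) \<le> norm a * norm b * K"
    by (rule exI[of _ 1]) (simp add: norm_herm_le)
  show "herm (r *\<^sub>R a) b = r *\<^sub>R herm a b" "herm a (r *\<^sub>R b) = r *\<^sub>R herm a b" for r and a b :: "complex^'n"
    using bounded_linear_herm[THEN bounded_linear.linear, THEN linear_cmul] by auto
qed (simp_all add: herm_simps)

lemma has_derivative_herm_self:
  "((\<lambda>z. herm z z) has_derivative (\<lambda>v. herm v z + herm z v)) (at z)"
  by (rule has_derivative_eq_rhs[OF bounded_bilinear.FDERIV[OF bounded_bilinear_herm has_derivative_ident has_derivative_ident]])
    (simp add: add.commute)

lemma has_derivative_theta: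
  "((\<lambda>z. theta \<nu> \<mu> z w) has_derivative
     (\<lambda>v. - (\<i> * of_real \<nu> / 2) * (herm v z + herm z v) + (of_real \<mu> / 2) * (herm v w - herm w v))) (at z)"
proof -
  have "((\<lambda>z. - (\<i> * of_real \<nu> / 2) * (herm z z - herm w w) + (of_real \<mu> / 2) * (herm z w - herm w z))
    has_derivative
     (\<lambda>v. - (\<i> * of_real \<nu> / 2) * (herm v z + herm z v - 0) + (of_real \<mu> / 2) * (herm v w - herm w v))) (at z)"
    by (intro has_derivative_add has_derivative_mult_right has_derivative_diff has_derivative_const
        has_derivative_herm_self bounded_linear_imp_has_derivative bounded_linear_herm)
  then show ?thesis by (simp add: theta_def)
qed

lemma has_derivative_tker:
  assumes "\<And>x. (q has_real_derivative q1 x) (at x)"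
  shows "((\<lambda>z. tker \<nu> \<mu> q z w) has_derivative
    (\<lambda>v. (- (\<i> * of_real \<nu> / 2) * (herm v z + herm z v) + (of_real \<mu> / 2) * (herm v w - herm w v))
          * tker \<nu> \<mu> q z w + of_real (2 * ((z - w) \<bullet> v)) * tker \<nu> \<mu> q1 z w)) (at z)"
proof -
  have n: "((\<lambda>z. (norm (z - w))\<^sup>2) has_derivative (\<lambda>v. 2 * ((z - w) \<bullet> v))) (at z)"
    unfolding power2_norm_eq_inner
    by (rule has_derivative_eq_rhs[OF has_derivative_inner[OF has_derivative_diff[OF has_derivative_ident has_derivative_const]
        has_derivative_diff[OF has_derivative_ident has_derivative_const]]]) (simp add: inner_commute)
  have q: "((\<lambda>z. complex_of_real (q ((norm (z - w))\<^sup>2))) has_derivative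
      (\<lambda>v. of_real (q1 ((norm (z - w))\<^sup>2) * (2 * ((z - w) \<bullet> v))))) (at z)"
    by (intro has_derivative_of_real
        has_derivative_compose[OF n assms[THEN has_field_derivative_imp_has_derivative]])
  show ?thesis
    unfolding tker_def phase_def
    by (rule has_derivative_eq_rhs[OF has_derivative_mult[OF has_derivative_exp_complex[OF has_derivative_theta] q]])
      (simp add: ac_simps)
qed

lemma tker_differentiable:
  assumes "\<And>x. (q has_real_derivative q1 x) (at x)"
  shows "(\<lambda>z. tker \<nu> \<mu> q z w) differentiable (at z)"
  using has_derivative_tker[OF assms] differentiable_def by blast

lemma d_z_tker:
  fixes z w :: "complex^'n::finite"
  assumes "\<And>x. (q has_real_derivative q1 x) (at x)"
  shows "d_z j (\<lambda>z. tker \<nu> \<mu> q z w) z =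
      (- (\<i> * of_real \<nu> / 2) * cnj (z $ j) + (of_real \<mu> / 2) * cnj (w $ j)) * tker \<nu> \<mu> q z w
      + (cnj (z $ j) - cnj (w $ j)) * tker \<nu> \<mu> q1 z w" (is ?A)
   and "d_zbar j (\<lambda>z. tker \<nu> \<mu> q z w) z =
      (- (\<i> * of_real \<nu> / 2) * z $ j + (- of_real \<mu> / 2) * w $ j) * tker \<nu> \<mu> q z w
      + (z $ j - w $ j) * tker \<nu> \<mu> q1 z w" (is ?B)
proof -
  have c: "complex_of_real (x \<bullet> axis j 1) = of_real (Re (x $ j))"
     "complex_of_real (x \<bullet> axis j \<i>) = of_real (Im (x $ j))" for x :: "complex^'n"
    by (simp_all add: inner_axis inner_complex_def)
  have e: "a = of_real (Re a) + \<i> * of_real (Im a)" "cnj a = of_real (Re a) - \<i> * of_real (Im a)" for a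
    by (simp_all add: complex_eq_iff)
  have r: "z $ j - w $ j = of_real (Re (z$j)) - of_real (Re (w $ j)) + \<i> * (of_real (Im (z$j)) - of_real (Im (w$j)))"
     "cnj (z $ j) - cnj (w $ j) = of_real (Re (z$j)) - of_real (Re (w $ j)) - \<i> * (of_real (Im (z$j)) - of_real (Im (w$j)))"
    by (simp_all add: complex_eq_iff)
  show ?A ?B
    by (simp_all only: d_z_eqI[OF has_derivative_tker[OF assms]] herm_axis of_real_mult c r)
      (simp_all add: field_simps)
qed

text \<open>The phase is chosen precisely so that all first order terms and all terms with the position \<open>z\<close>
  itself cancel and only functions of \<open>s = |z - w|\<^sup>2\<close> remain.  Coordinate by coordinate this is a
  polynomial identity in \<open>z\<^sub>j\<close>, \<open>w\<^sub>j\<close> and their conjugates.\<close>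

lemma Delta_tker:
  fixes z w :: "complex^'n::finite"
  assumes q: "\<And>x. (q has_real_derivative q1 x) (at x)" and q1: "\<And>x. (q1 has_real_derivative q2 x) (at x)"
  shows "Delta \<nu> \<mu> (\<lambda>z. tker \<nu> \<mu> q z w) z =
    tker \<nu> \<mu> (\<lambda>s. 4 * s * q2 s + 4 * real CARD('n) * q1 s - \<mu>\<^sup>2 * s * q s) z w"
proof -
  define N where "N = complex_of_real \<nu>"
  define M where "M = complex_of_real \<mu>"
  define T0 where "T0 = tker \<nu> \<mu> q z w"
  define T1 where "T1 = tker \<nu> \<mu> q1 z w"
  define T2 where "T2 = tker \<nu> \<mu> q2 z w"
  have dd: "d_z j (d_zbar j (\<lambda>z. tker \<nu> \<mu> q z w)) z =
     (- (\<i> * N / 2) * z $ j + (- M / 2) * w $ j) * ((- (\<i> * N / 2) * cnj (z $ j) + (M / 2) * cnj (w $ j)) * T0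
      + (cnj (z $ j) - cnj (w $ j)) * T1) - (\<i> * N / 2) * T0
     + (z $ j - w $ j) * ((- (\<i> * N / 2) * cnj (z $ j) + (M / 2) * cnj (w $ j)) * T1
      + (cnj (z $ j) - cnj (w $ j)) * T2) + T1" for j
  proof -
    let ?b = "\<lambda>z::complex^'n. - (\<i> * N / 2) * z $ j + (- M / 2) * w $ j"
    let ?u = "\<lambda>z::complex^'n. z $ j + (- (w $ j))"
    have eq: "d_zbar j (\<lambda>z. tker \<nu> \<mu> q z w) = (\<lambda>z. ?b z * tker \<nu> \<mu> q z w + ?u z * tker \<nu> \<mu> q1 z w)"
      by (rule ext) (simp add: d_z_tker[OF q] N_def M_def)
    have n: "(\<lambda>z::complex^'n. z $ j) differentiable (at z)"
      by (intro bounded_linear_imp_differentiable bounded_linear_vec_nth)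
    have db: "?b differentiable (at z)" "?u differentiable (at z)"
      by (intro derivative_intros n)+
    have vb: "d_z j ?b z = - (\<i> * N / 2)" "d_z j ?u z = 1"
      using n by (simp_all only: d_z_add d_z_mult differentiable_const differentiable_mult d_z_const d_z_coordinate)
         simp_all
    note dt = tker_differentiable[where \<nu> = \<nu> and \<mu> = \<mu> and w = w and z = z]
    have "d_z j (\<lambda>z. ?b z * tker \<nu> \<mu> q z w + ?u z * tker \<nu> \<mu> q1 z w) z =
        ?b z * d_z j (\<lambda>z. tker \<nu> \<mu> q z w) z + d_z j ?b z * tker \<nu> \<mu> q z w
        + (?u z * d_z j (\<lambda>z. tker \<nu> \<mu> q1 z w) z + d_z j ?u z * tker \<nu> \<mu> q1 z w)"
      by (simp only: d_z_add(1)[OF differentiable_mult[OF db(1) dt[OF q]] differentiable_mult[OF db(2) dt[OF q1]]]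
          d_z_mult(1)[OF db(1) dt[OF q]] d_z_mult(1)[OF db(2) dt[OF q1]])
    then show ?thesis
      unfolding eq vb d_z_tker[OF q] d_z_tker[OF q1]
        N_def[symmetric] M_def[symmetric] T0_def[symmetric] T1_def[symmetric] T2_def[symmetric]
      by simp
  qed
  have key: "4 * d_z j (d_zbar j (\<lambda>z. tker \<nu> \<mu> q z w)) z
     + 2 * \<i> * N * (z $ j * d_z j (\<lambda>z. tker \<nu> \<mu> q z w) z + cnj (z $ j) * d_zbar j (\<lambda>z. tker \<nu> \<mu> q z w) z + T0)
     + 2 * M * (z $ j * d_z j (\<lambda>z. tker \<nu> \<mu> q z w) z - cnj (z $ j) * d_zbar j (\<lambda>z. tker \<nu> \<mu> q z w) z)
     - (N\<^sup>2 + M\<^sup>2) * (z $ j * cnj (z $ j)) * T0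
     = 4 * ((z - w) $ j * cnj ((z - w) $ j)) * T2 + 4 * T1 - M\<^sup>2 * ((z - w) $ j * cnj ((z - w) $ j)) * T0" for j
  proof -
    define a where "a = z $ j"
    define a' where "a' = cnj (z $ j)"
    define b where "b = w $ j"
    define b' where "b' = cnj (w $ j)"
    have i: "\<i> * \<i> = -1" by simp
    show ?thesis
      unfolding dd d_z_tker[OF q] T0_def[symmetric] T1_def[symmetric] N_def[symmetric] M_def[symmetric]
        vector_minus_component complex_cnj_diff a_def[symmetric] b_def[symmetric] a'_def[symmetric] b'_def[symmetric]
      using i by algebra
  qed
  have hz: "of_real ((norm z)\<^sup>2) = (\<Sum>j\<in>UNIV. z $ j * cnj (z $ j))" for z :: "complex^'n"
    by (simp only: herm_self[symmetric] herm_def)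
  have "Delta \<nu> \<mu> (\<lambda>z. tker \<nu> \<mu> q z w) z = (\<Sum>j\<in>UNIV. 4 * d_z j (d_zbar j (\<lambda>z. tker \<nu> \<mu> q z w)) z
     + 2 * \<i> * N * (z $ j * d_z j (\<lambda>z. tker \<nu> \<mu> q z w) z + cnj (z $ j) * d_zbar j (\<lambda>z. tker \<nu> \<mu> q z w) z + T0)
     + 2 * M * (z $ j * d_z j (\<lambda>z. tker \<nu> \<mu> q z w) z - cnj (z $ j) * d_zbar j (\<lambda>z. tker \<nu> \<mu> q z w) z)
     - (N\<^sup>2 + M\<^sup>2) * (z $ j * cnj (z $ j)) * T0)"
    unfolding Delta_def euler_def euler_bar_def of_real_mult of_real_add of_real_power[symmetric] N_def[symmetric] M_def[symmetric] T0_def[symmetric] hz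
    by (simp add: sum.distrib sum_subtractf sum_distrib_left sum_distrib_right algebra_simps N_def M_def)
  also have "\<dots> = (\<Sum>j\<in>UNIV. 4 * ((z - w) $ j * cnj ((z - w) $ j)) * T2 + 4 * T1 - M\<^sup>2 * ((z - w) $ j * cnj ((z - w) $ j)) * T0)"
    by (intro sum.cong refl key)
  also have "\<dots> = 4 * of_real ((norm (z - w))\<^sup>2) * T2 + 4 * of_nat CARD('n) * T1 - M\<^sup>2 * of_real ((norm (z - w))\<^sup>2) * T0"
    unfolding hz by (simp add: sum.distrib sum_subtractf sum_distrib_left sum_distrib_right algebra_simps)
  also have "\<dots> = tker \<nu> \<mu> (\<lambda>s. 4 * s * q2 s + 4 * real CARD('n) * q1 s - \<mu>\<^sup>2 * s * q s) z w"
    by (simp add: T0_def T1_def T2_def M_def tker_def algebra_simps)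
  finally show ?thesis .
qed

section \<open>Integration by parts\<close>

lemma integrable_continuous_compact_support:
  fixes f :: "'a::euclidean_space \<Rightarrow> 'b::{banach, second_countable_topology}"
  assumes "continuous_on UNIV f" "\<And>x. norm x > R \<Longrightarrow> f x = 0"
  shows "integrable lborel f" and "\<exists>B. \<forall>x. norm (f x) \<le> B"
proof -
  have "bounded (f ` cball 0 R)"
    by (intro compact_imp_bounded compact_continuous_image continuous_on_subset[OF assms(1)]) auto
  then obtain B where B: "\<And>x. x \<in> cball 0 R \<Longrightarrow> norm (f x) \<le> B" "B \<ge> 0"
    by (metis bounded_pos image_eqI less_eq_real_def)
  then have bd: "norm (f x) \<le> B" for x
    using assms(2)[of x] by (cases "norm x \<le> R") auto
  then show "\<exists>B. \<forall>x. norm (f x) \<le> B" by blast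
  have "integrable lborel (\<lambda>x::'a. B * indicat_real (cball 0 R) x)"
    by (intro integrable_mult_right integrable_real_indicator)
      (use emeasure_lborel_cball_finite in auto)
  moreover have "f \<in> borel_measurable lborel"
    using borel_measurable_continuous_onI[OF assms(1)] by simp
  moreover have "norm (f x) \<le> norm (B * indicat_real (cball 0 R) x)" for x
    using B assms(2)[of x] by (auto simp: indicator_def)
  ultimately show "integrable lborel f"
    by (rule Bochner_Integration.integrable_bound[OF _ _ AE_I2])
qed

lemma integral_lborel_translate:
  fixes f :: "'a::euclidean_space \<Rightarrow> 'b::{banach, second_countable_topology}"
  assumes "f \<in> borel_measurable borel"
  shows "(LINT x|lborel. f (c + x)) = (LINT x|lborel. f x)"
    and "integrable lborel (\<lambda>x. f (c + x)) \<longleftrightarrow> integrable lborel f"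
proof -
  have m: "(+) c \<in> lborel \<rightarrow>\<^sub>M borel" by measurable
  show "(LINT x|lborel. f (c + x)) = (LINT x|lborel. f x)"
    using integral_distr[OF m assms] unfolding lborel_distr_plus by (rule sym)
  show "integrable lborel (\<lambda>x. f (c + x)) \<longleftrightarrow> integrable lborel f"
    using integrable_distr_eq[OF m assms] unfolding lborel_distr_plus by (rule sym)
qed

text \<open>By translation invariance all difference quotients of \<open>H\<close> have integral zero; compact support and a
  bound on the derivative allow passage to the limit.\<close>

lemma integral_derivative_zero:
  fixes H :: "'a::euclidean_space \<Rightarrow> complex"
  assumes H: "C_k (Suc 0) H" and supp: "\<And>x. norm x > R \<Longrightarrow> H x = 0"
  shows "integrable lborel (\<lambda>x. frechet_derivative H (at x) v)"
    and "(LINT x|lborel. frechet_derivative H (at x) v) = 0"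
proof -
  define D where "D x = frechet_derivative H (at x) v" for x
  have d: "(H has_derivative frechet_derivative H (at x)) (at x)" for x
    by (rule C_k_SucD_has_derivative[OF H])
  have cD: "continuous_on UNIV D" using H by (simp add: D_def[abs_def])
  have supD: "D x = 0" if "norm x > R" for x
  proof -
    have "(H has_derivative (\<lambda>_. 0)) (at x)"
      by (rule has_derivative_transform_within_open[of "\<lambda>_. 0" _ _ _ "{x. norm x > R}"])
        (use that supp in \<open>auto intro!: open_Collect_less continuous_intros\<close>)
    then show ?thesis by (simp add: D_def frechet_derivative_eqI)
  qed
  obtain B where B: "\<And>x. norm (D x) \<le> B"
    using integrable_continuous_compact_support(2)[OF cD supD] by blast
  have "B \<ge> 0" using B order_trans[OF norm_ge_zero] by blast
  have cH: "continuous_on UNIV H" by (rule C_k_continuous[OF H])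
  have mH: "H \<in> borel_measurable borel" using cH by (rule borel_measurable_continuous_onI)
  have iH: "integrable lborel H" by (rule integrable_continuous_compact_support(1)[OF cH supp])
  show int: "integrable lborel (\<lambda>x. frechet_derivative H (at x) v)"
    using integrable_continuous_compact_support(1)[OF cD supD] by (simp add: D_def[abs_def])
  define t where "t n = inverse (real (Suc n))" for n
  have t: "t n > 0" "t n \<le> 1" for n by (auto simp: t_def field_simps)
  have t0: "t \<longlonglongrightarrow> 0" unfolding t_def by (rule LIMSEQ_inverse_real_of_nat)
  define s where "s n x = (H (t n *\<^sub>R v + x) - H x) /\<^sub>R t n" for n x
  have line: "((\<lambda>r. H (r *\<^sub>R v + x)) has_vector_derivative D (r *\<^sub>R v + x)) (at r within S)" for r x S
  proof -
    have "((\<lambda>r. H (r *\<^sub>R v + x)) has_derivative (\<lambda>h. frechet_derivative H (at (r *\<^sub>R v + x)) (h *\<^sub>R v))) (at r within S)"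
      by (rule has_derivative_compose[OF _ d]) (auto intro!: derivative_eq_intros)
    moreover have "frechet_derivative H (at (r *\<^sub>R v + x)) (h *\<^sub>R v) = h *\<^sub>R D (r *\<^sub>R v + x)" for h
      using linear_cmul[OF has_derivative_linear[OF d]] by (simp add: D_def)
    ultimately show ?thesis by (simp add: has_vector_derivative_def)
  qed
  have sB: "norm (s n x) \<le> B" for n x
  proof -
    have "norm (H (t n *\<^sub>R v + x) - H (0 *\<^sub>R v + x)) \<le> B * norm (t n - 0)"
      by (rule differentiable_bound[where S = UNIV and f' = "\<lambda>r h. h *\<^sub>R D (r *\<^sub>R v + x)"])
        (use line B \<open>B \<ge> 0\<close> in \<open>auto simp: has_vector_derivative_def mult.commute[of B] intro!: onorm_bound mult_left_mono\<close>)
    then have "norm (H (t n *\<^sub>R v + x) - H x) / t n \<le> B"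
      using t[of n] by (simp add: divide_le_eq)
    moreover have "norm (s n x) = norm (H (t n *\<^sub>R v + x) - H x) / t n"
      using t[of n] by (simp add: s_def divide_inverse mult.commute)
    ultimately show ?thesis by simp
  qed
  have slim: "(\<lambda>n. s n x) \<longlonglongrightarrow> D x" for x
  proof -
    have "((\<lambda>r. norm (H (r *\<^sub>R v + x) - H (0 *\<^sub>R v + x) - (r - 0) *\<^sub>R D (0 *\<^sub>R v + x)) / norm (r - 0)) \<longlongrightarrow> 0) (at 0)"
      using line[of x 0 UNIV] unfolding has_vector_derivative_def has_derivative_iff_norm by blast
    moreover have "filterlim t (at 0) sequentially"
      unfolding filterlim_at using t0 t(1) by (auto intro!: always_eventually simp: less_imp_neq[symmetric])
    ultimately have "(\<lambda>n. norm (H (t n *\<^sub>R v + x) - H (0 *\<^sub>R v + x) - (t n - 0) *\<^sub>R D (0 *\<^sub>R v + x)) / norm (t n - 0)) \<longlonglongrightarrow> 0"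
      by (rule filterlim_compose)
    also have "(\<lambda>n. norm (H (t n *\<^sub>R v + x) - H (0 *\<^sub>R v + x) - (t n - 0) *\<^sub>R D (0 *\<^sub>R v + x)) / norm (t n - 0))
        = (\<lambda>n. norm (s n x - D x))"
    proof
      fix n
      have "s n x - D x = (H (t n *\<^sub>R v + x) - H x - t n *\<^sub>R D x) /\<^sub>R t n"
        using t(1)[of n] by (simp add: s_def scaleR_diff_right)
      then show "norm (H (t n *\<^sub>R v + x) - H (0 *\<^sub>R v + x) - (t n - 0) *\<^sub>R D (0 *\<^sub>R v + x)) / norm (t n - 0) = norm (s n x - D x)"
        using t(1)[of n] by (simp add: divide_inverse mult.commute)
    qed
    finally show ?thesis by (simp add: tendsto_norm_zero_iff LIM_zero_iff)
  qed
  have s0: "(LINT x|lborel. s n x) = 0" for n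
    using integral_lborel_translate[OF mH, of "t n *\<^sub>R v"] iH by (simp add: s_def)
  have "(\<lambda>n. LINT x|lborel. s n x) \<longlonglongrightarrow> (LINT x|lborel. D x)"
  proof (rule integral_dominated_convergence[where w = "\<lambda>x. B * indicat_real (cball 0 (\<bar>R\<bar> + norm v)) x"])
    show "integrable lborel (\<lambda>x::'a. B * indicat_real (cball 0 (\<bar>R\<bar> + norm v)) x)"
      by (intro integrable_mult_right integrable_real_indicator) (use emeasure_lborel_cball_finite in auto)
    show "D \<in> borel_measurable lborel" using borel_measurable_continuous_onI[OF cD] by simp
    show "s n \<in> borel_measurable lborel" for n unfolding s_def using mH by measurable
    show "AE x in lborel. (\<lambda>n. s n x) \<longlonglongrightarrow> D x" using slim by simp
    have "norm (s n x) \<le> B * indicat_real (cball 0 (\<bar>R\<bar> + norm v)) x" for n x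
    proof (cases "x \<in> cball 0 (\<bar>R\<bar> + norm v)")
      case False
      have "norm (t n *\<^sub>R v) \<le> 1 * norm v" using t[of n] unfolding norm_scaleR by (intro mult_right_mono) auto
      then have "norm (t n *\<^sub>R v + x) > R"
        using False norm_triangle_ineq2[of x "- (t n *\<^sub>R v)"] by (auto simp: add.commute)
      moreover have "\<bar>R\<bar> + norm v < norm x" using False by (simp add: not_le)
      then have "norm x > R" using norm_ge_zero[of v] by linarith
      ultimately have "s n x = 0" using supp by (simp add: s_def)
      then show ?thesis using \<open>B \<ge> 0\<close> by (simp add: indicator_def)
    qed (use sB in simp)
    then show "AE x in lborel. norm (s n x) \<le> B * indicat_real (cball 0 (\<bar>R\<bar> + norm v)) x" for n by simp
  qed
  then show "(LINT x|lborel. frechet_derivative H (at x) v) = 0"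
    using LIMSEQ_unique[OF _ tendsto_const] unfolding s0 D_def[symmetric] by blast
qed

lemma integral_d_z_zero:
  fixes H :: "complex^'n::finite \<Rightarrow> complex"
  assumes "C_k (Suc 0) H" "\<And>x. norm x > R \<Longrightarrow> H x = 0"
  shows "integrable lborel (d_z j H)" "integrable lborel (d_zbar j H)"
    "(LINT z|lborel. d_z j H z) = 0" "(LINT z|lborel. d_zbar j H z) = 0"
  using integral_derivative_zero[OF assms] unfolding d_z_def d_zbar_def by simp_all

lemma C_k_cnj: "C_k k f \<Longrightarrow> C_k k (\<lambda>x. cnj (f x))"
  by (rule C_k_linear_comp[OF bounded_linear_cnj])

lemma C_k_d_z:
  assumes "C_k (Suc k) F"
  shows "C_k k (d_z j F)" "C_k k (d_zbar j F)"
proof -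
  have e: "d_z j F = (\<lambda>z. frechet_derivative F (at z) (axis j 1) * (1/2) + frechet_derivative F (at z) (axis j \<i>) * (- \<i> / 2))"
    "d_zbar j F = (\<lambda>z. frechet_derivative F (at z) (axis j 1) * (1/2) + frechet_derivative F (at z) (axis j \<i>) * (\<i> / 2))"
    by (auto simp: d_z_def d_zbar_def field_simps)
  show "C_k k (d_z j F)" "C_k k (d_zbar j F)"
    unfolding e using assms by (intro C_k_add C_k_mult C_k_const; simp)+
qed

lemma C_k_coordinate:
  "C_k k (\<lambda>z::complex^'n::finite. z $ j)" "C_k k (\<lambda>z::complex^'n::finite. cnj (z $ j))"
  by (intro C_k_bounded_linear bounded_linear_vec_nth bounded_linear_cnj_nth)+

lemma continuous_on_Delta:
  assumes "C_k (Suc (Suc 0)) F"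
  shows "continuous_on UNIV (Delta \<nu> \<mu> F)"
proof -
  have [continuous_intros]: "continuous_on UNIV (d_z j (d_zbar j F))" "continuous_on UNIV (d_z j F)"
      "continuous_on UNIV (d_zbar j F)" "continuous_on UNIV F" for j
    using assms C_k_pred[OF assms] by (auto intro!: C_k_continuous C_k_d_z simp del: C_k.simps(2))
  show ?thesis unfolding Delta_def euler_def euler_bar_def
    by (intro continuous_intros)
qed

text \<open>Green's formula: the difference of the two integrands is a sum of Wirtinger derivatives of compactly
  supported functions, namely of the functions \<open>X\<close>, \<open>Y\<close>, \<open>U\<close>, \<open>V\<close> of the proof.  Only \<open>\<psi>\<close> has
  compact support, so that \<open>F\<close> can be an arbitrary eigenfunction.\<close>

lemma Delta_symmetric:
  fixes F \<psi> :: "complex^'n::finite \<Rightarrow> complex"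
  assumes F: "C_k (Suc (Suc 0)) F" and \<psi>: "C_k (Suc (Suc 0)) \<psi>" and supp: "\<And>z. norm z > R \<Longrightarrow> \<psi> z = 0"
  shows "(LINT z|lborel. Delta \<nu> \<mu> F z * cnj (\<psi> z)) = (LINT z|lborel. F z * cnj (Delta \<nu> \<mu> \<psi> z))"
proof -
  define X where "X j z = d_zbar j F z * cnj (\<psi> z)" for j z
  define Y where "Y j z = F z * cnj (d_zbar j \<psi> z)" for j z
  define U where "U j z = z $ j * (F z * cnj (\<psi> z))" for j z
  define V where "V j z = cnj (z $ j) * (F z * cnj (\<psi> z))" for j z
  note Fp = C_k_pred[OF F] and \<psi>p = C_k_pred[OF \<psi>]
  have C: "C_k (Suc 0) (X j)" "C_k (Suc 0) (Y j)" "C_k (Suc 0) (U j)" "C_k (Suc 0) (V j)" for j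
    unfolding X_def[abs_def] Y_def[abs_def] U_def[abs_def] V_def[abs_def]
    by (intro C_k_mult C_k_cnj C_k_d_z C_k_coordinate F \<psi> Fp \<psi>p)+
  have "d_zbar j \<psi> z = 0" if "norm z > R" for j z
  proof -
    have "(\<psi> has_derivative (\<lambda>_. 0)) (at z)"
      by (rule has_derivative_transform_within_open[of "\<lambda>_. 0" _ _ _ "{x. norm x > R}"])
        (use that supp in \<open>auto intro!: open_Collect_less continuous_intros\<close>)
    then show ?thesis by (simp add: d_z_eqI)
  qed
  then have S: "X j z = 0" "Y j z = 0" "U j z = 0" "V j z = 0" if "norm z > R" for j z
    using supp[OF that] that by (simp_all add: X_def Y_def U_def V_def)
  note zX = integral_d_z_zero[OF C(1) S(1)] and zY = integral_d_z_zero[OF C(2) S(2)]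
    and zU = integral_d_z_zero[OF C(3) S(3)] and zV = integral_d_z_zero[OF C(4) S(4)]
  define W where "W z = (\<Sum>j\<in>UNIV. 4 * d_z j (X j) z - 4 * d_zbar j (Y j) z
      + (2 * \<i> * of_real \<nu> + 2 * of_real \<mu>) * d_z j (U j) z
      + (2 * \<i> * of_real \<nu> - 2 * of_real \<mu>) * d_zbar j (V j) z)" for z
  have intW: "integrable lborel W" "(LINT z|lborel. W z) = 0"
    unfolding W_def[abs_def] using zX zY zU zV by (simp_all add: Bochner_Integration.integral_sum)
  have dif: "F differentiable (at z)" "(\<lambda>z. cnj (\<psi> z)) differentiable (at z)" "\<psi> differentiable (at z)"
     "d_zbar j F differentiable (at z)" "d_zbar j \<psi> differentiable (at z)"
     "(\<lambda>z. cnj (d_zbar j \<psi> z)) differentiable (at z)"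
     "(\<lambda>z. F z * cnj (\<psi> z)) differentiable (at z)" 
     "(\<lambda>z::complex^'n. z $ j) differentiable (at z)" "(\<lambda>z::complex^'n. cnj (z $ j)) differentiable (at z)" for j z
    using Fp \<psi>p C_k_d_z(2)[OF F, of j] C_k_d_z(2)[OF \<psi>, of j] C_k_cnj[OF \<psi>p]
      C_k_cnj[OF C_k_d_z(2)[OF \<psi>], of j] C_k_mult[OF Fp C_k_cnj[OF \<psi>p]]
      C_k_coordinate[of "Suc 0" j]
    by simp_all
  have pt: "Delta \<nu> \<mu> F z * cnj (\<psi> z) - F z * cnj (Delta \<nu> \<mu> \<psi> z) = W z" for z
  proof -
    have "W z = (\<Sum>j\<in>UNIV. (4 * d_z j (d_zbar j F) z
       + 2 * \<i> * of_real \<nu> * (z $ j * d_z j F z + cnj (z $ j) * d_zbar j F z + F z)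
       + 2 * of_real \<mu> * (z $ j * d_z j F z - cnj (z $ j) * d_zbar j F z)) * cnj (\<psi> z)
       - F z * cnj (4 * d_z j (d_zbar j \<psi>) z
       + 2 * \<i> * of_real \<nu> * (z $ j * d_z j \<psi> z + cnj (z $ j) * d_zbar j \<psi> z + \<psi> z)
       + 2 * of_real \<mu> * (z $ j * d_z j \<psi> z - cnj (z $ j) * d_zbar j \<psi> z)))"
      unfolding W_def X_def[abs_def] Y_def[abs_def] U_def[abs_def] V_def[abs_def]
      by (intro sum.cong refl)
        (simp only: d_z_mult[OF dif(4) dif(2)] d_z_mult[OF dif(1) dif(6)] d_z_mult[OF dif(8) dif(7)]
           d_z_mult[OF dif(9) dif(7)] d_z_mult[OF dif(1) dif(2)] d_z_cnj[OF dif(3)] d_z_cnj[OF dif(5)]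
           d_z_coordinate, simp add: algebra_simps)
    also have "\<dots> = Delta \<nu> \<mu> F z * cnj (\<psi> z) - F z * cnj (Delta \<nu> \<mu> \<psi> z)"
      unfolding Delta_def euler_def euler_bar_def
      by (simp add: sum.distrib sum_subtractf sum_distrib_left sum_distrib_right sum_negf algebra_simps)
    finally show ?thesis by simp
  qed
  have i1: "integrable lborel (\<lambda>z. Delta \<nu> \<mu> F z * cnj (\<psi> z))"
    by (rule integrable_continuous_compact_support(1)[of _ R])
      (use supp C_k_continuous[OF C_k_cnj[OF \<psi>]] continuous_on_Delta[OF F] in \<open>auto intro!: continuous_on_mult\<close>)
  have e: "(\<lambda>z. F z * cnj (Delta \<nu> \<mu> \<psi> z)) = (\<lambda>z. Delta \<nu> \<mu> F z * cnj (\<psi> z) - W z)"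
    by (simp add: pt[symmetric])
  show ?thesis unfolding e using i1 intW by simp
qed

section \<open>The space of square integrable functions\<close>

lemma L2I: "f \<in> borel_measurable lebesgue \<Longrightarrow> integrable lebesgue (\<lambda>x. (norm (f x))\<^sup>2) \<Longrightarrow> f \<in> L2"
  by (simp add: L2_def)

lemma L2D:
  assumes "f \<in> L2"
  shows "f \<in> borel_measurable lebesgue" "integrable lebesgue (\<lambda>x. (norm (f x))\<^sup>2)"
  using assms by (auto simp: L2_def)

lemma L2_bound:
  assumes "g \<in> L2" "f \<in> borel_measurable lebesgue" "\<And>x. norm (f x) \<le> norm (g x)"
  shows "f \<in> L2"
proof (rule L2I[OF assms(2)])
  note [measurable] = assms(2)
  show "integrable lebesgue (\<lambda>x. (norm (f x))\<^sup>2)"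
    by (rule Bochner_Integration.integrable_bound[OF L2D(2)[OF assms(1)]])
      (auto intro!: power_mono assms(3))
qed

lemma L2_add:
  assumes "f \<in> L2" "g \<in> L2"
  shows "(\<lambda>x. f x + g x) \<in> L2"
proof (rule L2I)
  note [measurable] = L2D(1)[OF assms(1)] L2D(1)[OF assms(2)]
  show "(\<lambda>x. f x + g x) \<in> borel_measurable lebesgue" by measurable
  have i: "integrable lebesgue (\<lambda>x. 2 * (norm (f x))\<^sup>2 + 2 * (norm (g x))\<^sup>2)"
    using L2D(2)[OF assms(1)] L2D(2)[OF assms(2)] by simp
  have "(norm (f x + g x))\<^sup>2 \<le> 2 * (norm (f x))\<^sup>2 + 2 * (norm (g x))\<^sup>2" for x
  proof -
    have "(norm (f x + g x))\<^sup>2 \<le> (norm (f x) + norm (g x))\<^sup>2"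
      by (intro power_mono norm_triangle_ineq) simp
    also have "\<dots> \<le> 2 * (norm (f x))\<^sup>2 + 2 * (norm (g x))\<^sup>2"
      using sum_squares_bound[of "norm (f x)" "norm (g x)"] by (simp add: power2_sum)
    finally show ?thesis .
  qed
  then show "integrable lebesgue (\<lambda>x. (norm (f x + g x))\<^sup>2)"
    by (intro Bochner_Integration.integrable_bound[OF i]) auto
qed

lemma L2_cmult: "f \<in> L2 \<Longrightarrow> (\<lambda>x. c * f x) \<in> L2"
  by (auto simp: L2_def norm_mult power_mult_distrib)

lemma L2_diff: "f \<in> L2 \<Longrightarrow> g \<in> L2 \<Longrightarrow> (\<lambda>x. f x - g x) \<in> L2"
  using L2_add[of f "\<lambda>x. -1 * g x"] L2_cmult[of g "-1"] by simp

lemma L2_zero: "(\<lambda>x. 0) \<in> L2"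
  by (simp add: L2_def)

lemma L2_sum: "(\<And>i. i \<in> I \<Longrightarrow> f i \<in> L2) \<Longrightarrow> (\<lambda>x. \<Sum>i\<in>I. f i x) \<in> L2"
  by (induction I rule: infinite_finite_induct) (auto intro: L2_zero L2_add)

lemma borel_measurable_cnj [measurable (raw)]:
  "f \<in> borel_measurable M \<Longrightarrow> (\<lambda>x. cnj (f x)) \<in> borel_measurable M"
  by (rule measurable_compose[OF _ borel_measurable_continuous_onI]) (auto intro: continuous_intros)

lemma L2_cnj: "f \<in> L2 \<Longrightarrow> (\<lambda>x. cnj (f x)) \<in> L2"
  by (rule L2_bound[of f]) (simp_all add: borel_measurable_cnj L2D(1))

lemma L2_mult_integrable:
  assumes "f \<in> L2" "g \<in> L2"
  shows "integrable lebesgue (\<lambda>x. f x * g x)"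
proof -
  note [measurable] = L2D(1)[OF assms(1)] L2D(1)[OF assms(2)]
  have i: "integrable lebesgue (\<lambda>x. (norm (f x))\<^sup>2 + (norm (g x))\<^sup>2)"
    using L2D(2)[OF assms(1)] L2D(2)[OF assms(2)] by simp
  have "norm (f x * g x) \<le> (norm (f x))\<^sup>2 + (norm (g x))\<^sup>2" for x
    using sum_squares_bound[of "norm (f x)" "norm (g x)"] mult_nonneg_nonneg[OF norm_ge_zero norm_ge_zero, of "f x" "g x"]
    unfolding norm_mult by linarith
  then show ?thesis
    by (intro Bochner_Integration.integrable_bound[OF i]) auto
qed

lemma L2_inner_integrable:
  "f \<in> L2 \<Longrightarrow> g \<in> L2 \<Longrightarrow> integrable lebesgue (\<lambda>x. f x * cnj (g x))"
  using L2_mult_integrable[OF _ L2_cnj] by blast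

lemma L2_inner_add:
  assumes "f \<in> L2" "g \<in> L2" "h \<in> L2"
  shows "L2_inner (\<lambda>x. f x + g x) h = L2_inner f h + L2_inner g h"
    "L2_inner h (\<lambda>x. f x + g x) = L2_inner h f + L2_inner h g"
    "L2_inner (\<lambda>x. f x - g x) h = L2_inner f h - L2_inner g h"
    "L2_inner h (\<lambda>x. f x - g x) = L2_inner h f - L2_inner h g"
  using assms[THEN L2_inner_integrable] unfolding L2_inner_def
  by (simp_all add: algebra_simps assms)

lemma L2_inner_sum:
  assumes "\<And>i. i \<in> I \<Longrightarrow> f i \<in> L2" "h \<in> L2"
  shows "L2_inner (\<lambda>x. \<Sum>i\<in>I. f i x) h = (\<Sum>i\<in>I. L2_inner (f i) h)"
  unfolding L2_inner_def sum_distrib_right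
  by (rule Bochner_Integration.integral_sum) (intro L2_inner_integrable assms)

lemma L2_inner_commute: "L2_inner g f = cnj (L2_inner f g)"
  unfolding L2_inner_def Bochner_Integration.integral_cnj[symmetric] by (simp add: mult.commute)

lemma L2_norm_nonneg [simp]: "L2_norm f \<ge> 0"
  by (simp add: L2_norm_def)

lemma L2_norm_power2: "(L2_norm f)\<^sup>2 = (LINT x|lebesgue. (norm (f x))\<^sup>2)"
  by (simp add: L2_norm_def)

lemma L2_inner_self: "L2_inner f f = of_real ((L2_norm f)\<^sup>2)"
  unfolding L2_norm_power2 L2_inner_def
  by (simp only: complex_norm_square[symmetric] integral_complex_of_real)

lemma L2_norm_minus_commute: "L2_norm (\<lambda>x. f x - g x) = L2_norm (\<lambda>x. g x - f x)"
  by (simp add: L2_norm_def norm_minus_commute)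

lemma L2_Cauchy_Schwarz:
  assumes "f \<in> L2" "g \<in> L2"
  shows "(LINT x|lebesgue. norm (f x) * norm (g x)) \<le> L2_norm f * L2_norm g"
    and "norm (L2_inner f g) \<le> L2_norm f * L2_norm g"
proof -
  note [measurable] = L2D(1)[OF assms(1)] L2D(1)[OF assms(2)]
  have i: "integrable lebesgue (\<lambda>x. norm (f x) * norm (g x))"
    using integrable_norm[OF L2_mult_integrable[OF assms]] by (simp add: norm_mult)
  let ?I = "LINT x|lebesgue. norm (f x) * norm (g x)"
  have "(\<integral>\<^sup>+x. ennreal (norm (f x)) * ennreal (norm (g x)) \<partial>lebesgue)\<^sup>2
     \<le> (\<integral>\<^sup>+x. (ennreal (norm (f x)))\<^sup>2 \<partial>lebesgue) * (\<integral>\<^sup>+x. (ennreal (norm (g x)))\<^sup>2 \<partial>lebesgue)"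
    by (rule Cauchy_Schwarz_nn_integral) measurable
  also have "(\<integral>\<^sup>+x. ennreal (norm (f x)) * ennreal (norm (g x)) \<partial>lebesgue) = ennreal ?I"
    using nn_integral_eq_integral[OF i] by (simp add: ennreal_mult)
  also have "(\<integral>\<^sup>+x. (ennreal (norm (f x)))\<^sup>2 \<partial>lebesgue) = ennreal ((L2_norm f)\<^sup>2)"
    using nn_integral_eq_integral[OF L2D(2)[OF assms(1)]] by (simp add: ennreal_power L2_norm_power2)
  also have "(\<integral>\<^sup>+x. (ennreal (norm (g x)))\<^sup>2 \<partial>lebesgue) = ennreal ((L2_norm g)\<^sup>2)"
    using nn_integral_eq_integral[OF L2D(2)[OF assms(2)]] by (simp add: ennreal_power L2_norm_power2)
  finally have "ennreal (?I\<^sup>2) \<le> ennreal ((L2_norm f * L2_norm g)\<^sup>2)"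
    by (simp add: ennreal_power ennreal_mult[symmetric] power_mult_distrib)
  then have "?I\<^sup>2 \<le> (L2_norm f * L2_norm g)\<^sup>2"
    by (simp add: ennreal_le_iff)
  then show 1: "?I \<le> L2_norm f * L2_norm g"
    by (rule power2_le_imp_le) simp
  have "norm (L2_inner f g) \<le> (LINT x|lebesgue. norm (f x * cnj (g x)))"
    unfolding L2_inner_def by (rule integral_norm_bound)
  with 1 show "norm (L2_inner f g) \<le> L2_norm f * L2_norm g" by (simp add: norm_mult)
qed

lemma L2_norm_diff_power2:
  assumes "f \<in> L2" "g \<in> L2"
  shows "(L2_norm (\<lambda>x. f x - g x))\<^sup>2 = (L2_norm f)\<^sup>2 - 2 * Re (L2_inner f g) + (L2_norm g)\<^sup>2"
proof -
  have "complex_of_real ((L2_norm (\<lambda>x. f x - g x))\<^sup>2)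
      = of_real ((L2_norm f)\<^sup>2) - (L2_inner f g + cnj (L2_inner f g)) + of_real ((L2_norm g)\<^sup>2)"
    unfolding L2_inner_self[symmetric]
    by (simp add: L2_inner_add assms L2_diff L2_inner_commute[of g f])
  also have "\<dots> = of_real ((L2_norm f)\<^sup>2 - 2 * Re (L2_inner f g) + (L2_norm g)\<^sup>2)"
    by (simp add: complex_add_cnj del: of_real_power)
  finally show ?thesis by (simp only: of_real_eq_iff)
qed

lemma L2_norm_triangle_diff:
  assumes "f \<in> L2" "g \<in> L2"
  shows "L2_norm (\<lambda>x. f x - g x) \<le> L2_norm f + L2_norm g"
proof (rule power2_le_imp_le)
  have "- Re (L2_inner f g) \<le> L2_norm f * L2_norm g"
    using L2_Cauchy_Schwarz(2)[OF assms] abs_Re_le_cmod[of "L2_inner f g"] by linarith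
  then show "(L2_norm (\<lambda>x. f x - g x))\<^sup>2 \<le> (L2_norm f + L2_norm g)\<^sup>2"
    by (simp add: L2_norm_diff_power2 assms power2_sum)
qed simp

lemma L2_dist_triangle:
  assumes "f \<in> L2" "g \<in> L2" "h \<in> L2"
  shows "L2_dist f h \<le> L2_dist f g + L2_dist g h"
  using L2_norm_triangle_diff[OF L2_diff[OF assms(1,2)] L2_diff[OF assms(3,2)]]
  by (simp add: L2_dist_def L2_norm_minus_commute[of g h])

text \<open>This form, with a bound on the extended integral, suits both Fatou's lemma and Tonelli's theorem,
  where integrability is only known afterwards.\<close>

lemma L2_norm_mono_nn:
  assumes "f \<in> borel_measurable lebesgue" "(\<integral>\<^sup>+x. ennreal ((norm (f x))\<^sup>2) \<partial>lebesgue) \<le> ennreal (B\<^sup>2)" "B \<ge> 0"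
  shows "f \<in> L2" "L2_norm f \<le> B"
proof -
  note [measurable] = assms(1)
  have i: "integrable lebesgue (\<lambda>x. (norm (f x))\<^sup>2)"
    by (rule integrableI_bounded) (use assms(2) in \<open>auto intro: le_less_trans[OF _ ennreal_less_top]\<close>)
  then show "f \<in> L2" using assms(1) by (intro L2I)
  have "ennreal ((L2_norm f)\<^sup>2) \<le> ennreal (B\<^sup>2)"
    using assms(2) nn_integral_eq_integral[OF i] by (simp add: L2_norm_power2)
  then show "L2_norm f \<le> B"
    using assms(3) by (simp add: ennreal_le_iff power2_le_iff_abs_le)
qed

section \<open>Gaussian integrals\<close>

lemma nn_integral_gaussian_line:
  assumes "c > 0"
  shows "(\<integral>\<^sup>+x. ennreal (exp (- c * x\<^sup>2)) \<partial>lborel) = ennreal (sqrt (pi / c))"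
proof -
  define \<sigma> where "\<sigma> = sqrt (1 / (2 * c))"
  have s: "\<sigma> > 0" "\<sigma>\<^sup>2 = 1 / (2 * c)" using assms by (auto simp: \<sigma>_def)
  have e: "exp (- c * x\<^sup>2) = sqrt (pi / c) * normal_density 0 \<sigma> x" for x
    using assms by (simp add: normal_density_def s real_sqrt_divide field_simps)
  have "(\<integral>\<^sup>+x. ennreal (normal_density 0 \<sigma> x) \<partial>lborel) = 1"
    using nn_integral_eq_integral[OF integrable_normal_density[OF s(1)], of 0] integral_normal_density[OF s(1), of 0]
    by simp
  then show ?thesis
    unfolding e using assms by (simp add: ennreal_mult nn_integral_cmult)
qed

lemma gaussian_integral:
  assumes "c > 0"
  shows "integrable lborel (\<lambda>x::'a::euclidean_space. exp (- c * (norm x)\<^sup>2))"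
    and "(LINT x|lborel. exp (- c * (norm (x::'a))\<^sup>2)) = sqrt (pi / c) ^ DIM('a)"
proof -
  have "(\<integral>\<^sup>+x. (\<Prod>b\<in>Basis. ennreal (exp (- c * ((x::'a) \<bullet> b)\<^sup>2))) \<partial>lborel)
      = (\<Prod>b\<in>(Basis::'a set). \<integral>\<^sup>+x. ennreal (exp (- c * x\<^sup>2)) \<partial>lborel)"
    by (rule nn_integral_lborel_prod) auto
  also have "\<dots> = ennreal (sqrt (pi / c) ^ DIM('a))"
    using assms by (simp only: nn_integral_gaussian_line prod_constant) (simp add: ennreal_power)
  also have "(\<lambda>x::'a. \<Prod>b\<in>Basis. ennreal (exp (- c * (x \<bullet> b)\<^sup>2))) = (\<lambda>x. ennreal (exp (- c * (norm x)\<^sup>2)))"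
  proof
    fix x :: 'a
    have "(norm x)\<^sup>2 = (\<Sum>b\<in>Basis. (x \<bullet> b)\<^sup>2)"
      unfolding power2_norm_eq_inner by (subst euclidean_inner) (simp add: power2_eq_square)
    then show "(\<Prod>b\<in>Basis. ennreal (exp (- c * (x \<bullet> b)\<^sup>2))) = ennreal (exp (- c * (norm x)\<^sup>2))"
      by (simp add: prod_ennreal exp_sum[symmetric] sum_distrib_left)
  qed
  finally have nn: "(\<integral>\<^sup>+(x::'a). ennreal (exp (- c * (norm x)\<^sup>2)) \<partial>lborel) = ennreal (sqrt (pi / c) ^ DIM('a))" .
  show "integrable lborel (\<lambda>x::'a. exp (- c * (norm x)\<^sup>2))"
    by (rule integrableI_bounded) (use nn in auto)
  show "(LINT x|lborel. exp (- c * (norm (x::'a))\<^sup>2)) = sqrt (pi / c) ^ DIM('a)"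
    by (subst integral_eq_nn_integral) (use nn assms in auto)
qed

text \<open>The shifted Gaussian is the envelope of all kernels, hence the shift and the Lebesgue measure.\<close>

lemma nn_integral_lebesgue_gaussian:
  fixes z :: "'a::euclidean_space"
  assumes "c > 0"
  shows "(\<integral>\<^sup>+w. ennreal (exp (- c * (norm (w - z))\<^sup>2)) \<partial>lebesgue) = ennreal (sqrt (pi / c) ^ DIM('a))"
proof -
  let ?f = "\<lambda>x::'a. ennreal (exp (- c * (norm x)\<^sup>2))"
  have "(\<integral>\<^sup>+x. ?f x \<partial>distr lborel borel ((+) (-z))) = (\<integral>\<^sup>+x. ?f ((-z) + x) \<partial>lborel)"
    by (rule nn_integral_distr) measurable
  then have "(\<integral>\<^sup>+w. ?f (w - z) \<partial>lborel) = (\<integral>\<^sup>+x. ?f x \<partial>lborel)"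
    unfolding lborel_distr_plus by simp
  also have "\<dots> = ennreal (sqrt (pi / c) ^ DIM('a))"
    using nn_integral_eq_integral[OF gaussian_integral(1)[OF assms, where 'a='a]] gaussian_integral(2)[OF assms, where 'a='a]
    by simp
  finally show ?thesis by (simp add: nn_integral_completion)
qed

lemma gaussian_shift_L2:
  fixes z :: "'a::euclidean_space"
  assumes "c > 0"
  shows "(\<lambda>w. complex_of_real (exp (- c * (norm (w - z))\<^sup>2))) \<in> L2"
    and "L2_norm (\<lambda>w. complex_of_real (exp (- c * (norm (w - z))\<^sup>2))) \<le> sqrt (sqrt (pi / (2 * c)) ^ DIM('a))"
proof -
  let ?f = "\<lambda>w. complex_of_real (exp (- c * (norm (w - z))\<^sup>2))"
  have m: "?f \<in> borel_measurable lebesgue"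
    by (rule measurable_completion) measurable
  have "(norm (?f w))\<^sup>2 = exp (- (2 * c) * (norm (w - z))\<^sup>2)" for w
    by (simp add: power2_eq_square exp_add[symmetric])
  then have n: "(\<integral>\<^sup>+w. ennreal ((norm (?f w))\<^sup>2) \<partial>lebesgue) \<le> ennreal ((sqrt (sqrt (pi / (2 * c)) ^ DIM('a)))\<^sup>2)"
    using nn_integral_lebesgue_gaussian[of "2 * c" z] assms by simp
  have nn: "0 \<le> sqrt (sqrt (pi / (2 * c)) ^ DIM('a))" using assms by simp
  show "?f \<in> L2" "L2_norm ?f \<le> sqrt (sqrt (pi / (2 * c)) ^ DIM('a))"
    by (rule L2_norm_mono_nn[OF m n nn])+
qed

lemma gaussian_shift_integral:
  fixes z :: "complex^'n::finite"
  assumes c: "c > 0"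
  shows "integrable lebesgue (\<lambda>w. exp (- c * (norm (z - w))\<^sup>2))"
    and "(LINT w|lebesgue. exp (- c * (norm (z - w))\<^sup>2)) = (pi / c) ^ CARD('n)"
proof -
  have m: "(\<lambda>w::complex^'n. exp (- c * (norm w)\<^sup>2)) \<in> borel_measurable borel" by measurable
  have eq: "(\<lambda>w. exp (- c * (norm (z - w))\<^sup>2)) = (\<lambda>w. exp (- c * (norm (- z + w))\<^sup>2))"
    by (auto simp: norm_minus_commute)
  have me: "(\<lambda>w. exp (- c * (norm (z - w))\<^sup>2)) \<in> borel_measurable lborel" by measurable
  have "DIM(complex^'n) = 2 * CARD('n)" by simp
  then have sq: "sqrt (pi / c) ^ DIM(complex^'n) = (pi / c) ^ CARD('n)"
    using c by (simp only: power_mult) simp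
  show "integrable lebesgue (\<lambda>w. exp (- c * (norm (z - w))\<^sup>2))"
    unfolding integrable_completion[OF me] unfolding eq integral_lborel_translate(2)[OF m]
    by (rule gaussian_integral(1)[OF c])
  show "(LINT w|lebesgue. exp (- c * (norm (z - w))\<^sup>2)) = (pi / c) ^ CARD('n)"
    unfolding integral_completion[OF me] unfolding eq integral_lborel_translate(1)[OF m] gaussian_integral(2)[OF c] sq ..
qed

section \<open>Twisted convolution with radial kernels of Gaussian decay\<close>

text \<open>The bound is required for \<open>s \<ge> 0\<close> only, because profiles are evaluated at \<open>|z - w|\<^sup>2\<close>.\<close>

definition gauss_bdd :: "(real \<Rightarrow> real) \<Rightarrow> bool" where
  "gauss_bdd q \<longleftrightarrow> q \<in> borel_measurable borel \<and> (\<exists>C c. C \<ge> 0 \<and> c > 0 \<and> (\<forall>s\<ge>0. \<bar>q s\<bar> \<le> C * exp (- c * s)))"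

text \<open>For \<open>\<nu> = 0\<close> this is the twisted convolution of \<open>f\<close> with the radial function
  \<open>q (|z|\<^sup>2)\<close>.\<close>

definition tint ::
    "real \<Rightarrow> real \<Rightarrow> (real \<Rightarrow> real) \<Rightarrow> (complex^'n::finite \<Rightarrow> complex) \<Rightarrow> complex^'n \<Rightarrow> complex" where
  "tint \<nu> \<mu> q f z = (LINT w|lebesgue. tker \<nu> \<mu> q z w * f w)"

lemma continuous_on_phase [continuous_intros]:
  "continuous_on A f \<Longrightarrow> continuous_on A g \<Longrightarrow> continuous_on A (\<lambda>x. phase \<nu> \<mu> (f x) (g x))"
  unfolding phase_def theta_def by (intro continuous_intros)

lemma measurable_tker:
  assumes [measurable]: "q \<in> borel_measurable borel"
  shows "(\<lambda>(z, w). tker \<nu> \<mu> q z w) \<in> borel_measurable (borel \<Otimes>\<^sub>M borel)"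
proof -
  have [measurable]: "(\<lambda>p::(complex^'n) \<times> (complex^'n). phase \<nu> \<mu> (fst p) (snd p)) \<in> borel_measurable (borel \<Otimes>\<^sub>M borel)"
    unfolding borel_prod by (intro borel_measurable_continuous_onI continuous_intros)
  show ?thesis unfolding tker_def case_prod_beta by measurable
qed

lemma measurable_tker_left:
  assumes "q \<in> borel_measurable borel"
  shows "(\<lambda>w. tker \<nu> \<mu> q w z) \<in> borel_measurable borel"
  using measurable_compose[OF measurable_Pair[OF measurable_ident_sets[OF refl] measurable_const[of z borel]] measurable_tker[OF assms, of \<nu> \<mu>]]
  by simp

text \<open>The product of two copies of the complete Lebesgue measure is not complete, but Borel functions are
  measurable for it; this suffices for the Fubini arguments.\<close>

lemma measurable_lebesgue_pair:
  assumes "h \<in> borel_measurable (borel \<Otimes>\<^sub>M borel)"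
  shows "h \<in> borel_measurable (lebesgue \<Otimes>\<^sub>M lebesgue)"
proof -
  have id: "(\<lambda>x. x) \<in> lebesgue \<rightarrow>\<^sub>M borel" by (rule measurable_completion) simp
  have "(\<lambda>p. (fst p, snd p)) \<in> (lebesgue \<Otimes>\<^sub>M lebesgue) \<rightarrow>\<^sub>M (borel \<Otimes>\<^sub>M borel)"
    by (intro measurable_Pair measurable_compose[OF measurable_fst id] measurable_compose[OF measurable_snd id])
  from measurable_compose[OF this assms] show ?thesis by simp
qed

lemma sigma_finite_lebesgue: "sigma_finite_measure (lebesgue :: 'a::euclidean_space measure)"
proof
  from lborel.sigma_finite_countable obtain A :: "'a set set" where
    AA: "countable A \<and> A \<subseteq> sets lborel \<and> \<Union>A = space lborel \<and> (\<forall>a\<in>A. emeasure lborel a \<noteq> \<infinity>)" ..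
  then have A: "countable A" "A \<subseteq> sets lborel" "\<Union>A = space lborel" "\<And>a. a \<in> A \<Longrightarrow> emeasure lborel a \<noteq> \<infinity>"
    by (metis, metis, metis, metis)
  have sub: "a \<in> sets lebesgue" "emeasure lebesgue a \<noteq> \<infinity>" if "a \<in> A" for a
  proof -
    have a: "a \<in> sets lborel" using that A(2) by blast
    then show "a \<in> sets lebesgue" by (rule sets_completionI_sets)
    then show "emeasure lebesgue a \<noteq> \<infinity>"
      using A(4)[OF that] emeasure_completion[of a lborel] main_part[OF a] by metis
  qed
  show "\<exists>A::'a set set. countable A \<and> A \<subseteq> sets lebesgue \<and> \<Union>A = space lebesgue \<and> (\<forall>a\<in>A. emeasure lebesgue a \<noteq> \<infinity>)"
    using A(1,3) sub by (intro exI[of _ A]) (simp add: subset_iff)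
qed

interpretation lebesgue: sigma_finite_measure "lebesgue :: 'a::euclidean_space measure"
  by (rule sigma_finite_lebesgue)

interpretation lebesgue_pair: pair_sigma_finite "lebesgue :: 'a::euclidean_space measure" "lebesgue :: 'b::euclidean_space measure" ..

lemma gauss_bddE:
  assumes "gauss_bdd q"
  obtains C c where "q \<in> borel_measurable borel" "C \<ge> 0" "c > 0" "\<And>s. s \<ge> 0 \<Longrightarrow> \<bar>q s\<bar> \<le> C * exp (- c * s)"
  using assms unfolding gauss_bdd_def by blast

lemma norm_tker_le:
  assumes "\<And>s. s \<ge> 0 \<Longrightarrow> \<bar>q s\<bar> \<le> C * exp (- c * s)"
  shows "norm (tker \<nu> \<mu> q z w) \<le> C * exp (- c * (norm (z - w))\<^sup>2)"
  using assms[of "(norm (z - w))\<^sup>2"] by (simp add: norm_tker)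

lemma tker_L2: 
  assumes "gauss_bdd q"
  shows "(\<lambda>w. tker \<nu> \<mu> q w z) \<in> L2"
proof -
  obtain C c where q: "q \<in> borel_measurable borel" "C \<ge> 0" "c > 0" "\<And>s. s \<ge> 0 \<Longrightarrow> \<bar>q s\<bar> \<le> C * exp (- c * s)"
    by (rule gauss_bddE[OF assms]) blast
  show ?thesis
    by (rule L2_bound[OF L2_cmult[OF gaussian_shift_L2(1)[OF q(3), of z], of "of_real C"]])
      (use norm_tker_le[OF q(4)] q(2) in \<open>auto intro!: measurable_completion measurable_tker_left[OF q(1)] simp: norm_mult\<close>)
qed

text \<open>Since the kernel is hermitian, pointwise values of the integral operators are inner products with
  fixed square integrable functions.  All pointwise estimates come from here.\<close>

lemma tint_eq_inner: "tint \<nu> \<mu> q f z = L2_inner f (\<lambda>w. tker \<nu> \<mu> q w z)"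
  by (simp add: tint_def L2_inner_def cnj_tker mult.commute)

lemma tint_integrable:
  assumes "gauss_bdd q" "f \<in> L2"
  shows "integrable lebesgue (\<lambda>w. tker \<nu> \<mu> q z w * f w)"
  using L2_inner_integrable[OF assms(2) tker_L2[OF assms(1)]] by (simp add: cnj_tker mult.commute)

lemma tint_pointwise_bound:
  assumes "gauss_bdd q" "f \<in> L2"
  shows "norm (tint \<nu> \<mu> q f z) \<le> L2_norm f * L2_norm (\<lambda>w. tker \<nu> \<mu> q w z)"
  unfolding tint_eq_inner by (rule L2_Cauchy_Schwarz(2)[OF assms(2) tker_L2[OF assms(1)]])

lemma tint_linear:
  assumes "gauss_bdd q" "f \<in> L2" "g \<in> L2"
  shows "tint \<nu> \<mu> q (\<lambda>x. f x - g x) z = tint \<nu> \<mu> q f z - tint \<nu> \<mu> q g z"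
  unfolding tint_eq_inner by (rule L2_inner_add(3)[OF assms(2,3) tker_L2[OF assms(1)]])

text \<open>Young's inequality for convolution with a Gaussian \<open>e\<close>: write \<open>e = \<surd>e \<cdot> \<surd>e\<close>, apply the
  Cauchy-Schwarz inequality in \<open>w\<close>, and integrate over \<open>z\<close> first.\<close>

lemma gaussian_convolution:
  fixes f :: "'a::euclidean_space \<Rightarrow> complex"
  assumes "c > 0" "f \<in> L2"
  defines "H \<equiv> \<lambda>z. LINT w|lebesgue. exp (- c * (norm (z - w))\<^sup>2) * norm (f w)"
  shows "integrable lebesgue (\<lambda>w. exp (- c * (norm (z - w))\<^sup>2) * norm (f w))"
    and "(\<lambda>z. complex_of_real (H z)) \<in> L2"
    and "L2_norm (\<lambda>z. complex_of_real (H z)) \<le> sqrt (pi / c) ^ DIM('a) * L2_norm f"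
proof -
  let ?G = "sqrt (pi / c) ^ DIM('a)"
  note mf [measurable] = L2D(1)[OF assms(2)]
  have int: "integrable lebesgue (\<lambda>w. exp (- c * (norm (z - w))\<^sup>2) * norm (f w))" for z
    using integrable_norm[OF L2_mult_integrable[OF gaussian_shift_L2(1)[OF assms(1), of z] assms(2)]]
    by (simp add: norm_mult norm_minus_commute)
  then show "integrable lebesgue (\<lambda>w. exp (- c * (norm (z - w))\<^sup>2) * norm (f w))" .
  have me: "(\<lambda>p. exp (- c * (norm (fst p - snd p))\<^sup>2)) \<in> borel_measurable (lebesgue \<Otimes>\<^sub>M (lebesgue :: 'a measure))"
    by (rule measurable_lebesgue_pair) measurable
  have mf2: "(\<lambda>p. norm (f (snd p))) \<in> borel_measurable (lebesgue \<Otimes>\<^sub>M (lebesgue :: 'a measure))"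
    by measurable
  have mH: "H \<in> borel_measurable lebesgue"
    unfolding H_def
    by (rule lebesgue.borel_measurable_lebesgue_integral)
      (use borel_measurable_times[OF me mf2] in \<open>simp add: case_prod_beta\<close>)
  have H0: "H z \<ge> 0" for z unfolding H_def by (intro integral_nonneg_AE) simp
  have HH: "(ennreal (H z))\<^sup>2 \<le> ennreal ?G * (\<integral>\<^sup>+w. ennreal (exp (- c * (norm (z - w))\<^sup>2) * (norm (f w))\<^sup>2) \<partial>lebesgue)" for z
  proof -
    let ?e = "\<lambda>w. exp (- (c / 2) * (norm (z - w))\<^sup>2)"
    have e: "?e w * ?e w = exp (- c * (norm (z - w))\<^sup>2)" for w by (simp add: exp_add[symmetric])
    then have e2: "(?e w)\<^sup>2 = exp (- c * (norm (z - w))\<^sup>2)" for w by (simp only: power2_eq_square[of "?e w"])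
    have mem [measurable]: "?e \<in> borel_measurable lebesgue" by (rule measurable_completion) measurable
    have "ennreal (H z) = (\<integral>\<^sup>+w. ennreal (exp (- c * (norm (z - w))\<^sup>2) * norm (f w)) \<partial>lebesgue)"
      unfolding H_def by (rule nn_integral_eq_integral[OF int, symmetric]) simp
    also have "\<dots> = (\<integral>\<^sup>+w. ennreal (?e w) * ennreal (?e w * norm (f w)) \<partial>lebesgue)"
      by (simp only: ennreal_mult[OF exp_ge_zero mult_nonneg_nonneg[OF exp_ge_zero norm_ge_zero], symmetric]
          mult.assoc[symmetric] e)
    also have "\<dots>\<^sup>2 \<le> (\<integral>\<^sup>+w. (ennreal (?e w))\<^sup>2 \<partial>lebesgue) * (\<integral>\<^sup>+w. (ennreal (?e w * norm (f w)))\<^sup>2 \<partial>lebesgue)"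
      by (rule Cauchy_Schwarz_nn_integral) measurable
    also have "(\<integral>\<^sup>+w. (ennreal (?e w))\<^sup>2 \<partial>lebesgue) = ennreal ?G"
      using nn_integral_lebesgue_gaussian[OF assms(1), of z]
      by (simp only: ennreal_power[OF exp_ge_zero] e2) (simp only: norm_minus_commute[of z])
    also have "(\<integral>\<^sup>+w. (ennreal (?e w * norm (f w)))\<^sup>2 \<partial>lebesgue) = (\<integral>\<^sup>+w. ennreal (exp (- c * (norm (z - w))\<^sup>2) * (norm (f w))\<^sup>2) \<partial>lebesgue)"
      by (simp only: ennreal_power[OF mult_nonneg_nonneg[OF exp_ge_zero norm_ge_zero]] power_mult_distrib e2)
    finally show ?thesis .
  qed
  have "(\<integral>\<^sup>+z. ennreal ((norm (complex_of_real (H z)))\<^sup>2) \<partial>lebesgue)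
      \<le> (\<integral>\<^sup>+z. ennreal ?G * (\<integral>\<^sup>+w. ennreal (exp (- c * (norm (z - w))\<^sup>2) * (norm (f w))\<^sup>2) \<partial>lebesgue) \<partial>lebesgue)"
    using HH H0 by (intro nn_integral_mono) (simp add: ennreal_power)
  also have "\<dots> = ennreal ?G * (\<integral>\<^sup>+z. (\<integral>\<^sup>+w. ennreal (exp (- c * (norm (z - w))\<^sup>2) * (norm (f w))\<^sup>2) \<partial>lebesgue) \<partial>lebesgue)"
    by (rule nn_integral_cmult, rule lebesgue.borel_measurable_nn_integral)
      (use me mf2 in \<open>simp add: case_prod_beta\<close>)
  also have "(\<integral>\<^sup>+z. (\<integral>\<^sup>+w. ennreal (exp (- c * (norm (z - w))\<^sup>2) * (norm (f w))\<^sup>2) \<partial>lebesgue) \<partial>lebesgue)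
     = (\<integral>\<^sup>+w. (\<integral>\<^sup>+z. ennreal (exp (- c * (norm (z - w))\<^sup>2) * (norm (f w))\<^sup>2) \<partial>lebesgue) \<partial>lebesgue)"
    using lebesgue_pair.Fubini[of "\<lambda>p. ennreal (exp (- c * (norm (fst p - snd p))\<^sup>2) * (norm (f (snd p)))\<^sup>2)"] me mf2
    by simp
  also have "\<dots> = (\<integral>\<^sup>+w. ennreal ?G * ennreal ((norm (f w))\<^sup>2) \<partial>lebesgue)"
  proof (rule nn_integral_cong)
    fix w :: 'a
    have m: "(\<lambda>z. ennreal (exp (- c * (norm (z - w))\<^sup>2))) \<in> borel_measurable lebesgue"
      by (rule measurable_completion) measurable
    show "(\<integral>\<^sup>+z. ennreal (exp (- c * (norm (z - w))\<^sup>2) * (norm (f w))\<^sup>2) \<partial>lebesgue) = ennreal ?G * ennreal ((norm (f w))\<^sup>2)"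
      unfolding ennreal_mult[OF exp_ge_zero zero_le_power2] nn_integral_multc[OF m]
        nn_integral_lebesgue_gaussian[OF assms(1)] ..
  qed
  also have "\<dots> = ennreal ?G * ennreal ((L2_norm f)\<^sup>2)"
    using nn_integral_eq_integral[OF L2D(2)[OF assms(2)]] by (simp add: nn_integral_cmult L2_norm_power2)
  also have "ennreal ?G * (ennreal ?G * ennreal ((L2_norm f)\<^sup>2)) = ennreal ((?G * L2_norm f)\<^sup>2)"
    using assms(1) by (simp add: ennreal_mult[symmetric] power_mult_distrib power2_eq_square mult_ac)
  finally have n: "(\<integral>\<^sup>+z. ennreal ((norm (complex_of_real (H z)))\<^sup>2) \<partial>lebesgue) \<le> ennreal ((?G * L2_norm f)\<^sup>2)" .
  have m: "(\<lambda>z. complex_of_real (H z)) \<in> borel_measurable lebesgue" using mH by measurable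
  have nn: "0 \<le> ?G * L2_norm f" using assms(1) by simp
  show "(\<lambda>z. complex_of_real (H z)) \<in> L2" "L2_norm (\<lambda>z. complex_of_real (H z)) \<le> ?G * L2_norm f"
    by (rule L2_norm_mono_nn[OF m n nn])+
qed

lemma measurable_tker_mult:
  fixes f :: "complex^'n::finite \<Rightarrow> complex"
  assumes "gauss_bdd q" "f \<in> L2"
  shows "(\<lambda>p. tker \<nu> \<mu> q (fst p) (snd p) * f (snd p)) \<in> borel_measurable (lebesgue \<Otimes>\<^sub>M lebesgue)"
proof -
  have q: "q \<in> borel_measurable borel" using assms(1) by (simp add: gauss_bdd_def)
  note [measurable] = L2D(1)[OF assms(2)]
  have [measurable]: "(\<lambda>p. tker \<nu> \<mu> q (fst p) (snd p)) \<in> borel_measurable (lebesgue \<Otimes>\<^sub>M (lebesgue :: (complex^'n) measure))"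
    by (rule measurable_lebesgue_pair, rule measurable_tker[OF q, unfolded case_prod_beta])
  show ?thesis by measurable
qed

lemma tint_L2:
  assumes "gauss_bdd q" "f \<in> L2"
  shows "tint \<nu> \<mu> q f \<in> L2"
proof -
  obtain C c where q: "q \<in> borel_measurable borel" "C \<ge> 0" "c > 0" "\<And>s. s \<ge> 0 \<Longrightarrow> \<bar>q s\<bar> \<le> C * exp (- c * s)"
    by (rule gauss_bddE[OF assms(1)]) blast
  have m: "tint \<nu> \<mu> q f \<in> borel_measurable lebesgue"
    unfolding tint_def[abs_def]
    by (rule lebesgue.borel_measurable_lebesgue_integral)
      (use measurable_tker_mult[OF assms] in \<open>simp add: case_prod_beta\<close>)
  show ?thesis
  proof (rule L2_bound[OF L2_cmult[OF gaussian_convolution(2)[OF q(3) assms(2)], of "of_real C"] m])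
    fix z
    have "norm (tint \<nu> \<mu> q f z) \<le> (LINT w|lebesgue. norm (tker \<nu> \<mu> q z w * f w))"
      unfolding tint_def by (rule integral_norm_bound)
    also have "\<dots> \<le> (LINT w|lebesgue. C * (exp (- c * (norm (z - w))\<^sup>2) * norm (f w)))"
      using norm_tker_le[OF q(4)] 
      by (intro integral_mono integrable_norm tint_integrable assms integrable_mult_right gaussian_convolution q)
        (auto simp: norm_mult mult.assoc[symmetric] intro!: mult_right_mono)
    also have "\<dots> = C * (LINT w|lebesgue. exp (- c * (norm (z - w))\<^sup>2) * norm (f w))" by simp
    finally show "norm (tint \<nu> \<mu> q f z) \<le> norm (of_real C * complex_of_real (LINT w|lebesgue. exp (- c * (norm (z - w))\<^sup>2) * norm (f w)))"
      using q(2) by (simp add: norm_mult)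
  qed
qed

text \<open>Fubini's theorem for a hermitian kernel; the Gaussian convolution of \<open>|f|\<close> dominates the inner
  integral.\<close>

lemma tint_self_adjoint:
  assumes "gauss_bdd q" "f \<in> L2" "g \<in> L2"
  shows "L2_inner (tint \<nu> \<mu> q f) g = L2_inner f (tint \<nu> \<mu> q g)"
proof -
  obtain C c where q: "q \<in> borel_measurable borel" "C \<ge> 0" "c > 0" "\<And>s. s \<ge> 0 \<Longrightarrow> \<bar>q s\<bar> \<le> C * exp (- c * s)"
    by (rule gauss_bddE[OF assms(1)]) blast
  note [measurable] = L2D(1)[OF assms(2)] L2D(1)[OF assms(3)] measurable_tker_mult[OF assms(1,2)]
  define k where "k p = tker \<nu> \<mu> q (fst p) (snd p) * f (snd p) * cnj (g (fst p))" for p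
  have mk: "k \<in> borel_measurable (lebesgue \<Otimes>\<^sub>M lebesgue)" unfolding k_def[abs_def] by measurable
  have ik: "integrable lebesgue (\<lambda>w. k (z, w))" for z
    unfolding k_def using tint_integrable[OF assms(1,2)] by simp
  have dom: "integrable lebesgue (\<lambda>z. C * norm (complex_of_real (LINT w|lebesgue. exp (- c * (norm (z - w))\<^sup>2) * norm (f w)) * g z))"
    by (intro integrable_mult_right integrable_norm L2_mult_integrable gaussian_convolution(2) q assms)
  have int: "integrable lebesgue (\<lambda>z. LINT w|lebesgue. norm (k (z, w)))"
  proof (rule Bochner_Integration.integrable_bound[OF dom _ AE_I2])
    show "(\<lambda>z. LINT w|lebesgue. norm (k (z, w))) \<in> borel_measurable lebesgue"
      by (rule lebesgue.borel_measurable_lebesgue_integral) (use mk in \<open>simp add: case_prod_beta\<close>)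
    fix z
    have "(LINT w|lebesgue. norm (k (z, w))) \<le> (LINT w|lebesgue. (C * norm (g z)) * (exp (- c * (norm (z - w))\<^sup>2) * norm (f w)))"
    proof (intro integral_mono integrable_norm ik integrable_mult_right gaussian_convolution(1) q assms)
      fix w
      have "norm (k (z, w)) = norm (tker \<nu> \<mu> q z w) * (norm (f w) * norm (g z))"
        by (simp add: k_def norm_mult)
      also have "\<dots> \<le> C * exp (- c * (norm (z - w))\<^sup>2) * (norm (f w) * norm (g z))"
        by (intro mult_right_mono norm_tker_le q) auto
      finally show "norm (k (z, w)) \<le> (C * norm (g z)) * (exp (- c * (norm (z - w))\<^sup>2) * norm (f w))"
        by (simp add: mult_ac)
    qed
    also have "\<dots> = (C * norm (g z)) * (LINT w|lebesgue. exp (- c * (norm (z - w))\<^sup>2) * norm (f w))"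
      by (rule integral_mult_right_zero)
    finally have "(LINT w|lebesgue. norm (k (z, w))) \<le> (C * norm (g z)) * (LINT w|lebesgue. exp (- c * (norm (z - w))\<^sup>2) * norm (f w))" .
    moreover have "0 \<le> (LINT w|lebesgue. norm (k (z, w)))" by (intro integral_nonneg_AE) simp
    moreover have "0 \<le> (LINT w|lebesgue. exp (- c * (norm (z - w))\<^sup>2) * norm (f w))" by (intro integral_nonneg_AE) simp
    ultimately show "norm (LINT w|lebesgue. norm (k (z, w)))
       \<le> norm (C * norm (complex_of_real (LINT w|lebesgue. exp (- c * (norm (z - w))\<^sup>2) * norm (f w)) * g z))"
      using q(2) by (simp only: norm_mult norm_of_real real_norm_def abs_of_nonneg abs_norm_cancel mult_ac)
  qed
  have "integrable (lebesgue \<Otimes>\<^sub>M lebesgue) k"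
    by (rule lebesgue_pair.Fubini_integrable[OF mk int]) (use ik in simp)
  then have "(LINT w|lebesgue. LINT z|lebesgue. k (z, w)) = (LINT z|lebesgue. LINT w|lebesgue. k (z, w))"
    using lebesgue_pair.Fubini_integral[of "\<lambda>z w. k (z, w)"] by (simp add: case_prod_beta)
  moreover have "(LINT w|lebesgue. k (z, w)) = tint \<nu> \<mu> q f z * cnj (g z)" for z
    by (simp add: k_def tint_def)
  moreover have "(LINT z|lebesgue. k (z, w)) = f w * cnj (tint \<nu> \<mu> q g w)" for w
  proof -
    have "k (z, w) = f w * cnj (tker \<nu> \<mu> q w z * g z)" for z
      by (simp add: k_def cnj_tker mult_ac)
    then show ?thesis by (simp add: tint_def del: complex_cnj_mult)
  qed
  ultimately show ?thesis by (simp add: L2_inner_def)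
qed

section \<open>Radial test functions\<close>

lemma gauss_bddI:
  assumes "q \<in> borel_measurable borel" "c > 0" "\<And>s. s \<ge> 0 \<Longrightarrow> \<bar>q s\<bar> \<le> C * exp (- c * s)"
  shows "gauss_bdd q"
proof -
  have "0 \<le> C" using order_trans[OF abs_ge_zero assms(3)[of 0]] by simp
  then show ?thesis using assms unfolding gauss_bdd_def by blast
qed

lemma gauss_bdd_exp: "c > 0 \<Longrightarrow> gauss_bdd (\<lambda>s. exp (- c * s))"
  by (rule gauss_bddI[where C = 1 and c = c]) auto

lemma gauss_bdd_cmult:
  assumes "gauss_bdd q" shows "gauss_bdd (\<lambda>s. a * q s)"
proof -
  obtain C c where q: "q \<in> borel_measurable borel" "C \<ge> 0" "c > 0" "\<And>s. s \<ge> 0 \<Longrightarrow> \<bar>q s\<bar> \<le> C * exp (- c * s)"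
    by (rule gauss_bddE[OF assms]) blast
  show ?thesis
    by (rule gauss_bddI[where C = "\<bar>a\<bar> * C" and c = c])
      (use q in \<open>auto simp: abs_mult mult.assoc intro!: mult_left_mono borel_measurable_times\<close>)
qed

lemma gauss_bdd_add:
  assumes "gauss_bdd q" "gauss_bdd p" shows "gauss_bdd (\<lambda>s. q s + p s)"
proof -
  obtain C c where q: "q \<in> borel_measurable borel" "C \<ge> 0" "c > 0" "\<And>s. s \<ge> 0 \<Longrightarrow> \<bar>q s\<bar> \<le> C * exp (- c * s)"
    by (rule gauss_bddE[OF assms(1)]) blast
  obtain D d where p: "p \<in> borel_measurable borel" "D \<ge> 0" "d > 0" "\<And>s. s \<ge> 0 \<Longrightarrow> \<bar>p s\<bar> \<le> D * exp (- d * s)"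
    by (rule gauss_bddE[OF assms(2)]) blast
  show ?thesis
  proof (rule gauss_bddI[where C = "C + D" and c = "min c d"])
    fix s :: real assume s: "s \<ge> 0"
    have e: "exp (- c * s) \<le> exp (- min c d * s)" "exp (- d * s) \<le> exp (- min c d * s)"
      using s by (auto intro!: mult_right_mono)
    have "\<bar>q s + p s\<bar> \<le> C * exp (- c * s) + D * exp (- d * s)"
      using q(4)[OF s] p(4)[OF s] by linarith
    also have "\<dots> \<le> C * exp (- min c d * s) + D * exp (- min c d * s)"
      using q(2) p(2) e by (intro add_mono mult_left_mono)
    finally show "\<bar>q s + p s\<bar> \<le> (C + D) * exp (- min c d * s)" by (simp add: distrib_right)
  qed (use q p in auto)
qed

lemma gauss_bdd_abs: "gauss_bdd q \<Longrightarrow> gauss_bdd (\<lambda>s. \<bar>q s\<bar>)"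
  unfolding gauss_bdd_def by auto

text \<open>The factor \<open>s\<close> costs half of the exponential rate, by \<open>x \<le> exp x\<close> for \<open>x = c s / 2\<close>.\<close>

lemma gauss_bdd_times:
  assumes "gauss_bdd q" shows "gauss_bdd (\<lambda>s. s * q s)"
proof -
  obtain C c where q: "q \<in> borel_measurable borel" "C \<ge> 0" "c > 0" "\<And>s. s \<ge> 0 \<Longrightarrow> \<bar>q s\<bar> \<le> C * exp (- c * s)"
    by (rule gauss_bddE[OF assms]) blast
  show ?thesis
  proof (rule gauss_bddI[where C = "2 / c * C" and c = "c / 2"])
    fix s :: real assume s: "s \<ge> 0"
    have "s * (c / 2) \<le> exp (c / 2 * s)"
      using exp_ge_add_one_self[of "c / 2 * s"] mult.commute[of s "c / 2"] by linarith
    then have "2 / c * (s * (c / 2)) \<le> 2 / c * exp (c / 2 * s)" using q(3) by (intro mult_left_mono) auto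
    then have "s \<le> 2 / c * exp (c / 2 * s)" using q(3) by simp
    then have "s * \<bar>q s\<bar> \<le> (2 / c * exp (c / 2 * s)) * (C * exp (- c * s))"
      using s q by (intro mult_mono) auto
    also have "\<dots> = 2 / c * C * (exp (c / 2 * s) * exp (- c * s))" by simp
    also have "exp (c / 2 * s) * exp (- c * s) = exp (- (c / 2) * s)"
      unfolding exp_add[symmetric] by (simp add: field_simps)
    finally show "\<bar>s * q s\<bar> \<le> 2 / c * C * exp (- (c / 2) * s)" using s by (simp add: abs_mult)
  qed (use q in auto)
qed

lemma gauss_bdd_power: "gauss_bdd q \<Longrightarrow> gauss_bdd (\<lambda>s. s ^ k * q s)"
  by (induction k) (auto simp: mult.assoc dest: gauss_bdd_times)

lemma gauss_bdd_sum: 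
  "finite I \<Longrightarrow> (\<And>i. i \<in> I \<Longrightarrow> gauss_bdd (q i)) \<Longrightarrow> gauss_bdd (\<lambda>s. \<Sum>i\<in>I. q i s)"
proof (induction I rule: finite_induct)
  case empty
  show ?case by (rule gauss_bddI[where C = 0 and c = 1]) auto
qed (auto intro: gauss_bdd_add)

lemma tint_dominated:
  assumes B: "gauss_bdd B" and f: "f \<in> L2" and m: "\<And>m. q m \<in> borel_measurable borel" "p \<in> borel_measurable borel"
    and le: "\<And>m s. s \<ge> 0 \<Longrightarrow> \<bar>q m s\<bar> \<le> B s" and lim: "\<And>s. s \<ge> 0 \<Longrightarrow> (\<lambda>m. q m s) \<longlonglongrightarrow> p s"
  shows "(\<lambda>m. tint \<nu> \<mu> (q m) f z) \<longlonglongrightarrow> tint \<nu> \<mu> p f z"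
  unfolding tint_def
proof (rule integral_dominated_convergence[where w = "\<lambda>w. norm (tker \<nu> \<mu> B z w * f w)"])
  have t: "(\<lambda>w. tker \<nu> \<mu> p z w) \<in> borel_measurable lebesgue" if "p \<in> borel_measurable borel" for p
    by (rule measurable_completion)
      (use borel_measurable_cnj[OF measurable_tker_left[OF that, of \<nu> \<mu> z]] in \<open>simp add: cnj_tker\<close>)
  show "(\<lambda>w. tker \<nu> \<mu> p z w * f w) \<in> borel_measurable lebesgue"
    by (intro borel_measurable_times t m L2D(1)[OF f])
  show "(\<lambda>w. tker \<nu> \<mu> (q i) z w * f w) \<in> borel_measurable lebesgue" for i
    by (intro borel_measurable_times t m L2D(1)[OF f])
  show "integrable lebesgue (\<lambda>w. norm (tker \<nu> \<mu> B z w * f w))"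
    by (intro integrable_norm tint_integrable B f)
  have "(\<lambda>m. tker \<nu> \<mu> (q m) z w * f w) \<longlonglongrightarrow> tker \<nu> \<mu> p z w * f w" for w
    unfolding tker_def by (intro tendsto_intros lim) simp
  then show "AE w in lebesgue. (\<lambda>m. tker \<nu> \<mu> (q m) z w * f w) \<longlonglongrightarrow> tker \<nu> \<mu> p z w * f w" by simp
  have "norm (tker \<nu> \<mu> (q i) z w * f w) \<le> norm (tker \<nu> \<mu> B z w * f w)" for i w
    using order_trans[OF le abs_ge_self, of "(norm (z - w))\<^sup>2" i]
    unfolding norm_mult norm_tker by (intro mult_right_mono) auto
  then show "AE w in lebesgue. norm (tker \<nu> \<mu> (q i) z w * f w) \<le> norm (tker \<nu> \<mu> B z w * f w)" for i by simp
qed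

section \<open>Eigenfunctions against radial kernels\<close>

lemma smooth_herm:
  "smooth (\<lambda>z. herm z w)" "smooth (\<lambda>z. herm w z)" "smooth (\<lambda>z. herm z z)"
proof -
  show "smooth (\<lambda>z. herm z w)" "smooth (\<lambda>z. herm w z)"
    by (intro smooth_rules(3) bounded_linear_herm)+
  show "smooth (\<lambda>z. herm z z)"
    unfolding herm_def
    by (intro smooth_sum smooth_mult smooth_rules(3) bounded_linear_vec_nth bounded_linear_cnj_nth)
qed

lemma smooth_phase: "smooth (\<lambda>z. phase \<nu> \<mu> z w)"
  unfolding phase_def theta_def diff_conv_add_uminus
  by (intro smooth_exp smooth_rules(1,2) smooth_mult smooth_herm smooth_rules(4)[OF bounded_linear_minus[OF bounded_linear_ident]])

lemma smooth_norm_diff_power2: "smooth (\<lambda>z::complex^'n::finite. (norm (z - w))\<^sup>2)"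
proof -
  have "(norm (z - w))\<^sup>2 = Re (herm z z + (- (herm z w) + (- (herm w z) + herm w w)))" for z
    using arg_cong[OF herm_self[of "z - w"], of Re] by (simp add: herm_simps del: of_real_power)
  moreover have "smooth (\<lambda>z. Re (herm z z + (- (herm z w) + (- (herm w z) + herm w w))))"
    by (intro smooth_rules(4)[OF bounded_linear_Re] smooth_rules(1,2) smooth_herm
      smooth_rules(4)[OF bounded_linear_minus[OF bounded_linear_ident]])
  ultimately show ?thesis by simp
qed

text \<open>The operator \<Delta> on the profile of a twisted radial kernel, in the variable \<open>s = |z - w|\<^sup>2\<close>; the
  arguments \<open>q1\<close> and \<open>q2\<close> stand for \<open>q'\<close> and \<open>q''\<close>, and \<open>n\<close> for the dimension.\<close>

definition radial_op :: "real \<Rightarrow> real \<Rightarrow> (real \<Rightarrow> real) \<Rightarrow> (real \<Rightarrow> real) \<Rightarrow> (real \<Rightarrow> real) \<Rightarrow> real \<Rightarrow> real" where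
  "radial_op n \<mu> q q1 q2 s = 4 * s * q2 s + 4 * n * q1 s - \<mu>\<^sup>2 * s * q s"

lemma C_k_tker:
  assumes q: "\<And>x. (q has_real_derivative q1 x) (at x)" and q1: "\<And>x. (q1 has_real_derivative q2 x) (at x)"
    and "continuous_on UNIV q2"
  shows "C_k (Suc (Suc 0)) (\<lambda>z::complex^'n::finite. tker \<nu> \<mu> q z w)"
proof -
  have s: "C_k k (\<lambda>z::complex^'n. (norm (z - w))\<^sup>2)" for k
    using smooth_norm_diff_power2 unfolding smooth_def by blast
  have "C_k 0 (\<lambda>z::complex^'n. q2 ((norm (z - w))\<^sup>2))"
    unfolding C_k.simps by (rule continuous_on_compose2[OF assms(3)]) (auto intro!: continuous_intros)
  then have "C_k (Suc (Suc 0)) (\<lambda>z::complex^'n. q ((norm (z - w))\<^sup>2))"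
    by (intro C_k_real_comp[OF s q] C_k_real_comp[OF s q1])
  then show ?thesis
    unfolding tker_def
    using smooth_phase[unfolded smooth_def] by (intro C_k_mult C_k_linear_comp[OF bounded_linear_of_real]) blast
qed

text \<open>Green's formula is applied in the variable \<open>w\<close> to \<open>F\<close> and \<open>tker \<nu> \<mu> q w z\<close>, whose conjugate is the
  kernel \<open>tker \<nu> \<mu> q z w\<close> of the integral operator.\<close>

lemma eigenfunction_compact_radial:
  fixes F :: "complex^'n::finite \<Rightarrow> complex"
  assumes F: "smooth F" and ev: "\<And>z. Delta \<nu> \<mu> F z = \<kappa> * F z"
    and q: "\<And>x. (q has_real_derivative q1 x) (at x)" and q1: "\<And>x. (q1 has_real_derivative q2 x) (at x)"
    and c: "continuous_on UNIV q2" and supp: "\<And>s. s > R\<^sup>2 \<Longrightarrow> q s = 0" and "R \<ge> 0"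
  shows "tint \<nu> \<mu> (radial_op (real CARD('n)) \<mu> q q1 q2) F z = \<kappa> * tint \<nu> \<mu> q F z"
proof -
  let ?L = "radial_op (real CARD('n)) \<mu> q q1 q2"
  let ?psi = "\<lambda>w. tker \<nu> \<mu> q w z"
  have psi0: "?psi w = 0" if "norm w > R + norm z" for w
  proof -
    have "norm (w - z) > R" using that norm_triangle_ineq2[of w z] by linarith
    then have "(norm (w - z))\<^sup>2 > R\<^sup>2" using \<open>R \<ge> 0\<close> by (intro power_strict_mono) auto
    then show ?thesis by (simp add: tker_def supp)
  qed
  have D: "Delta \<nu> \<mu> ?psi w = tker \<nu> \<mu> ?L w z" for w
    unfolding Delta_tker[OF q q1] by (simp add: radial_op_def[abs_def])
  have CF: "C_k (Suc (Suc 0)) F" using F unfolding smooth_def by blast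
  have "(LINT w|lborel. Delta \<nu> \<mu> F w * cnj (?psi w)) = (LINT w|lborel. F w * cnj (Delta \<nu> \<mu> ?psi w))"
    by (rule Delta_symmetric[OF CF C_k_tker[OF q q1 c] psi0])
  then have e: "(LINT w|lborel. \<kappa> * (tker \<nu> \<mu> q z w * F w)) = (LINT w|lborel. tker \<nu> \<mu> ?L z w * F w)"
    unfolding D ev cnj_tker by (simp add: mult_ac)
  have mF: "F \<in> borel_measurable borel"
    by (rule borel_measurable_continuous_onI[OF smooth_continuous[OF F]])
  have mq: "q \<in> borel_measurable borel" "q1 \<in> borel_measurable borel" "q2 \<in> borel_measurable borel"
    using q q1 c by (auto intro!: borel_measurable_continuous_onI DERIV_continuous_on[of UNIV] intro: has_field_derivative_at_within)
  have mL: "?L \<in> borel_measurable borel" unfolding radial_op_def[abs_def] using mq by measurable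
  have t: "(\<lambda>w. tker \<nu> \<mu> p z w) \<in> borel_measurable borel" if "p \<in> borel_measurable borel" for p
    using borel_measurable_cnj[OF measurable_tker_left[OF that, of \<nu> \<mu> z]] by (simp add: cnj_tker)
  have "(\<lambda>w. tker \<nu> \<mu> q z w * F w) \<in> borel_measurable lborel" "(\<lambda>w. tker \<nu> \<mu> ?L z w * F w) \<in> borel_measurable lborel"
    using borel_measurable_times[OF t[OF mq(1)] mF] borel_measurable_times[OF t[OF mL] mF] by simp_all
  then show ?thesis
    using e unfolding tint_def by (simp add: integral_completion)
qed

text \<open>Integrals depending on a parameter are differentiated below by estimating the second order remainder
  under the integral sign, which avoids limits of difference quotients.\<close>

lemma has_derivative_quadratic_remainder:
  fixes f :: "'a::real_normed_vector \<Rightarrow> 'b::real_normed_vector"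
  assumes L: "bounded_linear L" and "\<delta> > 0"
    and le: "\<And>h. norm h \<le> \<delta> \<Longrightarrow> norm (f (x + h) - f x - L h) \<le> K * (norm h)\<^sup>2"
  shows "(f has_derivative L) (at x)"
  unfolding has_derivative_at
proof (intro conjI L)
  have ev: "\<forall>\<^sub>F h in at 0. norm (norm (f (x + h) - f x - L h) / norm h) \<le> K * norm h"
    unfolding eventually_at
  proof (intro exI[of _ \<delta>] conjI ballI impI \<open>\<delta> > 0\<close>)
    fix h :: 'a assume "h \<noteq> 0 \<and> dist h 0 < \<delta>"
    then show "norm (norm (f (x + h) - f x - L h) / norm h) \<le> K * norm h"
      using le[of h] by (simp add: divide_le_eq power2_eq_square mult.assoc)
  qed
  have "((\<lambda>h::'a. K * norm h) \<longlongrightarrow> K * norm (0::'a)) (at 0)" by (intro tendsto_intros)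
  then show "(\<lambda>h. norm (f (x + h) - f x - L h) / norm h) \<midarrow>0\<rightarrow> 0"
    using Lim_null_comparison[OF ev] by simp
qed

text \<open>These powers serve as a twice differentiable cutoff.  At the kink \<open>x = 1\<close> the function is bounded by
  the square of the distance to the kink.\<close>

lemma DERIV_positive_part_power:
  "((\<lambda>x::real. (max 0 (1 - x)) ^ Suc (Suc m)) has_real_derivative (- real (Suc (Suc m)) * (max 0 (1 - x)) ^ Suc m)) (at x)"
proof -
  consider "x < 1" | "x > 1" | "x = 1" by linarith
  then show ?thesis
  proof cases
    case 1
    have "((\<lambda>x::real. (1 - x) ^ Suc (Suc m)) has_real_derivative (- real (Suc (Suc m)) * (1 - x) ^ Suc m)) (at x)"
      by (rule DERIV_cong, rule DERIV_power[where f = "\<lambda>x. 1 - x" and D = "-1"]) (auto intro!: derivative_eq_intros simp: algebra_simps)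
    then have "((\<lambda>x::real. (1 - x) ^ Suc (Suc m)) has_real_derivative (- real (Suc (Suc m)) * (max 0 (1 - x)) ^ Suc m)) (at x)"
      using 1 by (simp add: max_def)
    then show ?thesis
      by (rule has_field_derivative_transform_within_open[where S = "{..<1}"]) (use 1 in auto)
  next
    case 2
    have "((\<lambda>x::real. 0) has_real_derivative (- real (Suc (Suc m)) * (max 0 (1 - x)) ^ Suc m)) (at x)"
      using 2 by (simp add: max_def)
    then show ?thesis
      by (rule has_field_derivative_transform_within_open[where S = "{1<..}"]) (use 2 in auto)
  next
    case 3
    have "((\<lambda>x::real. (max 0 (1 - x)) ^ Suc (Suc m)) has_derivative (\<lambda>h. 0)) (at 1)"
    proof (rule has_derivative_quadratic_remainder[where \<delta> = 1 and K = 1])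
      fix h :: real assume h: "norm h \<le> 1"
      have "\<bar>max 0 (- h)\<bar> ^ Suc (Suc m) \<le> \<bar>max 0 (- h)\<bar> ^ 2"
        using h by (intro power_decreasing) auto
      also have "\<dots> \<le> \<bar>h\<bar> ^ 2" by (intro power_mono) auto
      finally show "norm (max 0 (1 - (1 + h)) ^ Suc (Suc m) - max 0 (1 - 1) ^ Suc (Suc m) - 0) \<le> 1 * (norm h)\<^sup>2"
        by (simp add: power_abs del: power_Suc)
    qed auto
    moreover have "(*) (- real (Suc (Suc m)) * (max 0 (1 - (1::real))) ^ Suc m) = (\<lambda>h. 0)" by (rule ext) simp
    ultimately show ?thesis unfolding 3 has_field_derivative_def by simp
  qed
qed

text \<open>The profile is cut off by \<open>(1 - s / R)\<^sub>+\<^sup>3\<close> with \<open>R \<rightarrow> \<infinity>\<close>.  A cutoff in the radial variable around \<open>z\<close>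
  keeps the kernel twisted radial, so the formula for \<open>radial_op\<close> still applies and no mixed terms with
  derivatives of \<open>F\<close> arise.\<close>

lemma eigenfunction_radial:
  fixes F :: "complex^'n::finite \<Rightarrow> complex"
  assumes F: "smooth F" and L2: "F \<in> L2" and ev: "\<And>z. Delta \<nu> \<mu> F z = \<kappa> * F z"
    and q: "\<And>x. (q has_real_derivative q1 x) (at x)" and q1: "\<And>x. (q1 has_real_derivative q2 x) (at x)"
    and c: "continuous_on UNIV q2" and bd: "gauss_bdd q" "gauss_bdd q1" "gauss_bdd q2"
  shows "tint \<nu> \<mu> (radial_op (real CARD('n)) \<mu> q q1 q2) F z = \<kappa> * tint \<nu> \<mu> q F z"
proof -
  define n where "n = real CARD('n)"
  define R where "R m = real (Suc m)" for m
  have R: "R m \<ge> 1" for m by (simp add: R_def)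
  define X where "X k m s = (max 0 (1 - s / R m)) ^ k" for k m s
  have dX: "(X (Suc (Suc k)) m has_real_derivative (- real (Suc (Suc k)) * X (Suc k) m s / R m)) (at s)" for k m s
  proof -
    have "((\<lambda>s. s / R m) has_real_derivative (1 / R m)) (at s)" using R[of m] by (auto intro!: derivative_eq_intros)
    from DERIV_chain2[OF DERIV_positive_part_power this, of k] show ?thesis
      by (simp add: X_def[abs_def])
  qed
  define Q where "Q m s = X 3 m s * q s" for m s
  define Q1 where "Q1 m s = - 3 * X 2 m s / R m * q s + X 3 m s * q1 s" for m s
  define Q2 where "Q2 m s = 6 * X 1 m s / (R m)\<^sup>2 * q s - 6 * X 2 m s / R m * q1 s + X 3 m s * q2 s" for m s
  have d3: "(X 3 m has_real_derivative (- 3 * X 2 m s / R m)) (at s)" for m s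
    using dX[of 1 m s] by (simp add: numeral_3_eq_3 numeral_2_eq_2)
  have d2: "(X 2 m has_real_derivative (- 2 * X 1 m s / R m)) (at s)" for m s
    using dX[of 0 m s] by (simp add: numeral_2_eq_2)
  have DQ: "(Q m has_real_derivative Q1 m s) (at s)" for m s
    unfolding Q_def[abs_def] Q1_def by (rule DERIV_cong[OF DERIV_mult[OF d3 q]]) simp
  have DQ1: "(Q1 m has_real_derivative Q2 m s) (at s)" for m s
    unfolding Q1_def[abs_def] Q2_def
    by (rule DERIV_cong[OF DERIV_add[OF DERIV_mult[OF DERIV_cdivide[OF DERIV_cmult[OF d2]] q] DERIV_mult[OF d3 q1]]])
      (simp add: power2_eq_square field_simps)
  have cX: "continuous_on UNIV (X k m)" for k m unfolding X_def[abs_def] using R[of m] by (auto intro!: continuous_intros)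
  have cq: "continuous_on UNIV q" "continuous_on UNIV q1"
    using q q1 by (auto intro!: DERIV_continuous_on intro: has_field_derivative_at_within)
  have cQ2: "continuous_on UNIV (Q2 m)" for m
    unfolding Q2_def[abs_def] using R[of m] by (auto intro!: continuous_intros cX cq c)
  have supp: "Q m s = 0" if "s > (sqrt (R m))\<^sup>2" for m s
    using that R[of m] by (simp add: Q_def X_def max_def)
  have comp: "tint \<nu> \<mu> (radial_op n \<mu> (Q m) (Q1 m) (Q2 m)) F z = \<kappa> * tint \<nu> \<mu> (Q m) F z" for m
    unfolding n_def using R[of m] by (intro eigenfunction_compact_radial[where R = "sqrt (R m)", OF F ev DQ DQ1 cQ2 supp]) auto
  have X01: "0 \<le> X k m s" "X k m s \<le> 1" if "s \<ge> 0" for k m s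
    unfolding X_def using that R[of m] by (auto intro!: power_le_one)
  have Xlim: "(\<lambda>m. X k m s) \<longlonglongrightarrow> 1" for k s
  proof -
    have "(\<lambda>m. s / R m) \<longlonglongrightarrow> 0"
      unfolding R_def using LIMSEQ_inverse_real_of_nat tendsto_mult_right_zero[of _ _ s] by (simp add: divide_inverse)
    then have "(\<lambda>m. X k m s) \<longlonglongrightarrow> (max 0 (1 - 0)) ^ k" unfolding X_def by (intro tendsto_intros)
    then show ?thesis by simp
  qed
  have R0: "(\<lambda>m. inverse (R m)) \<longlonglongrightarrow> 0" unfolding R_def by (rule LIMSEQ_inverse_real_of_nat)
  have L0: "(\<lambda>m. Q m s) \<longlonglongrightarrow> q s" for s
    using tendsto_mult[OF Xlim[of 3 s] tendsto_const[of "q s"]] by (simp add: Q_def)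
  have L1: "(\<lambda>m. Q1 m s) \<longlonglongrightarrow> q1 s" for s
  proof -
    have "(\<lambda>m. - 3 * X 2 m s * inverse (R m) * q s + X 3 m s * q1 s) \<longlonglongrightarrow> - 3 * 1 * 0 * q s + 1 * q1 s"
      by (intro tendsto_intros Xlim R0)
    then show ?thesis by (simp add: Q1_def divide_inverse)
  qed
  have L2': "(\<lambda>m. Q2 m s) \<longlonglongrightarrow> q2 s" for s
  proof -
    have "(\<lambda>m. 6 * X 1 m s * (inverse (R m))\<^sup>2 * q s - 6 * X 2 m s * inverse (R m) * q1 s + X 3 m s * q2 s) \<longlonglongrightarrow> 6 * 1 * 0\<^sup>2 * q s - 6 * 1 * 0 * q1 s + 1 * q2 s"
      by (intro tendsto_intros Xlim R0)
    then show ?thesis by (simp add: Q2_def divide_inverse power_inverse)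
  qed
  define B where "B s = \<bar>q s\<bar> + \<bar>q1 s\<bar> + \<bar>q2 s\<bar>" for s
  have gB: "gauss_bdd B" unfolding B_def[abs_def] by (intro gauss_bdd_add gauss_bdd_abs bd)
  have XR: "\<bar>a * X k m s / R m\<bar> \<le> a" if "s \<ge> 0" "a \<ge> 0" for a k m s
  proof -
    have "a * X k m s \<le> a * R m"
      using X01[OF that(1), of k m] R[of m] that by (intro mult_left_mono) auto
    then show ?thesis using X01[OF that(1), of k m] R[of m] that by (simp add: abs_mult divide_le_eq)
  qed
  have bQ: "\<bar>Q m s\<bar> \<le> \<bar>q s\<bar>" if "s \<ge> 0" for m s
    using X01[OF that, of 3 m] by (simp add: Q_def abs_mult mult_left_le_one_le)
  have arith: "x \<le> 3 * a + 1 * b \<Longrightarrow> 0 \<le> b \<Longrightarrow> 0 \<le> c \<Longrightarrow> x \<le> 3 * (a + b + c)"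
    "x \<le> 6 * a + 6 * b + 1 * c \<Longrightarrow> 0 \<le> c \<Longrightarrow> x \<le> 6 * (a + b + c)" for x a b c :: real
    by auto
  \<comment> \<open>\<open>R m\<close> is at least 1, so the derivatives of the cutoff are bounded by 3 and 6 uniformly in \<open>m\<close>.\<close>
  have bQ1: "\<bar>Q1 m s\<bar> \<le> 3 * B s" if "s \<ge> 0" for m s
  proof -
    have "\<bar>Q1 m s\<bar> \<le> \<bar>3 * X 2 m s / R m\<bar> * \<bar>q s\<bar> + \<bar>X 3 m s\<bar> * \<bar>q1 s\<bar>"
      unfolding Q1_def by (rule order_trans[OF abs_triangle_ineq]) (simp add: abs_mult)
    also have "\<dots> \<le> 3 * \<bar>q s\<bar> + 1 * \<bar>q1 s\<bar>"
      using XR[OF that, of 3 2 m] X01[OF that, of 3 m] by (intro add_mono mult_right_mono) auto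
    finally show ?thesis unfolding B_def by (rule arith(1)) simp_all
  qed
  have bQ2: "\<bar>Q2 m s\<bar> \<le> 6 * B s" if "s \<ge> 0" for m s
  proof -
    have "\<bar>6 * X 1 m s / (R m)\<^sup>2\<bar> \<le> 6"
    proof -
      have "6 * X 1 m s \<le> 6 * (R m)\<^sup>2"
        using order_trans[OF X01(2)[OF that, of 1 m] one_le_power[OF R[of m], of 2]] by (intro mult_left_mono) auto
      then show ?thesis using X01[OF that, of 1 m] R[of m] by (simp add: abs_mult divide_le_eq)
    qed
    note b6 = this
    have "\<bar>Q2 m s\<bar> \<le> \<bar>6 * X 1 m s / (R m)\<^sup>2\<bar> * \<bar>q s\<bar> + \<bar>6 * X 2 m s / R m\<bar> * \<bar>q1 s\<bar> + \<bar>X 3 m s\<bar> * \<bar>q2 s\<bar>"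
      unfolding Q2_def abs_mult[symmetric] by linarith
    also have "\<bar>6 * X 1 m s / (R m)\<^sup>2\<bar> * \<bar>q s\<bar> + \<bar>6 * X 2 m s / R m\<bar> * \<bar>q1 s\<bar> + \<bar>X 3 m s\<bar> * \<bar>q2 s\<bar> \<le> 6 * \<bar>q s\<bar> + 6 * \<bar>q1 s\<bar> + 1 * \<bar>q2 s\<bar>"
      using b6 XR[OF that, of 6 2 m] X01[OF that, of 3 m] by (intro add_mono mult_right_mono) auto
    finally show ?thesis unfolding B_def by (rule arith(2)) simp
  qed
  define E where "E s = 24 * (s * B s) + (12 * n) * B s + \<mu>\<^sup>2 * (s * B s)" for s
  have gE: "gauss_bdd E" unfolding E_def[abs_def] by (intro gauss_bdd_add gauss_bdd_cmult gauss_bdd_times gB)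
  have n0: "n \<ge> 0" by (simp add: n_def)
  have bL: "\<bar>radial_op n \<mu> (Q m) (Q1 m) (Q2 m) s\<bar> \<le> E s" if "s \<ge> 0" for m s
  proof -
    have bq: "\<bar>Q m s\<bar> \<le> B s" using bQ[OF that, of m] by (simp add: B_def)
    have "\<bar>4 * s * Q2 m s\<bar> \<le> 24 * (s * B s)"
      using mult_left_mono[OF bQ2[OF that, of m], of "4 * s"] that by (simp add: abs_mult)
    moreover have "\<bar>4 * n * Q1 m s\<bar> \<le> (12 * n) * B s"
      using mult_left_mono[OF bQ1[OF that, of m], of "4 * n"] n0 by (simp add: abs_mult)
    moreover have "\<bar>\<mu>\<^sup>2 * s * Q m s\<bar> \<le> \<mu>\<^sup>2 * (s * B s)"
      using mult_left_mono[OF bq, of "\<mu>\<^sup>2 * s"] that by (simp add: abs_mult)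
    ultimately show ?thesis unfolding radial_op_def E_def by linarith
  qed
  have meas: "p \<in> borel_measurable borel" if "continuous_on UNIV p" for p :: "real \<Rightarrow> real"
    using that by (rule borel_measurable_continuous_onI)
  have cQ: "continuous_on UNIV (Q m)" "continuous_on UNIV (Q1 m)" for m
    using DQ DQ1 by (auto intro!: DERIV_continuous_on intro: has_field_derivative_at_within)
  have "(\<lambda>m. tint \<nu> \<mu> (Q m) F z) \<longlonglongrightarrow> tint \<nu> \<mu> q F z"
    by (rule tint_dominated[OF gB L2])
      (use bQ L0 in \<open>auto intro!: meas cQ cq order_trans[OF bQ] simp: B_def\<close>)
  then have "(\<lambda>m. \<kappa> * tint \<nu> \<mu> (Q m) F z) \<longlonglongrightarrow> \<kappa> * tint \<nu> \<mu> q F z" by (intro tendsto_intros)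
  moreover have "(\<lambda>m. tint \<nu> \<mu> (radial_op n \<mu> (Q m) (Q1 m) (Q2 m)) F z) \<longlonglongrightarrow> tint \<nu> \<mu> (radial_op n \<mu> q q1 q2) F z"
  proof (rule tint_dominated[OF gE L2 _ _ bL])
    show "radial_op n \<mu> (Q m) (Q1 m) (Q2 m) \<in> borel_measurable borel" for m
      unfolding radial_op_def[abs_def] by (intro meas continuous_intros cQ cQ2)
    show "radial_op n \<mu> q q1 q2 \<in> borel_measurable borel"
      unfolding radial_op_def[abs_def] by (intro meas continuous_intros cq c)
    show "(\<lambda>m. radial_op n \<mu> (Q m) (Q1 m) (Q2 m) s) \<longlonglongrightarrow> radial_op n \<mu> q q1 q2 s" for s
      unfolding radial_op_def by (intro tendsto_intros L0 L1 L2')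
  qed
  ultimately show ?thesis
    unfolding comp n_def[symmetric] using LIMSEQ_unique by blast
qed

section \<open>Gaussian kernels of varying width\<close>

lemma exp_remainder: "\<bar>exp x - 1 - x\<bar> \<le> x\<^sup>2 * exp \<bar>x\<bar>" for x :: real
proof -
  obtain t where t: "\<bar>t\<bar> \<le> \<bar>x\<bar>" "exp x = (\<Sum>m<2. x ^ m / fact m) + exp t / fact 2 * x ^ 2"
    using Maclaurin_exp_le[of x 2] by blast
  have "exp t \<le> exp \<bar>x\<bar>" using t(1) by simp
  then have "exp t / 2 \<le> exp \<bar>x\<bar>" using exp_ge_zero[of t] by linarith
  then have "exp t / 2 * x\<^sup>2 \<le> exp \<bar>x\<bar> * x\<^sup>2" by (intro mult_right_mono) auto
  moreover have "exp x - 1 - x = exp t / 2 * x\<^sup>2" using t(2) by (simp add: numeral_2_eq_2)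
  moreover have "0 \<le> exp t / 2 * x\<^sup>2" by simp
  ultimately have "\<bar>exp x - 1 - x\<bar> \<le> exp \<bar>x\<bar> * x\<^sup>2" by (simp only: abs_of_nonneg)
  then show ?thesis by (simp only: mult.commute)
qed

text \<open>As \<open>a\<close> tends to \<open>1/2\<close> from above, the kernel tends to that of the projection onto the lowest
  eigenspace; as \<open>a\<close> grows, it concentrates at \<open>z\<close>.\<close>

definition gauss_int :: "real \<Rightarrow> real \<Rightarrow> (complex^'n::finite \<Rightarrow> complex) \<Rightarrow> complex^'n \<Rightarrow> real \<Rightarrow> complex" where
  "gauss_int \<nu> \<mu> F z a = tint \<nu> \<mu> (\<lambda>s. exp (- (\<mu> * a) * s)) F z"

lemma gauss_int_derivative:
  fixes F :: "complex^'n::finite \<Rightarrow> complex"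
  assumes \<mu>: "\<mu> > 0" and a: "a > 0" and F: "F \<in> L2"
  shows "((\<lambda>a. gauss_int \<nu> \<mu> F z a) has_vector_derivative
     (- of_real \<mu> * tint \<nu> \<mu> (\<lambda>s. s * exp (- (\<mu> * a) * s)) F z)) (at a)"
  unfolding has_vector_derivative_def
proof (rule has_derivative_quadratic_remainder[where \<delta> = "a / 2"])
  let ?e = "\<lambda>a s. exp (- (\<mu> * a) * s)"
  let ?K = "LINT w|lebesgue. norm (tker \<nu> \<mu> (\<lambda>s. s ^ 2 * ?e (a / 2) s) z w * F w)"
  let ?D = "- of_real \<mu> * tint \<nu> \<mu> (\<lambda>s. s * ?e a s) F z"
  have g: "gauss_bdd (?e b)" if "b > 0" for b using that \<mu> by (intro gauss_bdd_exp) auto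
  have g1: "gauss_bdd (\<lambda>s. s * ?e a s)" by (intro gauss_bdd_times g a)
  have g2: "gauss_bdd (\<lambda>s. s ^ 2 * ?e (a / 2) s)" by (intro gauss_bdd_power g) (use a in simp)
  fix h :: real assume "norm h \<le> a / 2"
  then have h: "\<bar>h\<bar> \<le> a / 2" "a + h > 0" using a by (auto simp: abs_le_iff)
  have R: "\<bar>?e (a + h) s - ?e a s + h * \<mu> * (s * ?e a s)\<bar> \<le> h\<^sup>2 * \<mu>\<^sup>2 * (s ^ 2 * ?e (a / 2) s)" if "s \<ge> 0" for s
  proof -
    have "?e (a + h) s = ?e a s * exp (- (\<mu> * h * s))" by (simp add: exp_add[symmetric] algebra_simps)
    then have "?e (a + h) s - ?e a s + h * \<mu> * (s * ?e a s) = ?e a s * (exp (- (\<mu> * h * s)) - 1 - (- (\<mu> * h * s)))"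
      by (simp add: algebra_simps)
    then have "\<bar>?e (a + h) s - ?e a s + h * \<mu> * (s * ?e a s)\<bar> = ?e a s * \<bar>exp (- (\<mu> * h * s)) - 1 - (- (\<mu> * h * s))\<bar>"
      by (simp add: abs_mult)
    also have "\<dots> \<le> ?e a s * ((\<mu> * h * s)\<^sup>2 * exp (\<mu> * (a / 2) * s))"
    proof (intro mult_left_mono)
      have "\<bar>- (\<mu> * h * s)\<bar> = \<mu> * \<bar>h\<bar> * s" using \<mu> that by (simp add: abs_mult)
      also have "\<dots> \<le> \<mu> * (a / 2) * s" using \<mu> that h by (intro mult_right_mono mult_left_mono) auto
      finally have "exp \<bar>- (\<mu> * h * s)\<bar> \<le> exp (\<mu> * (a / 2) * s)" by simp
      then have "(- (\<mu> * h * s))\<^sup>2 * exp \<bar>- (\<mu> * h * s)\<bar> \<le> (\<mu> * h * s)\<^sup>2 * exp (\<mu> * (a / 2) * s)"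
        by (simp only: power2_minus) (intro mult_left_mono, auto)
      then show "\<bar>exp (- (\<mu> * h * s)) - 1 - (- (\<mu> * h * s))\<bar> \<le> (\<mu> * h * s)\<^sup>2 * exp (\<mu> * (a / 2) * s)"
        by (rule order_trans[OF exp_remainder])
    qed simp
    also have "\<dots> = h\<^sup>2 * \<mu>\<^sup>2 * (s ^ 2 * (?e a s * exp (\<mu> * (a / 2) * s)))" by (simp add: power_mult_distrib)
    also have "?e a s * exp (\<mu> * (a / 2) * s) = ?e (a / 2) s"
      unfolding exp_add[symmetric] by (simp add: algebra_simps)
    finally show ?thesis .
  qed
  let ?k = "\<lambda>w. tker \<nu> \<mu> (?e (a + h)) z w * F w - tker \<nu> \<mu> (?e a) z w * F w + of_real (h * \<mu>) * (tker \<nu> \<mu> (\<lambda>s. s * ?e a s) z w * F w)"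
  note i = tint_integrable[OF g[OF h(2)] F, of \<nu> \<mu> z] tint_integrable[OF g[OF a] F, of \<nu> \<mu> z] tint_integrable[OF g1 F, of \<nu> \<mu> z]
    tint_integrable[OF g2 F, of \<nu> \<mu> z]
  have eq: "gauss_int \<nu> \<mu> F z (a + h) - gauss_int \<nu> \<mu> F z a - h *\<^sub>R ?D = (LINT w|lebesgue. ?k w)"
  proof -
    have "(LINT w|lebesgue. ?k w) = (LINT w|lebesgue. tker \<nu> \<mu> (?e (a + h)) z w * F w) - (LINT w|lebesgue. tker \<nu> \<mu> (?e a) z w * F w)
        + of_real (h * \<mu>) * (LINT w|lebesgue. tker \<nu> \<mu> (\<lambda>s. s * ?e a s) z w * F w)"
      by (simp only: Bochner_Integration.integral_add[OF Bochner_Integration.integrable_diff[OF i(1) i(2)] integrable_mult_right[OF i(3)]]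
          Bochner_Integration.integral_diff[OF i(1) i(2)] integral_mult_right_zero)
    then show ?thesis
      unfolding gauss_int_def tint_def
      by (simp only: scaleR_conv_of_real of_real_mult mult_minus_left mult_minus_right diff_minus_eq_add mult.assoc)
  qed
  have le: "(LINT w|lebesgue. norm (?k w)) \<le> (LINT w|lebesgue. (h\<^sup>2 * \<mu>\<^sup>2) * norm (tker \<nu> \<mu> (\<lambda>s. s ^ 2 * ?e (a / 2) s) z w * F w))"
  proof (rule integral_mono)
    show "integrable lebesgue (\<lambda>w. norm (?k w))"
      by (rule integrable_norm[OF Bochner_Integration.integrable_add[OF Bochner_Integration.integrable_diff[OF i(1) i(2)] integrable_mult_right[OF i(3)]]])
    show "integrable lebesgue (\<lambda>w. (h\<^sup>2 * \<mu>\<^sup>2) * norm (tker \<nu> \<mu> (\<lambda>s. s ^ 2 * ?e (a / 2) s) z w * F w))"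
      by (rule integrable_mult_right[OF integrable_norm[OF i(4)]])
    fix w
    let ?s = "(norm (z - w))\<^sup>2"
    have "?k w = phase \<nu> \<mu> z w * of_real (?e (a + h) ?s - ?e a ?s + h * \<mu> * (?s * ?e a ?s)) * F w"
      by (simp add: tker_def algebra_simps)
    then have "norm (?k w) = \<bar>?e (a + h) ?s - ?e a ?s + h * \<mu> * (?s * ?e a ?s)\<bar> * norm (F w)"
      by (simp only: norm_mult norm_phase norm_of_real mult_1)
    also have "\<dots> \<le> (h\<^sup>2 * \<mu>\<^sup>2 * (?s ^ 2 * ?e (a / 2) ?s)) * norm (F w)"
      by (intro mult_right_mono R) auto
    also have "\<dots> = (h\<^sup>2 * \<mu>\<^sup>2) * norm (tker \<nu> \<mu> (\<lambda>s. s ^ 2 * ?e (a / 2) s) z w * F w)"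
      by (simp add: norm_mult norm_tker abs_mult)
    finally show "norm (?k w) \<le> (h\<^sup>2 * \<mu>\<^sup>2) * norm (tker \<nu> \<mu> (\<lambda>s. s ^ 2 * ?e (a / 2) s) z w * F w)" .
  qed
  have K: "(LINT w|lebesgue. (h\<^sup>2 * \<mu>\<^sup>2) * norm (tker \<nu> \<mu> (\<lambda>s. s ^ 2 * ?e (a / 2) s) z w * F w)) = (\<mu>\<^sup>2 * ?K) * (norm h)\<^sup>2"
    unfolding integral_mult_right_zero by simp
  show "norm (gauss_int \<nu> \<mu> F z (a + h) - gauss_int \<nu> \<mu> F z a - h *\<^sub>R ?D) \<le> (\<mu>\<^sup>2 * ?K) * (norm h)\<^sup>2"
    unfolding eq K[symmetric] by (rule order_trans[OF integral_norm_bound le])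
next
  show "bounded_linear (\<lambda>h. h *\<^sub>R (- of_real \<mu> * tint \<nu> \<mu> (\<lambda>s. s * exp (- (\<mu> * a) * s)) F z))"
    by (rule bounded_linear_scaleR_left)
qed (use a in simp)

lemma power_gaussian_tendsto_0:
  assumes "c > 0"
  shows "((\<lambda>a::real. a ^ n * exp (- c * a)) \<longlongrightarrow> 0) at_top"
  using assms by real_asymp

text \<open>Near \<open>z\<close> continuity of \<open>F\<close> is used.  At distance at least \<open>\<delta>\<close> the kernel is at most
  \<open>exp (- \<mu> (a - 1) \<delta>\<^sup>2)\<close> times the kernel for \<open>a = 1\<close>, and this beats the normalising power of \<open>a\<close>.
  No bound on \<open>F\<close> is available, only square integrability.\<close>

lemma gauss_int_tendsto:
  fixes F :: "complex^'n::finite \<Rightarrow> complex"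
  assumes \<mu>: "\<mu> > 0" and F: "F \<in> L2" and cF: "continuous_on UNIV F"
  shows "((\<lambda>a. of_real ((\<mu> * a / pi) ^ CARD('n)) * gauss_int \<nu> \<mu> F z a) \<longlongrightarrow> F z) at_top"
proof -
  let ?N = "CARD('n)"
  define h where "h w = phase \<nu> \<mu> z w * F w" for w
  define e where "e a w = exp (- (\<mu> * a) * (norm (z - w))\<^sup>2)" for a w
  define T where "T a = (\<mu> * a / pi) ^ ?N" for a
  have ch: "continuous_on UNIV h" unfolding h_def[abs_def] by (intro continuous_intros cF)
  have hz: "h z = F z" by (simp add: h_def)
  have hn: "norm (h w) = norm (F w)" for w by (simp add: h_def norm_mult)
  have mh: "h \<in> borel_measurable lebesgue"
    by (rule measurable_completion) (use borel_measurable_continuous_onI[OF ch] in simp)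
  have hL2: "h \<in> L2" by (rule L2_bound[OF F mh]) (simp add: hn)
  have g: "gauss_bdd (\<lambda>s. exp (- (\<mu> * a) * s))" if "a > 0" for a using that \<mu> by (intro gauss_bdd_exp) auto
  have eh: "tker \<nu> \<mu> (\<lambda>s. exp (- (\<mu> * a) * s)) z w * F w = of_real (e a w) * h w" for a w
    by (simp add: tker_def e_def h_def)
  have ie: "integrable lebesgue (e a)" "(LINT w|lebesgue. e a w) = (pi / (\<mu> * a)) ^ ?N" if "a > 0" for a
    using gaussian_shift_integral[of "\<mu> * a" z] that \<mu> by (simp_all add: e_def[abs_def])
  have T1: "T a * (LINT w|lebesgue. e a w) = 1" if "a > 0" for a
    unfolding ie(2)[OF that] T_def power_mult_distrib[symmetric] using that \<mu> by simp
  have T0: "T a \<ge> 0" if "a > 0" for a using that \<mu> by (simp add: T_def)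
  have ieh: "integrable lebesgue (\<lambda>w. of_real (e a w) * h w)" if "a > 0" for a
    using tint_integrable[OF g[OF that] F, of \<nu> \<mu> z] unfolding eh .
  have diff: "of_real (T a) * gauss_int \<nu> \<mu> F z a - F z = (LINT w|lebesgue. of_real (T a) * (of_real (e a w) * (h w - h z)))" if "a > 0" for a
  proof -
    have "complex_of_real (T a) * (LINT w|lebesgue. of_real (e a w)) = 1"
      unfolding integral_complex_of_real of_real_mult[symmetric] T1[OF that] by simp
    then have "F z = of_real (T a) * (LINT w|lebesgue. of_real (e a w) * h z)"
      by (simp add: hz[symmetric] mult.assoc[symmetric])
    then show ?thesis
      unfolding gauss_int_def tint_def eh using ieh[OF that] ie(1)[OF that]
      by (simp add: right_diff_distrib integrable_of_real)
  qed
  define K where "K = (LINT w|lebesgue. e 1 w * (norm (h w) + norm (h z)))"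
  have iK: "integrable lebesgue (\<lambda>w. e 1 w * (norm (h w) + norm (h z)))"
  proof -
    have "integrable lebesgue (\<lambda>w. e 1 w * norm (h w))"
      using integrable_norm[OF ieh[of 1]] by (simp add: norm_mult e_def)
    moreover have "integrable lebesgue (\<lambda>w. e 1 w * norm (h z))"
      using ie(1)[of 1] by (intro integrable_mult_left) simp
    ultimately show ?thesis unfolding distrib_left by (rule Bochner_Integration.integrable_add)
  qed
  show ?thesis
    unfolding T_def[symmetric]
  proof (rule tendstoI)
    fix \<epsilon> :: real assume \<epsilon>: "\<epsilon> > 0"
    have "isCont h z" using ch by (simp add: continuous_on_eq_continuous_at)
    then obtain \<delta> where \<delta>: "\<delta> > 0" "\<And>w. dist w z < \<delta> \<Longrightarrow> dist (h w) (h z) < \<epsilon> / 2"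
      using \<epsilon> unfolding continuous_at_eps_delta by (metis half_gt_zero)
    \<comment> \<open>The integral over the complement of the ball of radius \<open>\<delta>\<close> is at most \<open>U a * K\<close>.\<close>
    define U where "U a = T a * exp (- (\<mu> * (a - 1)) * \<delta>\<^sup>2)" for a
    have "((\<lambda>a. ((\<mu> / pi) ^ ?N * exp (\<mu> * \<delta>\<^sup>2) * K) * (a ^ ?N * exp (- (\<mu> * \<delta>\<^sup>2) * a))) \<longlongrightarrow> ((\<mu> / pi) ^ ?N * exp (\<mu> * \<delta>\<^sup>2) * K) * 0) at_top"
      by (intro tendsto_mult tendsto_const power_gaussian_tendsto_0) (use \<mu> \<delta> in simp)
    also have "(\<lambda>a. ((\<mu> / pi) ^ ?N * exp (\<mu> * \<delta>\<^sup>2) * K) * (a ^ ?N * exp (- (\<mu> * \<delta>\<^sup>2) * a))) = (\<lambda>a. U a * K)"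
      by (auto simp: U_def T_def power_mult_distrib power_divide exp_add[symmetric] exp_diff algebra_simps)
    finally have U0: "((\<lambda>a. U a * K) \<longlongrightarrow> 0) at_top" by simp
    have ev: "\<forall>\<^sub>F a in at_top. U a * K < \<epsilon> / 2"
      using order_tendstoD(2)[OF U0, of "\<epsilon> / 2"] \<epsilon> by simp
    show "\<forall>\<^sub>F a in at_top. dist (of_real (T a) * gauss_int \<nu> \<mu> F z a) (F z) < \<epsilon>"
      using ev eventually_ge_at_top[of "1::real"]
    proof eventually_elim
      case (elim a)
      then have a: "a > 0" by simp
      have pt: "norm (of_real (T a) * (of_real (e a w) * (h w - h z))) \<le> (T a * (\<epsilon> / 2)) * e a w + U a * (e 1 w * (norm (h w) + norm (h z)))" for w
      proof (cases "dist w z < \<delta>")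
        case True
        have "T a * (e a w * norm (h w - h z)) \<le> T a * (e a w * (\<epsilon> / 2))"
          using \<delta>(2)[OF True] T0[OF a] by (intro mult_left_mono) (auto simp: dist_norm e_def)
        moreover have "0 \<le> U a * (e 1 w * (norm (h w) + norm (h z)))"
          using T0[OF a] by (simp add: U_def e_def)
        ultimately show ?thesis
          using T0[OF a] by (simp add: norm_mult e_def mult_ac)
      next
        case False
        then have "\<delta>\<^sup>2 \<le> (norm (z - w))\<^sup>2"
          using \<delta>(1) by (intro power_mono) (auto simp: dist_norm norm_minus_commute)
        then have "exp (- (\<mu> * (a - 1)) * (norm (z - w))\<^sup>2) \<le> exp (- (\<mu> * (a - 1)) * \<delta>\<^sup>2)"
          using \<mu> elim(2) by (simp add: mult_left_mono)
        moreover have "e a w = exp (- (\<mu> * (a - 1)) * (norm (z - w))\<^sup>2) * e 1 w"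
          unfolding e_def exp_add[symmetric] by (simp add: algebra_simps)
        ultimately have "e a w \<le> exp (- (\<mu> * (a - 1)) * \<delta>\<^sup>2) * e 1 w"
          by (simp only:) (intro mult_right_mono, simp_all add: e_def)
        then have "T a * (e a w * norm (h w - h z)) \<le> T a * ((exp (- (\<mu> * (a - 1)) * \<delta>\<^sup>2) * e 1 w) * (norm (h w) + norm (h z)))"
          using T0[OF a] by (intro mult_left_mono mult_mono norm_triangle_ineq4) (auto simp: e_def)
        moreover have "0 \<le> (T a * (\<epsilon> / 2)) * e a w"
          using T0[OF a] \<epsilon> by (simp add: e_def)
        ultimately show ?thesis
          using T0[OF a] by (simp add: norm_mult e_def U_def mult_ac)
      qed
      have i: "integrable lebesgue (\<lambda>w. of_real (T a) * (of_real (e a w) * (h w - h z)))"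
        using ieh[OF a] ie(1)[OF a] by (simp add: right_diff_distrib integrable_of_real)
      have "norm (of_real (T a) * gauss_int \<nu> \<mu> F z a - F z) \<le> (LINT w|lebesgue. norm (of_real (T a) * (of_real (e a w) * (h w - h z))))"
        unfolding diff[OF a] by (rule integral_norm_bound)
      also have "\<dots> \<le> (LINT w|lebesgue. (T a * (\<epsilon> / 2)) * e a w + U a * (e 1 w * (norm (h w) + norm (h z))))"
        by (intro integral_mono integrable_norm i Bochner_Integration.integrable_add integrable_mult_right ie a iK pt)
      also have "\<dots> = (\<epsilon> / 2) * (T a * (LINT w|lebesgue. e a w)) + U a * K"
        using ie(1)[OF a] iK by (simp add: K_def)
      also have "\<dots> < \<epsilon>" using elim(1) unfolding T1[OF a] by simp
      finally show ?case by (simp add: dist_norm)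
    qed
  qed
qed

text \<open>This is \<open>(a - 1/2) powr (- lam) * (a + 1/2) powr (lam + n)\<close>, an integrating factor for the differential
  equation of \<open>gauss_int\<close> in \<open>a\<close>; logarithms give complex powers of positive reals.\<close>

definition gauss_weight :: "complex \<Rightarrow> nat \<Rightarrow> real \<Rightarrow> complex" where
  "gauss_weight lam n a = exp (- lam * of_real (ln (a - 1/2)) + (lam + of_nat n) * of_real (ln (a + 1/2)))"

text \<open>The profile \<open>exp (- \<mu> a s)\<close> is mapped by \<open>radial_op\<close> to a combination of itself and of \<open>s\<close> times
  itself, and the latter is its derivative in \<open>a\<close> up to the factor \<open>- \<mu>\<close>.\<close>

lemma eigenfunction_gauss_int_ODE:
  fixes F :: "complex^'n::finite \<Rightarrow> complex"
  assumes \<mu>: "\<mu> > 0" and F: "F \<in> A2 \<nu> \<mu> lam" and a: "a > 1/2"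
  shows "of_real (a\<^sup>2 - 1/4) * (- of_real \<mu> * tint \<nu> \<mu> (\<lambda>s. s * exp (- (\<mu> * a) * s)) F z)
    = (lam + of_nat CARD('n) / 2 - of_nat CARD('n) * of_real a) * gauss_int \<nu> \<mu> F z a"
proof -
  let ?n = "real CARD('n)"
  let ?q = "\<lambda>s. exp (- (\<mu> * a) * s)"
  let ?q1 = "\<lambda>s. - (\<mu> * a) * exp (- (\<mu> * a) * s)"
  let ?q2 = "\<lambda>s. (\<mu> * a)\<^sup>2 * exp (- (\<mu> * a) * s)"
  have FF: "F \<in> L2" "smooth F" "\<And>z. Delta \<nu> \<mu> F z = - 2 * of_real \<mu> * (2 * lam + of_nat CARD('n)) * F z"
    using F by (auto simp: A2_def)
  have g: "gauss_bdd ?q" using a \<mu> by (intro gauss_bdd_exp) auto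
  have g1: "gauss_bdd (\<lambda>s. s * ?q s)" by (intro gauss_bdd_times g)
  have "tint \<nu> \<mu> (radial_op ?n \<mu> ?q ?q1 ?q2) F z = - 2 * of_real \<mu> * (2 * lam + of_nat CARD('n)) * tint \<nu> \<mu> ?q F z"
  proof (rule eigenfunction_radial[OF FF(2,1,3)])
    show "(?q has_real_derivative ?q1 x) (at x)" "(?q1 has_real_derivative ?q2 x) (at x)" for x
      by (auto intro!: derivative_eq_intros simp: power2_eq_square)
    show "continuous_on UNIV ?q2" by (intro continuous_intros)
    show "gauss_bdd ?q" by (rule g)
    show "gauss_bdd ?q1" by (rule gauss_bdd_cmult[OF g])
    show "gauss_bdd ?q2" by (rule gauss_bdd_cmult[OF g])
  qed
  moreover have "tint \<nu> \<mu> (radial_op ?n \<mu> ?q ?q1 ?q2) F z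
     = of_real (4 * \<mu>\<^sup>2 * (a\<^sup>2 - 1/4)) * tint \<nu> \<mu> (\<lambda>s. s * ?q s) F z - of_real (4 * ?n * \<mu> * a) * tint \<nu> \<mu> ?q F z"
  proof -
    have k: "tker \<nu> \<mu> (radial_op ?n \<mu> ?q ?q1 ?q2) z w * F w
        = of_real (4 * \<mu>\<^sup>2 * (a\<^sup>2 - 1/4)) * (tker \<nu> \<mu> (\<lambda>s. s * ?q s) z w * F w) - of_real (4 * ?n * \<mu> * a) * (tker \<nu> \<mu> ?q z w * F w)" for w
    proof -
      define s where "s = (norm (z - w))\<^sup>2"
      have "radial_op ?n \<mu> ?q ?q1 ?q2 s = 4 * \<mu>\<^sup>2 * (a\<^sup>2 - 1/4) * (s * ?q s) - 4 * ?n * \<mu> * a * ?q s"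
        unfolding radial_op_def by (simp add: power2_eq_square algebra_simps)
      then show ?thesis unfolding tker_def s_def[symmetric]
        by (simp only: of_real_diff of_real_mult) (simp add: algebra_simps)
    qed
    show ?thesis
      unfolding tint_def k
      by (simp only: Bochner_Integration.integral_diff[OF integrable_mult_right[OF tint_integrable[OF g1 FF(1)]]
        integrable_mult_right[OF tint_integrable[OF g FF(1)]]] integral_mult_right_zero)
  qed
  ultimately have e: "of_real (4 * \<mu>\<^sup>2 * (a\<^sup>2 - 1/4)) * tint \<nu> \<mu> (\<lambda>s. s * ?q s) F z - of_real (4 * ?n * \<mu> * a) * tint \<nu> \<mu> ?q F z
     = - 2 * of_real \<mu> * (2 * lam + of_nat CARD('n)) * tint \<nu> \<mu> ?q F z" by simp
  define S where "S = tint \<nu> \<mu> (\<lambda>s. s * ?q s) F z"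
  define G where "G = tint \<nu> \<mu> ?q F z"
  define M where "M = complex_of_real \<mu>"
  define A where "A = complex_of_real a"
  define N where "N = (of_nat CARD('n) :: complex)"
  have "4 * M * ((A\<^sup>2 - 1/4) * (- M * S)) = 4 * M * ((lam + N / 2 - N * A) * G)"
    using e[folded S_def G_def]
    by (simp add: M_def[symmetric] A_def[symmetric] N_def[symmetric] power2_eq_square algebra_simps)
  moreover have "4 * M \<noteq> 0" using \<mu> by (simp add: M_def)
  ultimately have "(A\<^sup>2 - 1/4) * (- M * S) = (lam + N / 2 - N * A) * G"
    using mult_left_cancel by blast
  moreover have "complex_of_real (a\<^sup>2 - 1/4) = A\<^sup>2 - 1/4" by (simp add: A_def)
  ultimately show ?thesis
    by (simp only: gauss_int_def S_def G_def M_def N_def A_def)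
qed

lemma gauss_weight_derivative:
  assumes "a > 1/2"
  shows "((\<lambda>a. gauss_weight lam n a) has_vector_derivative
    (gauss_weight lam n a * (- lam * of_real (1 / (a - 1/2)) + (lam + of_nat n) * of_real (1 / (a + 1/2))))) (at a)"
proof -
  have l: "((\<lambda>a. complex_of_real (ln (a - 1/2))) has_vector_derivative of_real (1 / (a - 1/2))) (at a)"
    "((\<lambda>a. complex_of_real (ln (a + 1/2))) has_vector_derivative of_real (1 / (a + 1/2))) (at a)"
    using assms by (intro has_vector_derivative_of_real; auto intro!: derivative_eq_intros simp: has_real_derivative_iff_has_vector_derivative[symmetric])+
  have "((\<lambda>a. - lam * of_real (ln (a - 1/2)) + (lam + of_nat n) * of_real (ln (a + 1/2))) has_vector_derivative
    (- lam * of_real (1 / (a - 1/2)) + (lam + of_nat n) * of_real (1 / (a + 1/2)))) (at a)"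
    by (intro has_vector_derivative_add has_vector_derivative_mult_right l)
  from field_vector_diff_chain_at[OF this DERIV_exp]
  show ?thesis unfolding gauss_weight_def by (simp add: o_def mult.commute)
qed

lemma gauss_weight_asymp:
  "((\<lambda>a. gauss_weight lam n a / of_real (a ^ n)) \<longlongrightarrow> 1) at_top"
proof -
  have l1: "((\<lambda>a::real. ln (a - 1/2) - ln a) \<longlongrightarrow> 0) at_top" by real_asymp
  have l2: "((\<lambda>a::real. ln (a + 1/2) - ln a) \<longlongrightarrow> 0) at_top" by real_asymp
  have "((\<lambda>a. exp (- lam * of_real (ln (a - 1/2) - ln a) + (lam + of_nat n) * of_real (ln (a + 1/2) - ln a)))
     \<longlongrightarrow> exp (- lam * of_real 0 + (lam + of_nat n) * of_real 0)) at_top"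
    by (intro tendsto_intros l1 l2)
  moreover have "\<forall>\<^sub>F a in at_top. exp (- lam * of_real (ln (a - 1/2) - ln a) + (lam + of_nat n) * of_real (ln (a + 1/2) - ln a))
     = gauss_weight lam n a / of_real (a ^ n)"
    using eventually_gt_at_top[of "1::real"]
  proof eventually_elim
    case (elim a)
    have "complex_of_real (a ^ n) = exp (of_nat n * of_real (ln a))"
      using elim by (simp add: exp_of_nat_mult exp_of_real)
    then show ?case
      unfolding gauss_weight_def by (simp add: exp_diff[symmetric] algebra_simps)
  qed
  ultimately show ?thesis by (simp add: tendsto_cong)
qed

text \<open>The left-hand side is constant in \<open>a\<close> by the differential equation; the constant is its limit at
  infinity.\<close>

lemma eigenfunction_gauss_int:
  fixes F :: "complex^'n::finite \<Rightarrow> complex"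
  assumes \<mu>: "\<mu> > 0" and F: "F \<in> A2 \<nu> \<mu> lam" and a: "a > 1/2"
  shows "gauss_weight lam CARD('n) a * gauss_int \<nu> \<mu> F z a = of_real ((pi / \<mu>) ^ CARD('n)) * F z"
proof -
  let ?N = "CARD('n)"
  define g where "g a = gauss_weight lam ?N a * gauss_int \<nu> \<mu> F z a" for a
  have L2: "F \<in> L2" and cF: "continuous_on UNIV F" using F smooth_continuous by (auto simp: A2_def)
  have d0: "(g has_vector_derivative 0) (at a within {1/2<..})" if "a \<in> {1/2<..}" for a
  proof -
    have a: "a > 1/2" "a > 0" using that by auto
    let ?S = "- of_real \<mu> * tint \<nu> \<mu> (\<lambda>s. s * exp (- (\<mu> * a) * s)) F z"
    let ?G = "gauss_int \<nu> \<mu> F z a"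
    let ?D = "- lam * of_real (1 / (a - 1/2)) + (lam + of_nat ?N) * of_real (1 / (a + 1/2))"
    have gd: "(g has_vector_derivative (gauss_weight lam ?N a * ?S + gauss_weight lam ?N a * ?D * ?G)) (at a)"
      unfolding g_def
      by (rule has_vector_derivative_mult[OF gauss_weight_derivative[OF a(1)] gauss_int_derivative[OF \<mu> a(2) L2]])
    have z: "?S + ?D * ?G = 0"
    proof -
      have nz: "complex_of_real a - 1/2 \<noteq> 0" "complex_of_real a + 1/2 \<noteq> 0"
        using a by (auto simp: complex_eq_iff)
      have "of_real (a\<^sup>2 - 1/4) * ?D = - lam * (of_real a + 1/2) + (lam + of_nat ?N) * (of_real a - 1/2)"
      proof -
        have f: "complex_of_real (a\<^sup>2 - 1/4) = (of_real a - 1/2) * (of_real a + 1/2)"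
          by (simp add: power2_eq_square algebra_simps)
        have "u * v * (- lam * (1 / u) + m * (1 / v)) = - lam * v + m * u" if "u \<noteq> 0" "v \<noteq> 0" for u v m :: complex
          using that by (simp add: field_simps)
        from this[OF nz] show ?thesis
          unfolding f by (simp only: of_real_divide of_real_diff of_real_add of_real_1 of_real_numeral)
      qed
      note D = this
      have "k * (S + D * G) = 0" if "k * S = X * G" "k * D = R" "X + R = 0" for k S D G X R :: complex
        using that by algebra
      from this[OF eigenfunction_gauss_int_ODE[OF \<mu> F a(1)] D]
      have "of_real (a\<^sup>2 - 1/4) * (?S + ?D * ?G) = 0" by (simp add: algebra_simps)
      moreover have "complex_of_real (a\<^sup>2 - 1/4) \<noteq> 0"
      proof -
        have "(1/2)\<^sup>2 < a\<^sup>2" using a by (intro power_strict_mono) auto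
        then show ?thesis by (simp add: power2_eq_square del: of_real_power of_real_diff)
      qed
      ultimately show ?thesis by simp
    qed
    have "w * s + w * d * g = 0" if "s + d * g = 0" for w s d g :: complex
      using that by algebra
    from gd[unfolded this[OF z]] show ?thesis by (rule has_vector_derivative_at_within)
  qed
  obtain c where c: "\<And>a. a \<in> {1/2<..} \<Longrightarrow> g a = c"
    using has_vector_derivative_zero_constant[OF _ d0] convex_real_interval by blast
  have "((\<lambda>a. gauss_weight lam ?N a / of_real (a ^ ?N) * (of_real ((\<mu> * a / pi) ^ ?N) * gauss_int \<nu> \<mu> F z a)) \<longlongrightarrow> 1 * F z) at_top"
    by (intro tendsto_mult gauss_weight_asymp gauss_int_tendsto \<mu> L2 cF)
  note lim = this
  have ev: "\<forall>\<^sub>F a in at_top. gauss_weight lam ?N a / of_real (a ^ ?N) * (of_real ((\<mu> * a / pi) ^ ?N) * gauss_int \<nu> \<mu> F z a)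
      = of_real ((\<mu> / pi) ^ ?N) * c"
    using eventually_gt_at_top[of "1::real"]
  proof eventually_elim
    case (elim a)
    have "(\<mu> * a / pi) ^ ?N = (\<mu> / pi) ^ ?N * a ^ ?N" by (simp add: power_mult_distrib power_divide)
    moreover have "complex_of_real (a ^ ?N) \<noteq> 0" using elim by simp
    moreover have "g a = c" using c[of a] elim by simp
    ultimately show ?case by (simp add: g_def[symmetric] mult_ac del: of_real_power)
  qed
  have "((\<lambda>a::real. of_real ((\<mu> / pi) ^ ?N) * c) \<longlongrightarrow> 1 * F z) at_top"
    using lim unfolding tendsto_cong[OF ev] .
  from tendsto_unique[OF trivial_limit_at_top_linorder tendsto_const this]
  have e: "of_real ((\<mu> / pi) ^ ?N) * c = F z" by simp
  have "complex_of_real ((pi / \<mu>) ^ ?N) * of_real ((\<mu> / pi) ^ ?N) = 1"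
    unfolding of_real_mult[symmetric] power_mult_distrib[symmetric] using \<mu> by simp
  then have "c = of_real ((pi / \<mu>) ^ ?N) * F z"
    unfolding e[symmetric] mult.assoc[symmetric] by simp
  then show ?thesis using c[of a] a by (simp add: g_def)
qed

section \<open>Laguerre polynomials\<close>

text \<open>The coefficients of the Laguerre polynomial \<open>L\<^sub>l\<^bsup>(n-1)\<^esup>\<close>.  The case distinction is necessary because
  \<open>l - k\<close> is a truncated subtraction, which would give the binomial coefficient \<open>1\<close> for \<open>k > l\<close>.\<close>

definition lag_coeff :: "nat \<Rightarrow> nat \<Rightarrow> nat \<Rightarrow> real" where
  "lag_coeff n l k = (if k \<le> l then (-1) ^ k * real ((l + n - 1) choose (l - k)) / fact k else 0)"

definition laguerre :: "nat \<Rightarrow> nat \<Rightarrow> real poly" where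
  "laguerre n l = (\<Sum>k\<le>l. monom (lag_coeff n l k) k)"

lemma coeff_laguerre: "coeff (laguerre n l) k = lag_coeff n l k"
proof -
  have "coeff (laguerre n l) k = (\<Sum>i\<le>l. if i = k then lag_coeff n l k else 0)"
    unfolding laguerre_def coeff_sum coeff_monom by (intro sum.cong) auto
  then show ?thesis by (simp add: lag_coeff_def)
qed

lemma poly_laguerre: "poly (laguerre n l) x = (\<Sum>k\<le>l. lag_coeff n l k * x ^ k)"
  by (simp add: laguerre_def poly_sum poly_monom)

lemma lag_coeff_rec:
  assumes "n > 0"
  shows "real (Suc k) * real (n + k) * lag_coeff n l (Suc k) = (real k - real l) * lag_coeff n l k"
proof (cases "k < l")
  case True
  define j where "j = l - Suc k"
  define N where "N = l + n - 1"
  have j: "l - k = Suc j" "l - Suc k = j" "j \<le> N" "N - j = n + k" "real k - real l = - real (Suc j)"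
    using True assms by (auto simp: j_def N_def)
  have "Suc j * (N choose Suc j) = (N - j) * (N choose j)"
    by (simp only: binomial_absorption binomial_absorb_comp)
  then have b: "real (n + k) * real (N choose j) = real (Suc j) * real (N choose Suc j)"
    unfolding j(4) of_nat_mult[symmetric] by simp
  have c: "lag_coeff n l (Suc k) = - ((-1) ^ k) * real (N choose j) / (real (Suc k) * fact k)"
    "lag_coeff n l k = (-1) ^ k * real (N choose Suc j) / fact k"
    using True by (simp_all only: lag_coeff_def j N_def[symmetric] fact_Suc) simp_all
  have "a * b * (- e * B / (a * f)) = (- d) * (e * B' / f)" if "b * B = d * B'" "a \<noteq> 0" for a b e f B d B' :: real
    using that by simp
  note gen = this
  show ?thesis unfolding c j(5) by (rule gen[OF b]) simp
qed (auto simp: lag_coeff_def)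

lemma laguerre_ODE:
  assumes "n > 0"
  shows "[:0, 1:] * pderiv (pderiv (laguerre n l)) + [:real n, -1:] * pderiv (laguerre n l) + smult (real l) (laguerre n l) = 0"
proof (rule poly_eqI)
  fix k
  let ?c = "lag_coeff n l"
  have "coeff ([:0, 1:] * pderiv (pderiv (laguerre n l)) + [:real n, -1:] * pderiv (laguerre n l) + smult (real l) (laguerre n l)) k
     = real (Suc k) * real (n + k) * ?c (Suc k) - (real k - real l) * ?c k"
    by (cases k) (simp_all add: coeff_laguerre coeff_pderiv algebra_simps)
  then show "coeff ([:0, 1:] * pderiv (pderiv (laguerre n l)) + [:real n, -1:] * pderiv (laguerre n l) + smult (real l) (laguerre n l)) k = coeff 0 k"
    using lag_coeff_rec[OF assms, of k l] by simp
qed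

text \<open>This class of profiles is closed under differentiation, which reduces the radial equation to the
  Laguerre equation for the polynomial.\<close>

definition exp_poly :: "real \<Rightarrow> real poly \<Rightarrow> real \<Rightarrow> real" where
  "exp_poly \<mu> p s = exp (- (\<mu> / 2) * s) * poly p (\<mu> * s)"

lemma exp_poly_derivative:
  "(exp_poly \<mu> p has_real_derivative \<mu> * exp_poly \<mu> (pderiv p - smult (1/2) p) s) (at s)"
  unfolding exp_poly_def[abs_def]
  by (rule derivative_eq_intros poly_DERIV DERIV_chain2[where f = "poly p"] refl | simp)+
    (simp add: algebra_simps)

lemma gauss_bdd_exp_poly:
  assumes "\<mu> > 0" shows "gauss_bdd (exp_poly \<mu> p)"
proof -
  have "exp_poly \<mu> p = (\<lambda>s. \<Sum>i\<le>degree p. (coeff p i * \<mu> ^ i) * (s ^ i * exp (- (\<mu> / 2) * s)))"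
    by (auto simp: exp_poly_def poly_altdef power_mult_distrib sum_distrib_left mult_ac intro!: sum.cong)
  moreover have "gauss_bdd \<dots>"
    using assms by (intro gauss_bdd_sum gauss_bdd_cmult gauss_bdd_power gauss_bdd_exp) auto
  ultimately show ?thesis by simp
qed

definition lagq :: "nat \<Rightarrow> real \<Rightarrow> nat \<Rightarrow> real \<Rightarrow> real" where
  "lagq n \<mu> l = exp_poly \<mu> (laguerre n l)"

text \<open>In terms of \<open>x = \<mu> s\<close> this is Laguerre's equation \<open>x p'' + (n - x) p' + l p = 0\<close>.\<close>

lemma lagq_radial:
  assumes "n > 0"
  obtains q1 q2 where "\<And>x. (lagq n \<mu> l has_real_derivative q1 x) (at x)" "\<And>x. (q1 has_real_derivative q2 x) (at x)"
    "continuous_on UNIV q2" "\<mu> > 0 \<Longrightarrow> gauss_bdd q1" "\<mu> > 0 \<Longrightarrow> gauss_bdd q2"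
    "radial_op (real n) \<mu> (lagq n \<mu> l) q1 q2 = (\<lambda>s. (- 2 * \<mu> * (2 * real l + real n)) * lagq n \<mu> l s)"
proof
  define p where "p = laguerre n l"
  define p1 where "p1 = pderiv p - smult (1/2) p"
  define p2 where "p2 = pderiv p1 - smult (1/2) p1"
  let ?q1 = "\<lambda>s. \<mu> * exp_poly \<mu> p1 s" and ?q2 = "\<lambda>s. \<mu> * (\<mu> * exp_poly \<mu> p2 s)"
  show "(lagq n \<mu> l has_real_derivative ?q1 x) (at x)" for x
    unfolding lagq_def p1_def p_def by (rule exp_poly_derivative)
  show "(?q1 has_real_derivative ?q2 x) (at x)" for x
    unfolding p2_def by (intro DERIV_cmult exp_poly_derivative)
  show "continuous_on UNIV ?q2" unfolding exp_poly_def by (intro continuous_intros)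
  show "gauss_bdd ?q1" "gauss_bdd ?q2" if "\<mu> > 0"
    using gauss_bdd_exp_poly[OF that] by (intro gauss_bdd_cmult; simp)+
  show "radial_op (real n) \<mu> (lagq n \<mu> l) ?q1 ?q2 = (\<lambda>s. (- 2 * \<mu> * (2 * real l + real n)) * lagq n \<mu> l s)"
  proof
    fix s
    define x where "x = \<mu> * s"
    define E where "E = exp (- (\<mu> / 2) * s)"
    define P0 where "P0 = poly p x"
    define P1 where "P1 = poly (pderiv p) x"
    define P2 where "P2 = poly (pderiv (pderiv p)) x"
    have ep: "exp_poly \<mu> p s = E * poly p x" for p by (simp add: exp_poly_def E_def x_def)
    have ode: "x * P2 + (real n - x) * P1 + real l * P0 = 0"
      using arg_cong[OF laguerre_ODE[OF assms, of l], of "\<lambda>p. poly p x"]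
      by (simp add: P0_def P1_def P2_def p_def left_diff_distrib)
    have "radial_op (real n) \<mu> (lagq n \<mu> l) ?q1 ?q2 s
       = 4 * \<mu> * E * (x * (P2 - P1 + P0 / 4) + real n * (P1 - P0 / 2) - x * P0 / 4)"
      unfolding radial_op_def lagq_def ep p2_def p1_def
      by (simp only: pderiv_diff pderiv_smult poly_diff poly_smult p_def[symmetric] P0_def[symmetric] P1_def[symmetric] P2_def[symmetric])
        (simp add: power2_eq_square field_simps x_def)
    also have "\<dots> = 4 * \<mu> * E * ((x * P2 + (real n - x) * P1 + real l * P0) - (real l + real n / 2) * P0)"
      by (simp add: field_simps)
    also have "\<dots> = (- 2 * \<mu> * (2 * real l + real n)) * lagq n \<mu> l s"
      unfolding ode by (simp add: lagq_def ep P0_def[symmetric] p_def[symmetric] field_simps)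
    finally show "radial_op (real n) \<mu> (lagq n \<mu> l) ?q1 ?q2 s = (- 2 * \<mu> * (2 * real l + real n)) * lagq n \<mu> l s" .
  qed
qed

lemma negative_binomial_sums:
  assumes "0 \<le> r" "r < (1::real)"
  shows "(\<lambda>m. real ((m + N) choose m) * r ^ m) sums ((1 / (1 - r)) ^ Suc N)"
proof -
  have "(\<lambda>m. ((- (real N + 1)) gchoose m) * (- r) ^ m) sums (1 + (- r)) powr (- (real N + 1))"
    by (rule gen_binomial_real) (use assms in simp)
  moreover have "((- (real N + 1)) gchoose m) * (- r) ^ m = real ((m + N) choose m) * r ^ m" for m
  proof -
    have "((- (real N + 1)) gchoose m) = (-1) ^ m * ((real m - (- (real N + 1)) - 1) gchoose m)"
      by (rule gbinomial_negated_upper)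
    also have "real m - (- (real N + 1)) - 1 = real (m + N)" by simp
    also have "real (m + N) gchoose m = real ((m + N) choose m)" by (rule binomial_gbinomial[symmetric])
    finally show ?thesis by (simp add: power_minus[of r])
  qed
  moreover have "(1 + (- r)) powr (- (real N + 1)) = (1 / (1 - r)) ^ Suc N"
  proof -
    have e: "- (real N + 1) = - real (Suc N)" "1 + (- r) = 1 - r" by simp_all
    show ?thesis
      unfolding e powr_minus using assms by (subst powr_realpow) (auto simp: power_one_over divide_inverse power_inverse)
  qed
  ultimately show ?thesis by simp
qed

text \<open>The double sum over \<open>l\<close> and the exponent \<open>k\<close> is exchanged.  For fixed \<open>k\<close> the sum over \<open>l\<close> is a negative
  binomial series, and the sum over \<open>k\<close> is then an exponential series.  Replacing \<open>x\<close> by \<open>- \<bar>x\<bar>\<close> makes all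
  terms nonnegative and yields the bound.\<close>

lemma laguerre_generating:
  assumes n: "n > 0" and r: "0 \<le> r" "r < 1"
  shows "(\<lambda>l. r ^ l * poly (laguerre n l) x) sums ((1 / (1 - r)) ^ n * exp (- (r * x / (1 - r))))"
    and "(\<Sum>l<M. \<bar>r ^ l * poly (laguerre n l) x\<bar>) \<le> (1 / (1 - r)) ^ n * exp (r * \<bar>x\<bar> / (1 - r))"
proof -
  define b where "b k l = (if k \<le> l then real ((l + n - 1) choose (l - k)) * r ^ l else 0)" for k l
  define G where "G y = (1 / (1 - r)) ^ n * exp (r * y / (1 - r))" for y
  have b0: "b k l \<ge> 0" for k l using r by (simp add: b_def)
  \<comment> \<open>The substitution \<open>l = m + k\<close> gives the negative binomial series with exponent \<open>n + k\<close>.\<close>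
  have col: "(b k has_sum (r / (1 - r)) ^ k * (1 / (1 - r)) ^ n) UNIV" for k
  proof -
    have e: "b k (m + k) = r ^ k * (real ((m + (n + k - 1)) choose m) * r ^ m)" for m
      using n by (simp add: b_def power_add add_ac)
    have z: "b k l = 0" if "l < k" for l using that by (simp add: b_def)
    have "(\<lambda>m. b k (m + k)) sums (r ^ k * (1 / (1 - r)) ^ Suc (n + k - 1))"
      unfolding e by (intro sums_mult negative_binomial_sums r)
    then have "b k sums (r ^ k * (1 / (1 - r)) ^ Suc (n + k - 1) + (\<Sum>i<k. b k i))"
      by (simp add: sums_iff_shift)
    moreover have "(\<Sum>i<k. b k i) = 0" by (intro sum.neutral) (use z in auto)
    moreover have "r ^ k * (1 / (1 - r)) ^ Suc (n + k - 1) = (r / (1 - r)) ^ k * (1 / (1 - r)) ^ n"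
      using n by (simp add: power_add power_divide)
    ultimately have "b k sums ((r / (1 - r)) ^ k * (1 / (1 - r)) ^ n)" by simp
    then show ?thesis by (rule sums_nonneg_imp_has_sum) (rule b0)
  qed
  define f where "f y p = b (fst p) (snd p) * (y ^ fst p / fact (fst p))" for y :: real and p
  have colf: "((\<lambda>l. f y (k, l)) has_sum ((r / (1 - r)) ^ k * (1 / (1 - r)) ^ n * (y ^ k / fact k))) UNIV" for y k
    unfolding f_def fst_conv snd_conv by (intro has_sum_cmult_left col)
  have tot: "((\<lambda>k. (r / (1 - r)) ^ k * (1 / (1 - r)) ^ n * (y ^ k / fact k)) has_sum G y) UNIV" for y
  proof -
    have "((\<lambda>k. (r * y / (1 - r)) ^ k /\<^sub>R fact k) has_sum exp (r * y / (1 - r))) UNIV"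
      by (rule norm_summable_imp_has_sum[OF summable_norm_exp exp_converges])
    from has_sum_cmult_right[OF this, of "(1 / (1 - r)) ^ n"] show ?thesis
      by (simp add: G_def power_divide power_mult_distrib divide_inverse mult_ac)
  qed
  have s0: "f y summable_on UNIV \<times> UNIV" if "y \<ge> 0" for y
    by (rule summable_on_SigmaI[OF colf]) (use tot that b0 in \<open>auto simp: f_def summable_on_def\<close>)
  have s: "f y summable_on UNIV \<times> UNIV" for y
  proof (rule abs_summable_summable)
    have "(\<lambda>p. norm (f y p)) = f \<bar>y\<bar>"
      by (auto simp: f_def abs_mult b0 power_abs)
    then show "(\<lambda>p. norm (f y p)) summable_on UNIV \<times> UNIV" using s0[of "\<bar>y\<bar>"] by simp
  qed
  have "(f y has_sum G y) (UNIV \<times> UNIV)" for y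
    by (rule has_sum_SigmaI[OF colf tot s])
  then have sw: "((\<lambda>(l, k). f y (k, l)) has_sum G y) (UNIV \<times> UNIV)" for y
    by (subst (asm) has_sum_swap)
  have row: "((\<lambda>k. (\<lambda>(l, k). f y (k, l)) (l, k)) has_sum (\<Sum>k\<le>l. f y (k, l))) UNIV" for y l
    unfolding case_prod_conv
    by (rule has_sum_finite_neutralI[where B = "{..l}"]) (auto simp: f_def b_def)
  have sums: "(\<lambda>l. \<Sum>k\<le>l. f y (k, l)) sums G y" for y
    by (rule has_sum_imp_sums[OF has_sum_SigmaD[OF sw row]])
  have lag: "r ^ l * poly (laguerre n l) x = (\<Sum>k\<le>l. f (- x) (k, l))" for l
    unfolding poly_laguerre sum_distrib_left
    by (intro sum.cong) (auto simp: f_def b_def lag_coeff_def power_minus[of x])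
  show "(\<lambda>l. r ^ l * poly (laguerre n l) x) sums ((1 / (1 - r)) ^ n * exp (- (r * x / (1 - r))))"
    unfolding lag using sums[of "- x"] by (simp add: G_def)
  have "(\<Sum>l<M. \<bar>r ^ l * poly (laguerre n l) x\<bar>) \<le> (\<Sum>l<M. \<Sum>k\<le>l. f \<bar>x\<bar> (k, l))"
    unfolding lag
    by (intro sum_mono order_trans[OF sum_abs]) (auto simp: f_def abs_mult b0 power_abs)
  also have "\<dots> \<le> (\<Sum>l. \<Sum>k\<le>l. f \<bar>x\<bar> (k, l))"
    by (rule sum_le_suminf[OF sums_summable[OF sums] finite_lessThan])
      (auto intro!: sum_nonneg mult_nonneg_nonneg divide_nonneg_nonneg b0 simp: f_def)
  also have "\<dots> = G \<bar>x\<bar>" by (rule sums_unique[OF sums, symmetric])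
  finally show "(\<Sum>l<M. \<bar>r ^ l * poly (laguerre n l) x\<bar>) \<le> (1 / (1 - r)) ^ n * exp (r * \<bar>x\<bar> / (1 - r))"
    by (simp add: G_def)
qed

lemma lagq_generating:
  assumes n: "n > 0" and r: "0 \<le> r" "r < 1"
  shows "(\<lambda>l. r ^ l * lagq n \<mu> l s) sums ((1 / (1 - r)) ^ n * exp (- (\<mu> * ((1 + r) / (2 * (1 - r)))) * s))" (is ?A)
    and "\<bar>\<Sum>l<M. r ^ l * lagq n \<mu> l s\<bar> \<le> (1 / (1 - r)) ^ n * exp (- (\<mu> / 2) * s + r * \<bar>\<mu> * s\<bar> / (1 - r))" (is ?B)
proof -
  have c: "- (\<mu> / 2) * s - r * (\<mu> * s) / (1 - r) = - (\<mu> * ((1 + r) / (2 * (1 - r)))) * s"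
    using r by (simp add: divide_simps) (simp add: algebra_simps)
  have e: "exp (- (\<mu> / 2) * s) * exp (- (r * (\<mu> * s) / (1 - r))) = exp (- (\<mu> * ((1 + r) / (2 * (1 - r)))) * s)"
    unfolding exp_add[symmetric] c[symmetric] by simp
  have p: "r ^ l * lagq n \<mu> l s = exp (- (\<mu> / 2) * s) * (r ^ l * poly (laguerre n l) (\<mu> * s))" for l
    by (simp add: lagq_def exp_poly_def)
  have "(\<lambda>l. exp (- (\<mu> / 2) * s) * (r ^ l * poly (laguerre n l) (\<mu> * s))) sums
     (exp (- (\<mu> / 2) * s) * ((1 / (1 - r)) ^ n * exp (- (r * (\<mu> * s) / (1 - r)))))"
    by (intro sums_mult laguerre_generating n r)
  also have "exp (- (\<mu> / 2) * s) * ((1 / (1 - r)) ^ n * exp (- (r * (\<mu> * s) / (1 - r))))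
     = (1 / (1 - r)) ^ n * (exp (- (\<mu> / 2) * s) * exp (- (r * (\<mu> * s) / (1 - r))))" by simp
  finally show ?A unfolding p e .
  have "\<bar>\<Sum>l<M. r ^ l * lagq n \<mu> l s\<bar> = exp (- (\<mu> / 2) * s) * \<bar>\<Sum>l<M. r ^ l * poly (laguerre n l) (\<mu> * s)\<bar>"
    unfolding p sum_distrib_left[symmetric] by (simp add: abs_mult)
  also have "\<dots> \<le> exp (- (\<mu> / 2) * s) * ((1 / (1 - r)) ^ n * exp (r * \<bar>\<mu> * s\<bar> / (1 - r)))"
    by (intro mult_left_mono order_trans[OF sum_abs laguerre_generating(2)] n r) simp
  also have "\<dots> = (1 / (1 - r)) ^ n * exp (- (\<mu> / 2) * s + r * \<bar>\<mu> * s\<bar> / (1 - r))"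
    unfolding exp_add by simp
  finally show ?B .
qed

lemma gauss_bdd_lagq: "\<mu> > 0 \<Longrightarrow> gauss_bdd (lagq n \<mu> l)"
  unfolding lagq_def by (rule gauss_bdd_exp_poly)

lemma measurable_lagq: "lagq n \<mu> l \<in> borel_measurable borel"
  unfolding lagq_def exp_poly_def[abs_def]
  by (intro borel_measurable_continuous_onI continuous_intros)

lemma tint_sum:
  assumes "\<And>i. i \<in> I \<Longrightarrow> gauss_bdd (q i)" "f \<in> L2"
  shows "tint \<nu> \<mu> (\<lambda>s. \<Sum>i\<in>I. c i * q i s) f z = (\<Sum>i\<in>I. of_real (c i) * tint \<nu> \<mu> (q i) f z)"
proof -
  have "tker \<nu> \<mu> (\<lambda>s. \<Sum>i\<in>I. c i * q i s) z w * f w = (\<Sum>i\<in>I. of_real (c i) * (tker \<nu> \<mu> (q i) z w * f w))" for w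
    by (simp add: tker_def sum_distrib_left sum_distrib_right mult_ac)
  then have "tint \<nu> \<mu> (\<lambda>s. \<Sum>i\<in>I. c i * q i s) f z = (\<Sum>i\<in>I. LINT w|lebesgue. of_real (c i) * (tker \<nu> \<mu> (q i) z w * f w))"
    unfolding tint_def
    by (simp only:) (intro Bochner_Integration.integral_sum integrable_mult_right tint_integrable assms)
  then show ?thesis by (simp add: tint_def)
qed

lemma tint_cmult: "tint \<nu> \<mu> (\<lambda>s. c * q s) f z = of_real c * tint \<nu> \<mu> q f z"
proof -
  have "tker \<nu> \<mu> (\<lambda>s. c * q s) z w * f w = of_real c * (tker \<nu> \<mu> q z w * f w)" for w
    by (simp add: tker_def)
  then show ?thesis by (simp only: tint_def integral_mult_right_zero)
qed

text \<open>The majorant \<open>exp (- \<mu> s / 2 + r \<mu> s / (1 - r))\<close> of the partial sums decays only for \<open>r < 1/3\<close>.  Here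
  \<open>r = 1/4\<close>, which corresponds to \<open>a = 5/6\<close>.\<close>

lemma laguerre_series_small:
  fixes f :: "complex^'n::finite \<Rightarrow> complex"
  assumes \<mu>: "\<mu> > 0" and f: "f \<in> L2"
  shows "(\<lambda>N. \<Sum>l<N. of_real ((1/4) ^ l) * tint \<nu> \<mu> (lagq CARD('n) \<mu> l) f z) \<longlonglongrightarrow> of_real ((4/3) ^ CARD('n)) * gauss_int \<nu> \<mu> f z (5/6)"
proof -
  let ?n = "CARD('n)"
  have n: "?n > 0" by simp
  define W where "W s = (4/3) ^ ?n * exp (- (\<mu> / 6) * s)" for s
  have gW: "gauss_bdd W" unfolding W_def[abs_def] using \<mu> by (intro gauss_bdd_cmult gauss_bdd_exp) auto
  have "(\<lambda>N. tint \<nu> \<mu> (\<lambda>s. \<Sum>l<N. (1/4) ^ l * lagq ?n \<mu> l s) f z) \<longlonglongrightarrow> tint \<nu> \<mu> (\<lambda>s. (4/3) ^ ?n * exp (- (\<mu> * (5/6)) * s)) f z"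
  proof (rule tint_dominated[OF gW f])
    show "(\<lambda>s. \<Sum>l<N. (1/4) ^ l * lagq ?n \<mu> l s) \<in> borel_measurable borel" for N
      using measurable_lagq by (intro borel_measurable_sum borel_measurable_times borel_measurable_const)
    show "(\<lambda>s. (4/3) ^ ?n * exp (- (\<mu> * (5/6)) * s)) \<in> borel_measurable borel" by measurable
    fix N :: nat and s :: real assume s: "s \<ge> 0"
    show "\<bar>\<Sum>l<N. (1/4) ^ l * lagq ?n \<mu> l s\<bar> \<le> W s"
      using lagq_generating(2)[OF n, where r = "1/4" and M = N and \<mu> = \<mu> and s = s] s \<mu> by (simp add: W_def)
    show "(\<lambda>N. \<Sum>l<N. (1/4) ^ l * lagq ?n \<mu> l s) \<longlonglongrightarrow> (4/3) ^ ?n * exp (- (\<mu> * (5/6)) * s)"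
      using lagq_generating(1)[OF n, where r = "1/4" and \<mu> = \<mu> and s = s] by (simp add: sums_def)
  qed
  then show ?thesis
    unfolding gauss_int_def tint_cmult tint_sum[OF gauss_bdd_lagq[OF \<mu>] f] .
qed

text \<open>For functions supported in the ball of radius \<open>R\<close> and points \<open>z\<close> of that ball only the values
  \<open>s \<le> (2 R)\<^sup>2\<close> matter.  Truncating all profiles there removes the restriction to small \<open>r\<close>.\<close>

lemma laguerre_series_compact:
  fixes g :: "complex^'n::finite \<Rightarrow> complex"
  assumes \<mu>: "\<mu> > 0" and g: "g \<in> L2" "integrable lebesgue g" and supp: "\<And>w. norm w > R \<Longrightarrow> g w = 0"
    and r: "0 \<le> r" "r < 1"
  shows "norm z \<le> R \<Longrightarrow> (\<lambda>N. \<Sum>l<N. of_real (r ^ l) * tint \<nu> \<mu> (lagq CARD('n) \<mu> l) g z)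
      \<longlonglongrightarrow> of_real ((1 / (1 - r)) ^ CARD('n)) * gauss_int \<nu> \<mu> g z ((1 + r) / (2 * (1 - r)))"
    and "\<exists>K. \<forall>N z. norm z \<le> R \<longrightarrow> norm (\<Sum>l<N. of_real (r ^ l) * tint \<nu> \<mu> (lagq CARD('n) \<mu> l) g z) \<le> K"
proof -
  let ?n = "CARD('n)"
  have n: "?n > 0" by simp
  define S where "S = (2 * R)\<^sup>2"
  define T where "T q s = (if s \<le> S then q s else 0)" for q :: "real \<Rightarrow> real" and s
  define C where "C = (1 / (1 - r)) ^ ?n * exp (r * (\<mu> * S) / (1 - r))"
  have C0: "C \<ge> 0" using r by (simp add: C_def)
  have S0: "S \<ge> 0" by (simp add: S_def)
  have gT: "gauss_bdd (T (\<lambda>_. C))"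
  proof (rule gauss_bddI[where c = 1 and C = "C * exp S"])
    show "T (\<lambda>_. C) \<in> borel_measurable borel" unfolding T_def[abs_def] by measurable
    fix s :: real
    have "C * 1 \<le> C * exp (S - s)" if "s \<le> S" using C0 that by (intro mult_left_mono) auto
    then show "\<bar>T (\<lambda>_. C) s\<bar> \<le> C * exp S * exp (- 1 * s)"
      using C0 by (simp add: T_def exp_diff exp_minus divide_inverse mult.assoc)
  qed simp
  have near: "tker \<nu> \<mu> q z w * g w = tker \<nu> \<mu> (T q) z w * g w" if "norm z \<le> R" for q z w
  proof (cases "norm w > R")
    case False
    then have "norm (z - w) \<le> 2 * R" using norm_triangle_ineq4[of z w] that by simp
    then have "(norm (z - w))\<^sup>2 \<le> S" unfolding S_def by (intro power_mono) auto
    then show ?thesis by (simp add: tker_def T_def)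
  qed (simp add: supp)
  have nearI: "tint \<nu> \<mu> q g z = tint \<nu> \<mu> (T q) g z" if "norm z \<le> R" for q z
    unfolding tint_def by (rule Bochner_Integration.integral_cong[OF refl near[OF that]])
  define Q where "Q N s = (\<Sum>l<N. r ^ l * lagq ?n \<mu> l s)" for N s
  have mQ: "Q N \<in> borel_measurable borel" for N
    unfolding Q_def[abs_def] using measurable_lagq by (intro borel_measurable_sum borel_measurable_times borel_measurable_const)
  have le: "\<bar>T (Q N) s\<bar> \<le> T (\<lambda>_. C) s" if s: "s \<ge> 0" for N s
  proof (cases "s \<le> S")
    case True
    have "\<bar>Q N s\<bar> \<le> (1 / (1 - r)) ^ ?n * exp (- (\<mu> / 2) * s + r * \<bar>\<mu> * s\<bar> / (1 - r))"
      unfolding Q_def by (rule lagq_generating(2)[OF n r])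
    also have "\<dots> \<le> C"
      unfolding C_def
    proof (intro mult_left_mono)
      have "r * (\<mu> * s) / (1 - r) \<le> r * (\<mu> * S) / (1 - r)"
        using True r \<mu> by (intro divide_right_mono mult_left_mono) auto
      moreover have "\<bar>\<mu> * s\<bar> = \<mu> * s" "- (\<mu> / 2) * s \<le> 0" using s \<mu> by auto
      ultimately have "- (\<mu> / 2) * s + r * \<bar>\<mu> * s\<bar> / (1 - r) \<le> r * (\<mu> * S) / (1 - r)" by linarith
      then show "exp (- (\<mu> / 2) * s + r * \<bar>\<mu> * s\<bar> / (1 - r)) \<le> exp (r * (\<mu> * S) / (1 - r))"
        unfolding exp_le_cancel_iff .
    qed (use r in simp)
    finally show ?thesis using True by (simp add: T_def)
  qed (simp add: T_def)
  have part: "(\<Sum>l<N. of_real (r ^ l) * tint \<nu> \<mu> (lagq ?n \<mu> l) g z) = tint \<nu> \<mu> (Q N) g z" for N z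
    unfolding Q_def[abs_def] by (rule tint_sum[OF gauss_bdd_lagq[OF \<mu>] g(1), symmetric])
  show "(\<lambda>N. \<Sum>l<N. of_real (r ^ l) * tint \<nu> \<mu> (lagq ?n \<mu> l) g z)
      \<longlonglongrightarrow> of_real ((1 / (1 - r)) ^ ?n) * gauss_int \<nu> \<mu> g z ((1 + r) / (2 * (1 - r)))" if z: "norm z \<le> R"
    unfolding part gauss_int_def tint_cmult[symmetric, of "(1 / (1 - r)) ^ ?n"]
      nearI[OF z, of "Q N" for N] nearI[OF z, of "\<lambda>s. (1 / (1 - r)) ^ ?n * exp (- (\<mu> * ((1 + r) / (2 * (1 - r)))) * s)"]
  proof (rule tint_dominated[OF gT g(1) _ _ le])
    show "T (Q N) \<in> borel_measurable borel" for N unfolding T_def[abs_def] using mQ[of N] by measurable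
    show "T (\<lambda>s. (1 / (1 - r)) ^ ?n * exp (- (\<mu> * ((1 + r) / (2 * (1 - r)))) * s)) \<in> borel_measurable borel"
      unfolding T_def[abs_def] by measurable
    show "(\<lambda>N. T (Q N) s) \<longlonglongrightarrow> T (\<lambda>s. (1 / (1 - r)) ^ ?n * exp (- (\<mu> * ((1 + r) / (2 * (1 - r)))) * s)) s" for s
      using lagq_generating(1)[OF n r, of \<mu> s] by (simp add: T_def Q_def sums_def)
  qed
  have "norm (tint \<nu> \<mu> (Q N) g z) \<le> (LINT w|lebesgue. C * norm (g w))" if z: "norm z \<le> R" for N z
  proof -
    have le2: "norm (tker \<nu> \<mu> (Q N) z w * g w) \<le> C * norm (g w)" for w
    proof -
      have "\<bar>T (Q N) ((norm (z - w))\<^sup>2)\<bar> \<le> C"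
        using le[of "(norm (z - w))\<^sup>2" N] C0 by (simp add: T_def split: if_splits)
      then show ?thesis unfolding near[OF z, of "Q N" w] norm_mult norm_tker by (intro mult_right_mono) auto
    qed
    have "integrable lebesgue (\<lambda>w. tker \<nu> \<mu> (Q N) z w * g w)"
      by (rule tint_integrable[OF _ g(1)])
        (auto simp: Q_def[abs_def] intro!: gauss_bdd_sum gauss_bdd_cmult gauss_bdd_lagq \<mu>)
    then have "(LINT w|lebesgue. norm (tker \<nu> \<mu> (Q N) z w * g w)) \<le> (LINT w|lebesgue. C * norm (g w))"
      by (intro integral_mono integrable_norm integrable_mult_right g(2) le2)
    then show ?thesis unfolding tint_def by (rule order_trans[OF integral_norm_bound])
  qed
  then show "\<exists>K. \<forall>N z. norm z \<le> R \<longrightarrow> norm (\<Sum>l<N. of_real (r ^ l) * tint \<nu> \<mu> (lagq ?n \<mu> l) g z) \<le> K"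
    unfolding part by blast
qed

section \<open>Reproducing property\<close>

lemma A2_D:
  assumes "F \<in> A2 \<nu> \<mu> lam"
  shows "F \<in> L2" "smooth F" "Delta \<nu> \<mu> (F :: complex^'n::finite \<Rightarrow> complex) z = - 2 * of_real \<mu> * (2 * lam + of_nat CARD('n)) * F z"
  using assms by (auto simp: A2_def)

text \<open>The profile has eigenvalue \<open>l\<close>, so that \<open>(lam - l) tint F = 0\<close>.\<close>

lemma A2_tint_lagq_zero:
  fixes F :: "complex^'n::finite \<Rightarrow> complex"
  assumes \<mu>: "\<mu> > 0" and F: "F \<in> A2 \<nu> \<mu> lam" and l: "lam \<noteq> of_nat l"
  shows "tint \<nu> \<mu> (lagq CARD('n) \<mu> l) F z = 0"
proof -
  let ?n = "CARD('n)"
  let ?q = "lagq ?n \<mu> l"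
  obtain q1 q2 where d: "\<And>x. (?q has_real_derivative q1 x) (at x)" "\<And>x. (q1 has_real_derivative q2 x) (at x)"
    "continuous_on UNIV q2" and b: "gauss_bdd q1" "gauss_bdd q2"
    and r: "radial_op (real ?n) \<mu> ?q q1 q2 = (\<lambda>s. (- 2 * \<mu> * (2 * real l + real ?n)) * ?q s)"
    using lagq_radial[where n = ?n and \<mu> = \<mu> and l = l, OF zero_less_card_finite] \<mu> by metis
  have "tint \<nu> \<mu> (radial_op (real ?n) \<mu> ?q q1 q2) F z = (- 2 * of_real \<mu> * (2 * lam + of_nat ?n)) * tint \<nu> \<mu> ?q F z"
    by (rule eigenfunction_radial[OF A2_D(2,1,3)[OF F] d gauss_bdd_lagq[OF \<mu>] b])
  then have e: "of_real (- 2 * \<mu> * (2 * real l + real ?n)) * tint \<nu> \<mu> ?q F z = (- 2 * of_real \<mu> * (2 * lam + of_nat ?n)) * tint \<nu> \<mu> ?q F z"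
    by (simp only: r tint_cmult)
  define I where "I = tint \<nu> \<mu> ?q F z"
  have "4 * of_real \<mu> * ((lam - of_nat l) * I) = 0"
    using e[folded I_def] by (auto simp: algebra_simps)
  then show ?thesis using l \<mu> by (auto simp: I_def)
qed

text \<open>All terms of the series for \<open>M\<^sub>r F\<close> vanish, while \<open>M\<^sub>r F\<close> is a nonzero multiple of \<open>F\<close>.\<close>

lemma A2_trivial:
  fixes F :: "complex^'n::finite \<Rightarrow> complex"
  assumes \<mu>: "\<mu> > 0" and F: "F \<in> A2 \<nu> \<mu> lam" and l: "\<And>l. lam \<noteq> of_nat l"
  shows "F z = 0"
proof -
  let ?n = "CARD('n)"
  have "(\<lambda>N::nat. 0) \<longlonglongrightarrow> of_real ((4/3) ^ ?n) * gauss_int \<nu> \<mu> F z (5/6)"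
    using laguerre_series_small[OF \<mu> A2_D(1)[OF F], of \<nu> z] by (simp add: A2_tint_lagq_zero[OF \<mu> F l])
  then have "of_real ((4/3) ^ ?n) * gauss_int \<nu> \<mu> F z (5/6) = 0"
    by (rule LIMSEQ_unique[OF _ tendsto_const])
  then have "gauss_int \<nu> \<mu> F z (5/6) = 0" by simp
  then have "of_real ((pi / \<mu>) ^ ?n) * F z = 0"
    using eigenfunction_gauss_int[OF \<mu> F, of "5/6" z] by simp
  then show ?thesis using \<mu> by simp
qed

text \<open>Only the term \<open>r\<^sup>l P\<^sub>l F\<close> of the series for \<open>M\<^sub>r F = r\<^sup>l F\<close> survives.\<close>

lemma A2_reproducing:
  fixes F :: "complex^'n::finite \<Rightarrow> complex"
  assumes \<mu>: "\<mu> > 0" and F: "F \<in> A2 \<nu> \<mu> (of_nat l)"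
  shows "tint \<nu> \<mu> (lagq CARD('n) \<mu> l) F z = of_real ((pi / \<mu>) ^ CARD('n)) * F z"
proof -
  let ?n = "CARD('n)"
  let ?I = "tint \<nu> \<mu> (lagq ?n \<mu> l) F z"
  have z: "tint \<nu> \<mu> (lagq ?n \<mu> m) F z = 0" if "m \<noteq> l" for m
    by (rule A2_tint_lagq_zero[OF \<mu> F]) (use that in simp)
  have s: "(\<Sum>m<N. of_real ((1/4) ^ m) * tint \<nu> \<mu> (lagq ?n \<mu> m) F z) = of_real ((1/4) ^ l) * ?I" if "N \<ge> Suc l" for N
  proof -
    have "(\<Sum>m<N. of_real ((1/4) ^ m) * tint \<nu> \<mu> (lagq ?n \<mu> m) F z) = (\<Sum>m\<in>{l}. of_real ((1/4) ^ m) * tint \<nu> \<mu> (lagq ?n \<mu> m) F z)"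
      using that by (intro sum.mono_neutral_right) (auto simp: z)
    then show ?thesis by simp
  qed
  have "(\<lambda>N. \<Sum>m<N. of_real ((1/4) ^ m) * tint \<nu> \<mu> (lagq ?n \<mu> m) F z) \<longlonglongrightarrow> of_real ((1/4) ^ l) * ?I"
    by (rule tendsto_eventually, rule eventually_sequentiallyI[of "Suc l"]) (rule s)
  from LIMSEQ_unique[OF this laguerre_series_small[OF \<mu> A2_D(1)[OF F]]]
  have e: "of_real ((1/4) ^ l) * ?I = of_real ((4/3) ^ ?n) * gauss_int \<nu> \<mu> F z (5/6)" .
  have "gauss_weight (of_nat l) ?n (5/6) = of_real (4 ^ l * (4/3) ^ ?n)"
  proof -
    have "gauss_weight (of_nat l) ?n (5/6) = of_real (exp (- real l * ln (1/3) + (real l + real ?n) * ln (4/3)))"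
      by (simp add: gauss_weight_def exp_of_real[symmetric])
    also have "exp (- real l * ln (1/3) + (real l + real ?n) * ln (4/3)) = exp (real l * (ln (4/3) - ln (1/3))) * exp (real ?n * ln (4/3))"
      by (simp add: exp_add[symmetric] algebra_simps)
    also have "ln (4/3) - ln (1/3) = ln (4::real)" by (simp add: ln_div)
    also have "exp (real l * ln 4) * exp (real ?n * ln (4/3)) = 4 ^ l * (4/3::real) ^ ?n"
      by (simp add: exp_of_nat_mult)
    finally show ?thesis .
  qed
  then have "of_real (4 ^ l) * (of_real ((4/3) ^ ?n) * gauss_int \<nu> \<mu> F z (5/6)) = of_real ((pi / \<mu>) ^ ?n) * F z"
    using eigenfunction_gauss_int[OF \<mu> F, of "5/6" z] by (simp add: mult.assoc)
  then have "of_real (4 ^ l) * (of_real ((1/4) ^ l) * ?I) = of_real ((pi / \<mu>) ^ ?n) * F z"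
    unfolding e .
  moreover have "complex_of_real (4 ^ l) * of_real ((1/4) ^ l) = 1"
    unfolding of_real_mult[symmetric] power_mult_distrib[symmetric] by simp
  ultimately show ?thesis unfolding mult.assoc[symmetric] by simp
qed

section \<open>Smoothness of the integrals\<close>

definition exp_bdd :: "('a::euclidean_space \<Rightarrow> complex) \<Rightarrow> bool" where
  "exp_bdd p \<longleftrightarrow> p \<in> borel_measurable borel \<and> (\<exists>C b. C \<ge> 0 \<and> b \<ge> 0 \<and> (\<forall>w. norm (p w) \<le> C * exp (b * norm w)))"

lemma exp_bdd_const: "exp_bdd (\<lambda>w. c)"
  unfolding exp_bdd_def by (intro conjI exI[of _ "norm c"] exI[of _ "0::real"]) auto

lemma exp_bdd_mult:
  assumes "exp_bdd p" "exp_bdd q" shows "exp_bdd (\<lambda>w. p w * q w)"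
proof -
  obtain C b where p: "p \<in> borel_measurable borel" "C \<ge> 0" "b \<ge> 0" "\<And>w. norm (p w) \<le> C * exp (b * norm w)"
    using assms(1) unfolding exp_bdd_def by blast
  obtain D d where q: "q \<in> borel_measurable borel" "D \<ge> 0" "d \<ge> 0" "\<And>w. norm (q w) \<le> D * exp (d * norm w)"
    using assms(2) unfolding exp_bdd_def by blast
  have "norm (p w * q w) \<le> (C * D) * exp ((b + d) * norm w)" for w
  proof -
    have "norm (p w * q w) \<le> (C * exp (b * norm w)) * (D * exp (d * norm w))"
      unfolding norm_mult using p q by (intro mult_mono) auto
    also have "\<dots> = (C * D) * exp ((b + d) * norm w)" by (simp add: distrib_right exp_add)
    finally show ?thesis .
  qed
  then show ?thesis unfolding exp_bdd_def using p q
    by (intro conjI borel_measurable_times exI[of _ "C * D"] exI[of _ "b + d"]) auto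
qed

lemma exp_bdd_linear:
  assumes "bounded_linear (L :: 'a::euclidean_space \<Rightarrow> complex)" shows "exp_bdd L"
proof -
  obtain K where K: "K \<ge> 0" "\<And>w. norm (L w) \<le> norm w * K"
    using bounded_linear.nonneg_bounded[OF assms] by blast
  have "norm (L w) \<le> K * exp (1 * norm w)" for w
  proof -
    have "norm w \<le> exp (norm w)" using exp_ge_add_one_self[of "norm w"] by linarith
    then have "norm w * K \<le> exp (norm w) * K" using K(1) by (rule mult_right_mono)
    then show ?thesis using K(2)[of w] by (simp add: mult.commute)
  qed
  then show ?thesis unfolding exp_bdd_def
    using K(1) borel_measurable_continuous_onI[OF linear_continuous_on[OF assms]]
    by (intro conjI exI[of _ K] exI[of _ 1]) auto
qed

text \<open>The part of the kernels that couples \<open>z\<close> and \<open>w\<close>, together with the Gaussian in \<open>w\<close>.  What is left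
  of a kernel is a sum of products of a function of \<open>z\<close> and one of \<open>w\<close>, and the coupling is holomorphic
  in \<open>z\<close>, so that differentiation in \<open>z\<close> only produces factors linear in \<open>w\<close>.\<close>

definition fock_weight :: "real \<Rightarrow> real \<Rightarrow> complex^'n::finite \<Rightarrow> complex^'n \<Rightarrow> complex" where
  "fock_weight \<nu> \<mu> z w = exp (of_real \<mu> * herm z w) * exp ((\<i> * of_real \<nu> / 2 - of_real \<mu> / 2) * herm w w)"

lemma fock_weight_continuous: "continuous_on UNIV (fock_weight \<nu> \<mu> z)"
  unfolding fock_weight_def by (intro continuous_intros)

lemma norm_fock_weight_le:
  assumes "\<mu> > 0"
  shows "norm (fock_weight \<nu> \<mu> z w) \<le> exp (\<mu> * norm z * norm w - \<mu> / 2 * (norm w)\<^sup>2)"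
proof -
  have "Re (herm z w) \<le> norm z * norm w"
    using complex_Re_le_cmod[of "herm z w"] norm_herm_le[of z w] by linarith
  then have "\<mu> * Re (herm z w) \<le> \<mu> * (norm z * norm w)" using assms by (intro mult_left_mono) auto
  moreover have "norm (fock_weight \<nu> \<mu> z w) = exp (\<mu> * Re (herm z w) - \<mu> / 2 * (norm w)\<^sup>2)"
    by (simp add: fock_weight_def norm_mult exp_add[symmetric] herm_self del: of_real_power)
  ultimately show ?thesis by (simp add: mult.assoc)
qed

lemma fock_envelope:
  assumes \<mu>: "\<mu> > 0" and b: "b \<ge> 0"
  shows "exp (b * norm w) * exp (\<mu> * norm z * norm w - \<mu> / 2 * (norm w)\<^sup>2)
     \<le> exp ((b + \<mu> * norm z)\<^sup>2 / \<mu>) * exp (- (\<mu> / 4) * (norm (w - 0))\<^sup>2)"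
proof -
  define B where "B = b + \<mu> * norm z"
  define x where "x = norm w"
  have "0 \<le> (\<mu> * x / 2 - B)\<^sup>2" by simp
  also have "(\<mu> * x / 2 - B)\<^sup>2 = \<mu> * (\<mu> / 4 * x\<^sup>2 - B * x + B\<^sup>2 / \<mu>)"
    using \<mu> by (simp add: power2_eq_square field_simps)
  finally have "B * x \<le> \<mu> / 4 * x\<^sup>2 + B\<^sup>2 / \<mu>"
    using \<mu> by (simp add: zero_le_mult_iff)
  then have "b * x + (\<mu> * norm z * x - \<mu> / 2 * x\<^sup>2) \<le> B\<^sup>2 / \<mu> + - (\<mu> / 4) * x\<^sup>2"
    by (simp add: B_def distrib_right)
  then show ?thesis
    unfolding exp_add[symmetric] exp_le_cancel_iff B_def x_def diff_zero .
qed

lemma fock_L2: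
  fixes p :: "complex^'n::finite \<Rightarrow> complex"
  assumes \<mu>: "\<mu> > 0" and p: "exp_bdd p"
  shows "(\<lambda>w. p w * fock_weight \<nu> \<mu> z w) \<in> L2"
proof -
  obtain C b where p: "p \<in> borel_measurable borel" "C \<ge> 0" "b \<ge> 0" "\<And>w. norm (p w) \<le> C * exp (b * norm w)"
    using p unfolding exp_bdd_def by blast
  have "(\<lambda>w. complex_of_real (exp (- (\<mu> / 4) * (norm (w - 0))\<^sup>2))) \<in> (L2 :: (complex^'n \<Rightarrow> complex) set)"
    using \<mu> by (intro gaussian_shift_L2) auto
  then have L: "(\<lambda>w. of_real (C * exp ((b + \<mu> * norm z)\<^sup>2 / \<mu>)) * complex_of_real (exp (- (\<mu> / 4) * (norm (w - 0))\<^sup>2))) \<in> (L2 :: (complex^'n \<Rightarrow> complex) set)"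
    by (rule L2_cmult)
  show ?thesis
  proof (rule L2_bound[OF L])
    show "(\<lambda>w. p w * fock_weight \<nu> \<mu> z w) \<in> borel_measurable lebesgue"
      by (rule measurable_completion)
        (use borel_measurable_times[OF p(1) borel_measurable_continuous_onI[OF fock_weight_continuous]] in simp)
    fix w
    have "norm (p w * fock_weight \<nu> \<mu> z w) \<le> (C * exp (b * norm w)) * exp (\<mu> * norm z * norm w - \<mu> / 2 * (norm w)\<^sup>2)"
      unfolding norm_mult using p by (intro mult_mono norm_fock_weight_le \<mu>) auto
    also have "\<dots> \<le> C * (exp ((b + \<mu> * norm z)\<^sup>2 / \<mu>) * exp (- (\<mu> / 4) * (norm (w - 0))\<^sup>2))"
      by (subst mult.assoc) (intro mult_left_mono fock_envelope \<mu> p)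
    also have "\<dots> = norm (of_real (C * exp ((b + \<mu> * norm z)\<^sup>2 / \<mu>)) * complex_of_real (exp (- (\<mu> / 4) * (norm (w - 0))\<^sup>2)))"
      using p(2) by (simp add: norm_mult)
    finally show "norm (p w * fock_weight \<nu> \<mu> z w) \<le> norm (of_real (C * exp ((b + \<mu> * norm z)\<^sup>2 / \<mu>)) * complex_of_real (exp (- (\<mu> / 4) * (norm (w - 0))\<^sup>2)))" .
  qed
qed

lemma fock_integrable:
  "\<mu> > 0 \<Longrightarrow> exp_bdd p \<Longrightarrow> f \<in> L2 \<Longrightarrow> integrable lebesgue (\<lambda>w. p w * fock_weight \<nu> \<mu> z w * f w)"
  by (rule L2_mult_integrable[OF fock_L2])

lemma exp_remainder_complex: "norm (exp y - 1 - y) \<le> (norm y)\<^sup>2 * exp (norm y)" for y :: complex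
proof -
  have "norm (exp y - (\<Sum>k\<le>1. y ^ k / fact k)) \<le> exp \<bar>Re y\<bar> * (norm y) ^ Suc 1 / fact 1"
    by (rule Taylor_exp)
  also have "\<dots> \<le> exp (norm y) * (norm y)\<^sup>2"
    using abs_Re_le_cmod[of y] by (simp add: power2_eq_square mult_right_mono)
  finally show ?thesis by (simp add: mult.commute diff_diff_eq)
qed

text \<open>The remainder is controlled by \<open>|exp y - 1 - y| \<le> |y|\<^sup>2 exp |y|\<close> for \<open>y = \<mu> herm h w\<close>.  The resulting
  factor \<open>|w|\<^sup>2 exp (\<mu> |w|)\<close> is again absorbed by the Gaussian weight.\<close>

lemma fock_integral_derivative:
  fixes p :: "complex^'n::finite \<Rightarrow> complex"
  assumes \<mu>: "\<mu> > 0" and p: "exp_bdd p" and f: "f \<in> L2"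
  shows "((\<lambda>z. LINT w|lebesgue. p w * fock_weight \<nu> \<mu> z w * f w) has_derivative
    (\<lambda>v. LINT w|lebesgue. (p w * (of_real \<mu> * herm v w)) * fock_weight \<nu> \<mu> z w * f w)) (at z)"
proof -
  let ?G = "\<lambda>q z w. q w * fock_weight \<nu> \<mu> z w * f w"
  let ?J = "\<lambda>q z. LINT w|lebesgue. ?G q z w"
  let ?p = "\<lambda>v w. p w * (of_real \<mu> * herm v w)"
  have ev: "exp_bdd (?p v)" for v
    by (intro exp_bdd_mult p exp_bdd_const exp_bdd_linear bounded_linear_herm)
  note i0 = fock_integrable[OF \<mu> p f, where \<nu> = \<nu>] and i1 = fock_integrable[OF \<mu> ev f, where \<nu> = \<nu>]
  have lin: "linear (\<lambda>v. ?J (?p v) z)"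
  proof (rule linearI)
    fix x y
    have "?G (?p (x + y)) z w
       = ?G (?p x) z w + ?G (?p y) z w" for w
      by (simp add: herm_simps algebra_simps)
    then show "?J (?p (x + y)) z
       = ?J (?p x) z + ?J (?p y) z"
      by (simp only: Bochner_Integration.integral_add[OF i1 i1])
  next
    fix r x
    have "?G (?p (r *\<^sub>R x)) z w
       = r *\<^sub>R (?G (?p x) z w)" for w
      by (simp add: bounded_bilinear.scaleR_left[OF bounded_bilinear_herm])
    then show "?J (?p (r *\<^sub>R x)) z
       = r *\<^sub>R ?J (?p x) z"
      by (simp only: Bochner_Integration.integral_scaleR_right)
  qed
  \<comment> \<open>An envelope for the remainder that does not depend on \<open>h\<close>, valid for \<open>norm h \<le> 1\<close>.\<close>
  define E where "E w = p w * (of_real ((norm w)\<^sup>2 * exp (\<mu> * norm w)))" for w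
  have eE: "exp_bdd E"
    unfolding E_def[abs_def]
  proof (rule exp_bdd_mult[OF p])
    have *: "(norm w)\<^sup>2 * exp (\<mu> * norm w) \<le> 1 * exp ((2 + \<mu>) * norm w)" for w :: "complex^'n"
    proof -
      have "norm w \<le> exp (norm w)" using exp_ge_add_one_self[of "norm w"] by linarith
      then have "(norm w)\<^sup>2 \<le> (exp (norm w))\<^sup>2" by (intro power_mono) auto
      also have "\<dots> = exp (2 * norm w)" by (simp add: exp_double)
      finally have "(norm w)\<^sup>2 * exp (\<mu> * norm w) \<le> exp (2 * norm w) * exp (\<mu> * norm w)" by (intro mult_right_mono) auto
      then show ?thesis by (simp add: exp_add[symmetric] distrib_right)
    qed
    show "exp_bdd (\<lambda>w::complex^'n. complex_of_real ((norm w)\<^sup>2 * exp (\<mu> * norm w)))"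
      unfolding exp_bdd_def
    proof (rule_tac conjI)
      show "(\<lambda>w::complex^'n. complex_of_real ((norm w)\<^sup>2 * exp (\<mu> * norm w))) \<in> borel_measurable borel"
        by measurable
      show "\<exists>C b. C \<ge> 0 \<and> b \<ge> 0 \<and> (\<forall>w::complex^'n. norm (complex_of_real ((norm w)\<^sup>2 * exp (\<mu> * norm w))) \<le> C * exp (b * norm w))"
        by (rule exI[of _ 1], rule exI[of _ "2 + \<mu>"], simp only: norm_of_real abs_of_nonneg[OF mult_nonneg_nonneg[OF zero_le_power2 exp_ge_zero]])
          (use \<mu> * in simp)
    qed
  qed
  note iE = fock_integrable[OF \<mu> eE f, where \<nu> = \<nu>]
  define K where "K = (LINT w|lebesgue. norm (?G E z w))"
  show ?thesis
  proof (rule has_derivative_quadratic_remainder[where \<delta> = 1 and K = "\<mu>\<^sup>2 * K"])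
    show "bounded_linear (\<lambda>v. ?J (?p v) z)"
      using lin by (simp add: linear_conv_bounded_linear)
    fix h :: "complex^'n" assume h: "norm h \<le> 1"
    define k where "k w = ?G p (z + h) w - ?G p z w
        - ?G (?p h) z w" for w
    have ik: "integrable lebesgue k"
      unfolding k_def[abs_def] by (rule Bochner_Integration.integrable_diff[OF Bochner_Integration.integrable_diff[OF i0 i0] i1])
    have eq: "?J p (z + h) - ?J p z
        - ?J (?p h) z = (LINT w|lebesgue. k w)"
      unfolding k_def by (simp only: Bochner_Integration.integral_diff[OF Bochner_Integration.integrable_diff[OF i0 i0] i1]
          Bochner_Integration.integral_diff[OF i0 i0])
    have le: "norm (k w) \<le> (\<mu>\<^sup>2 * (norm h)\<^sup>2) * norm (?G E z w)" for w
    proof -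
      define y where "y = of_real \<mu> * herm h w"
      have ny: "norm y \<le> \<mu> * (norm h * norm w)"
        using mult_left_mono[OF norm_herm_le[of h w], of \<mu>] \<mu> by (simp add: y_def norm_mult)
      have "norm h * norm w \<le> 1 * norm w" using h by (intro mult_right_mono) auto
      then have "\<mu> * (norm h * norm w) \<le> \<mu> * norm w" using \<mu> by (intro mult_left_mono) auto
      then have ny1: "norm y \<le> \<mu> * norm w" using ny by linarith
      have "fock_weight \<nu> \<mu> (z + h) w = exp y * fock_weight \<nu> \<mu> z w"
        by (simp add: fock_weight_def y_def herm_simps distrib_left exp_add mult_ac)
      then have "k w = (exp y - 1 - y) * (?G p z w)"
        by (simp add: k_def y_def algebra_simps)
      then have "norm (k w) = norm (exp y - 1 - y) * norm (?G p z w)"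
        by (simp only: norm_mult)
      also have "\<dots> \<le> ((\<mu> * (norm h * norm w))\<^sup>2 * exp (\<mu> * norm w)) * norm (?G p z w)"
      proof (intro mult_right_mono)
        have "(norm y)\<^sup>2 * exp (norm y) \<le> (\<mu> * (norm h * norm w))\<^sup>2 * exp (\<mu> * norm w)"
          using ny ny1 by (intro mult_mono power_mono) auto
        then show "norm (exp y - 1 - y) \<le> (\<mu> * (norm h * norm w))\<^sup>2 * exp (\<mu> * norm w)"
          by (rule order_trans[OF exp_remainder_complex])
      qed simp
      also have "\<dots> = (\<mu>\<^sup>2 * (norm h)\<^sup>2) * norm (?G E z w)"
        by (simp add: E_def norm_mult norm_power power_mult_distrib)
      finally show ?thesis .
    qed
    have K: "(LINT w|lebesgue. (\<mu>\<^sup>2 * (norm h)\<^sup>2) * norm (?G E z w)) = \<mu>\<^sup>2 * K * (norm h)\<^sup>2"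
      unfolding integral_mult_right_zero K_def by simp
    have "norm (LINT w|lebesgue. k w) \<le> \<mu>\<^sup>2 * K * (norm h)\<^sup>2"
      unfolding K[symmetric]
      by (rule order_trans[OF integral_norm_bound integral_mono[OF integrable_norm[OF ik] integrable_mult_right[OF integrable_norm[OF iE]] le]])
    then show "norm (?J p (z + h) - ?J p z
        - ?J (?p h) z) \<le> \<mu>\<^sup>2 * K * (norm h)\<^sup>2"
      unfolding eq .
  qed simp
qed

text \<open>Kernels that can be differentiated under the integral sign arbitrarily often: the class is closed under
  derivatives in \<open>z\<close>, which is what an induction on the order of differentiability needs.\<close>

inductive fock_kernel :: "real \<Rightarrow> real \<Rightarrow> (complex^'n::finite \<Rightarrow> complex^'n \<Rightarrow> complex) \<Rightarrow> bool" for \<nu> \<mu> where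
  base: "smooth u \<Longrightarrow> exp_bdd p \<Longrightarrow> fock_kernel \<nu> \<mu> (\<lambda>z w. u z * (p w * fock_weight \<nu> \<mu> z w))"
| add: "fock_kernel \<nu> \<mu> A \<Longrightarrow> fock_kernel \<nu> \<mu> B \<Longrightarrow> fock_kernel \<nu> \<mu> (\<lambda>z w. A z w + B z w)"

lemma fock_kernel_smooth_mult:
  "fock_kernel \<nu> \<mu> A \<Longrightarrow> smooth h \<Longrightarrow> fock_kernel \<nu> \<mu> (\<lambda>z w. h z * A z w)"
proof (induction rule: fock_kernel.induct)
  case (base u p)
  have "fock_kernel \<nu> \<mu> (\<lambda>z w. (h z * u z) * (p w * fock_weight \<nu> \<mu> z w))"
    by (intro fock_kernel.base smooth_mult base)
  then show ?case by (simp add: mult.assoc)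
next
  case (add A B)
  then show ?case using fock_kernel.add by (simp add: distrib_left)
qed

lemma fock_kernel_exp_mult:
  "fock_kernel \<nu> \<mu> A \<Longrightarrow> exp_bdd q \<Longrightarrow> fock_kernel \<nu> \<mu> (\<lambda>z w. q w * A z w)"
proof (induction rule: fock_kernel.induct)
  case (base u p)
  have "fock_kernel \<nu> \<mu> (\<lambda>z w. u z * ((q w * p w) * fock_weight \<nu> \<mu> z w))"
    by (intro fock_kernel.base exp_bdd_mult base)
  then show ?case by (simp add: mult_ac)
next
  case (add A B)
  then show ?case using fock_kernel.add by (simp add: distrib_left)
qed

lemma fock_kernel_sum:
  "finite I \<Longrightarrow> (\<And>i. i \<in> I \<Longrightarrow> fock_kernel \<nu> \<mu> (A i)) \<Longrightarrow> fock_kernel \<nu> \<mu> (\<lambda>z w. \<Sum>i\<in>I. A i z w)"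
proof (induction I rule: finite_induct)
  case empty
  have "fock_kernel \<nu> \<mu> (\<lambda>z w. 0 * (0 * fock_weight \<nu> \<mu> z w))"
    by (intro fock_kernel.base smooth_rules exp_bdd_const)
  then show ?case by simp
qed (auto intro: fock_kernel.add)

lemma fock_weight_has_derivative:
  "((\<lambda>z. fock_weight \<nu> \<mu> z w) has_derivative (\<lambda>v. (of_real \<mu> * herm v w) * fock_weight \<nu> \<mu> z w)) (at z)"
proof -
  have d: "((\<lambda>z. of_real \<mu> * herm z w) has_derivative (\<lambda>v. of_real \<mu> * herm v w)) (at z)"
    by (intro has_derivative_mult_right bounded_linear_imp_has_derivative bounded_linear_herm)
  show ?thesis unfolding fock_weight_def
    by (rule has_derivative_eq_rhs[OF has_derivative_mult_left[OF has_derivative_exp_complex[OF d]]]) (simp add: mult_ac)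
qed

lemma fock_kernel_integrable:
  "fock_kernel \<nu> \<mu> A \<Longrightarrow> \<mu> > 0 \<Longrightarrow> f \<in> L2 \<Longrightarrow> integrable lebesgue (\<lambda>w. A z w * f w)"
proof (induction rule: fock_kernel.induct)
  case (base u p)
  show ?case
    using integrable_mult_right[OF fock_integrable[OF base(3) base(2) base(4), where \<nu> = \<nu> and z = z], of "u z"] by (simp only: mult.assoc)
next
  case (add A B)
  show ?case
    unfolding distrib_right by (rule Bochner_Integration.integrable_add[OF add.IH(1)[OF add.prems] add.IH(2)[OF add.prems]])
qed

lemma fock_kernel_derivative:
  fixes A :: "complex^'n::finite \<Rightarrow> complex^'n \<Rightarrow> complex"
  assumes "fock_kernel \<nu> \<mu> A" and \<mu>: "\<mu> > 0" and f: "f \<in> L2"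
  shows "(\<forall>z w. (\<lambda>z. A z w) differentiable (at z)) \<and>
    (\<forall>v. fock_kernel \<nu> \<mu> (\<lambda>z w. frechet_derivative (\<lambda>z. A z w) (at z) v)) \<and>
    (\<forall>z. ((\<lambda>z. LINT w|lebesgue. A z w * f w) has_derivative
       (\<lambda>v. LINT w|lebesgue. frechet_derivative (\<lambda>z. A z w) (at z) v * f w)) (at z))"
  using assms(1)
proof (induction rule: fock_kernel.induct)
  case (base u p)
  define u' where "u' z v = frechet_derivative u (at z) v" for z v
  have du: "(u has_derivative u' z) (at z)" for z
    unfolding u'_def by (rule smooth_has_derivative[OF base(1)])
  have dA: "((\<lambda>z. u z * (p w * fock_weight \<nu> \<mu> z w)) has_derivative
     (\<lambda>v. u z * (p w * ((of_real \<mu> * herm v w) * fock_weight \<nu> \<mu> z w)) + u' z v * (p w * fock_weight \<nu> \<mu> z w))) (at z)" for z w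
    by (rule has_derivative_mult[OF du has_derivative_mult_right[OF fock_weight_has_derivative]])
  have ev: "exp_bdd (\<lambda>w. p w * (of_real \<mu> * herm v w))" for v
    by (intro exp_bdd_mult base exp_bdd_const exp_bdd_linear bounded_linear_herm)
  note i0 = fock_integrable[OF \<mu> base(2) f, where \<nu> = \<nu>] and i1 = fock_integrable[OF \<mu> ev f, where \<nu> = \<nu>]
  have fd: "frechet_derivative (\<lambda>z. u z * (p w * fock_weight \<nu> \<mu> z w)) (at z) v
      = u z * ((p w * (of_real \<mu> * herm v w)) * fock_weight \<nu> \<mu> z w) + u' z v * (p w * fock_weight \<nu> \<mu> z w)" for z w v
    unfolding frechet_derivative_eqI[OF dA] by (simp add: mult.assoc)
  show ?case
  proof (intro conjI allI)
    show "(\<lambda>z. u z * (p w * fock_weight \<nu> \<mu> z w)) differentiable (at z)" for z w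
      using dA differentiable_def by blast
    show "fock_kernel \<nu> \<mu> (\<lambda>z w. frechet_derivative (\<lambda>z. u z * (p w * fock_weight \<nu> \<mu> z w)) (at z) v)" for v
      unfolding fd u'_def
      by (intro fock_kernel.add fock_kernel.base base smooth_derivative ev)
    show "((\<lambda>z. LINT w|lebesgue. u z * (p w * fock_weight \<nu> \<mu> z w) * f w) has_derivative
       (\<lambda>v. LINT w|lebesgue. frechet_derivative (\<lambda>z. u z * (p w * fock_weight \<nu> \<mu> z w)) (at z) v * f w)) (at z)" for z
    proof -
      have e1: "(LINT w|lebesgue. u z * (p w * fock_weight \<nu> \<mu> z w) * f w) = u z * (LINT w|lebesgue. p w * fock_weight \<nu> \<mu> z w * f w)" for z
        unfolding mult.assoc[of "u z"] by (rule integral_mult_right_zero)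
      have e2: "(LINT w|lebesgue. frechet_derivative (\<lambda>z. u z * (p w * fock_weight \<nu> \<mu> z w)) (at z) v * f w)
          = u z * (LINT w|lebesgue. (p w * (of_real \<mu> * herm v w)) * fock_weight \<nu> \<mu> z w * f w)
           + u' z v * (LINT w|lebesgue. p w * fock_weight \<nu> \<mu> z w * f w)" for v
        unfolding fd distrib_right mult.assoc[of "u z"] mult.assoc[of "u' z v"]
        by (simp only: Bochner_Integration.integral_add[OF integrable_mult_right[OF i1] integrable_mult_right[OF i0]] integral_mult_right_zero)
      show ?thesis unfolding e1 e2
        by (rule has_derivative_mult[OF du fock_integral_derivative[OF \<mu> base(2) f]])
    qed
  qed
next
  case (add A B)
  have dA: "((\<lambda>z. A z w) has_derivative frechet_derivative (\<lambda>z. A z w) (at z)) (at z)"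
    and dB: "((\<lambda>z. B z w) has_derivative frechet_derivative (\<lambda>z. B z w) (at z)) (at z)" for z w
    using add.IH by (simp_all add: frechet_derivative_works[symmetric])
  have kA: "fock_kernel \<nu> \<mu> (\<lambda>z w. frechet_derivative (\<lambda>z. A z w) (at z) v)"
    and kB: "fock_kernel \<nu> \<mu> (\<lambda>z w. frechet_derivative (\<lambda>z. B z w) (at z) v)" for v
    using add.IH by simp_all
  have IA: "((\<lambda>z. LINT w|lebesgue. A z w * f w) has_derivative
       (\<lambda>v. LINT w|lebesgue. frechet_derivative (\<lambda>z. A z w) (at z) v * f w)) (at z)"
    and IB: "((\<lambda>z. LINT w|lebesgue. B z w * f w) has_derivative
       (\<lambda>v. LINT w|lebesgue. frechet_derivative (\<lambda>z. B z w) (at z) v * f w)) (at z)" for z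
    using add.IH by simp_all
  have fd: "frechet_derivative (\<lambda>z. A z w + B z w) (at z) v = frechet_derivative (\<lambda>z. A z w) (at z) v + frechet_derivative (\<lambda>z. B z w) (at z) v" for z w v
    using frechet_derivative_eqI[OF has_derivative_add[OF dA dB]] by simp
  have e: "(LINT w|lebesgue. (A z w + B z w) * f w) = (LINT w|lebesgue. A z w * f w) + (LINT w|lebesgue. B z w * f w)"
    if "fock_kernel \<nu> \<mu> A" "fock_kernel \<nu> \<mu> B" for z and A B :: "complex^'n \<Rightarrow> complex^'n \<Rightarrow> complex"
    unfolding distrib_right
    by (rule Bochner_Integration.integral_add[OF fock_kernel_integrable[OF that(1) \<mu> f] fock_kernel_integrable[OF that(2) \<mu> f]])
  show ?case
  proof (intro conjI allI)
    show "(\<lambda>z. A z w + B z w) differentiable (at z)" for z w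
      using has_derivative_add[OF dA dB] differentiable_def by blast
    show "fock_kernel \<nu> \<mu> (\<lambda>z w. frechet_derivative (\<lambda>z. A z w + B z w) (at z) v)" for v
      unfolding fd by (rule fock_kernel.add[OF kA kB])
    show "((\<lambda>z. LINT w|lebesgue. (A z w + B z w) * f w) has_derivative
       (\<lambda>v. LINT w|lebesgue. frechet_derivative (\<lambda>z. A z w + B z w) (at z) v * f w)) (at z)" for z
      unfolding fd e[OF add.hyps] e[OF kA kB] by (rule has_derivative_add[OF IA IB])
  qed
qed

lemma fock_kernel_integral_smooth:
  assumes "fock_kernel \<nu> \<mu> A" "\<mu> > 0" "f \<in> L2"
  shows "smooth (\<lambda>z. LINT w|lebesgue. A z w * f w)"
proof -
  have "C_k k (\<lambda>z. LINT w|lebesgue. A z w * f w)" if "fock_kernel \<nu> \<mu> A" for k A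
    using that
  proof (induction k arbitrary: A)
    case 0
    have "(\<lambda>z. LINT w|lebesgue. A z w * f w) differentiable_on UNIV"
      using fock_kernel_derivative[OF 0 assms(2,3)] by (auto simp: differentiable_on_def differentiable_def)
    then show ?case by (simp add: differentiable_imp_continuous_on)
  next
    case (Suc k)
    note d = fock_kernel_derivative[OF Suc.prems assms(2,3)]
    show ?case
    proof (rule C_k_SucI)
      show "((\<lambda>z. LINT w|lebesgue. A z w * f w) has_derivative
       (\<lambda>v. LINT w|lebesgue. frechet_derivative (\<lambda>z. A z w) (at z) v * f w)) (at z)" for z
        using d by blast
      show "C_k k (\<lambda>z. LINT w|lebesgue. frechet_derivative (\<lambda>z. A z w) (at z) v * f w)" for v
        by (rule Suc.IH) (use d in blast)
    qed
  qed
  then show ?thesis using assms(1) by (simp add: smooth_def)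
qed

lemma fock_kernel_d_z:
  fixes A :: "complex^'n::finite \<Rightarrow> complex^'n \<Rightarrow> complex"
  assumes A: "fock_kernel \<nu> \<mu> A" and \<mu>: "\<mu> > 0" and f: "f \<in> L2"
  shows "fock_kernel \<nu> \<mu> (\<lambda>z w. d_z j (\<lambda>z. A z w) z)" "fock_kernel \<nu> \<mu> (\<lambda>z w. d_zbar j (\<lambda>z. A z w) z)"
    and "d_z j (\<lambda>z. LINT w|lebesgue. A z w * f w) = (\<lambda>z. LINT w|lebesgue. d_z j (\<lambda>z. A z w) z * f w)"
    and "d_zbar j (\<lambda>z. LINT w|lebesgue. A z w * f w) = (\<lambda>z. LINT w|lebesgue. d_zbar j (\<lambda>z. A z w) z * f w)"
proof -
  note d = fock_kernel_derivative[OF A \<mu> f]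
  let ?D = "\<lambda>z w v. frechet_derivative (\<lambda>z. A z w) (at z) v"
  have k: "fock_kernel \<nu> \<mu> (\<lambda>z w. c * ?D z w v)" for c v
    by (rule fock_kernel_smooth_mult) (use d smooth_rules(1) in blast)+
  have e1: "d_z j (\<lambda>z. A z w) z = (1/2) * ?D z w (axis j 1) + (- \<i> / 2) * ?D z w (axis j \<i>)"
    and e2: "d_zbar j (\<lambda>z. A z w) z = (1/2) * ?D z w (axis j 1) + (\<i> / 2) * ?D z w (axis j \<i>)" for z w
    by (simp_all add: d_z_def d_zbar_def field_simps)
  show "fock_kernel \<nu> \<mu> (\<lambda>z w. d_z j (\<lambda>z. A z w) z)" "fock_kernel \<nu> \<mu> (\<lambda>z w. d_zbar j (\<lambda>z. A z w) z)"
    unfolding e1 e2 by (rule fock_kernel.add[OF k k])+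
  have i: "integrable lebesgue (\<lambda>w. c * ?D z w v * f w)" for c z v
    by (rule fock_kernel_integrable[OF k \<mu> f])
  have dI: "((\<lambda>z. LINT w|lebesgue. A z w * f w) has_derivative (\<lambda>v. LINT w|lebesgue. ?D z w v * f w)) (at z)" for z
    using d by blast
  have c: "(LINT w|lebesgue. c * ?D z w v * f w) = c * (LINT w|lebesgue. ?D z w v * f w)" for c z v
    unfolding mult.assoc by (rule integral_mult_right_zero)
  show "d_z j (\<lambda>z. LINT w|lebesgue. A z w * f w) = (\<lambda>z. LINT w|lebesgue. d_z j (\<lambda>z. A z w) z * f w)"
    unfolding e1 distrib_right Bochner_Integration.integral_add[OF i i] c
    by (rule ext) (simp only: d_z_eqI(1)[OF dI], simp add: field_simps)
  show "d_zbar j (\<lambda>z. LINT w|lebesgue. A z w * f w) = (\<lambda>z. LINT w|lebesgue. d_zbar j (\<lambda>z. A z w) z * f w)"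
    unfolding e2 distrib_right Bochner_Integration.integral_add[OF i i] c
    by (rule ext) (simp only: d_z_eqI(2)[OF dI], simp add: field_simps)
qed

lemma fock_kernel_Delta:
  fixes A :: "complex^'n::finite \<Rightarrow> complex^'n \<Rightarrow> complex"
  assumes A: "fock_kernel \<nu> \<mu> A" and \<mu>: "\<mu> > 0" and f: "f \<in> L2"
  shows "Delta \<nu>' \<mu>' (\<lambda>z. LINT w|lebesgue. A z w * f w) z = (LINT w|lebesgue. Delta \<nu>' \<mu>' (\<lambda>z. A z w) z * f w)"
proof -
  note K = fock_kernel_d_z[OF A \<mu> f]
  note i = fock_kernel_integrable[OF A \<mu> f] fock_kernel_integrable[OF K(1) \<mu> f] fock_kernel_integrable[OF K(2) \<mu> f]
    fock_kernel_integrable[OF fock_kernel_d_z(1)[OF K(2) \<mu> f] \<mu> f]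
  let ?d = "\<lambda>j w. d_z j (\<lambda>z. A z w) z" and ?b = "\<lambda>j w. d_zbar j (\<lambda>z. A z w) z"
    and ?db = "\<lambda>j w. d_z j (d_zbar j (\<lambda>z. A z w)) z"
  have expand: "Delta \<nu>' \<mu>' (\<lambda>z. A z w) z * f w = 4 * (\<Sum>j\<in>UNIV. ?db j w * f w)
      + (2 * \<i> * of_real \<nu>' + 2 * of_real \<mu>') * (\<Sum>j\<in>UNIV. z $ j * (?d j w * f w))
      + (2 * \<i> * of_real \<nu>' - 2 * of_real \<mu>') * (\<Sum>j\<in>UNIV. cnj (z $ j) * (?b j w * f w))
      + (2 * \<i> * of_real \<nu>' * of_nat CARD('n) - of_real ((\<nu>'\<^sup>2 + \<mu>'\<^sup>2) * (norm z)\<^sup>2)) * (A z w * f w)" for w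
  proof -
    have s1: "(\<Sum>j\<in>UNIV. ?db j w * f w) = (\<Sum>j\<in>UNIV. ?db j w) * f w" by (simp add: sum_distrib_right)
    have s2: "(\<Sum>j\<in>UNIV. z $ j * (?d j w * f w)) = (\<Sum>j\<in>UNIV. z $ j * ?d j w) * f w" by (simp add: sum_distrib_right mult.assoc)
    have s3: "(\<Sum>j\<in>UNIV. cnj (z $ j) * (?b j w * f w)) = (\<Sum>j\<in>UNIV. cnj (z $ j) * ?b j w) * f w" by (simp add: sum_distrib_right mult.assoc)
    show ?thesis
      unfolding Delta_def euler_def euler_bar_def s1 s2 s3
      by (simp add: algebra_simps del: of_real_mult of_real_add of_real_power)
  qed
  have "(LINT w|lebesgue. Delta \<nu>' \<mu>' (\<lambda>z. A z w) z * f w) = 4 * (\<Sum>j\<in>UNIV. LINT w|lebesgue. ?db j w * f w)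
      + (2 * \<i> * of_real \<nu>' + 2 * of_real \<mu>') * (\<Sum>j\<in>UNIV. z $ j * (LINT w|lebesgue. ?d j w * f w))
      + (2 * \<i> * of_real \<nu>' - 2 * of_real \<mu>') * (\<Sum>j\<in>UNIV. cnj (z $ j) * (LINT w|lebesgue. ?b j w * f w))
      + (2 * \<i> * of_real \<nu>' * of_nat CARD('n) - of_real ((\<nu>'\<^sup>2 + \<mu>'\<^sup>2) * (norm z)\<^sup>2)) * (LINT w|lebesgue. A z w * f w)"
  proof -
    have s: "integrable lebesgue (\<lambda>w. \<Sum>j\<in>UNIV. a j * g j w)" "integrable lebesgue (\<lambda>w. \<Sum>j\<in>UNIV. g j w)"
      "(LINT w|lebesgue. (\<Sum>j\<in>UNIV. a j * g j w)) = (\<Sum>j\<in>UNIV. a j * (LINT w|lebesgue. g j w))"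
      "(LINT w|lebesgue. (\<Sum>j\<in>UNIV. g j w)) = (\<Sum>j\<in>UNIV. LINT w|lebesgue. g j w)"
      if "\<And>j. integrable lebesgue (g j)" for a :: "'n \<Rightarrow> complex" and g :: "'n \<Rightarrow> complex^'n \<Rightarrow> complex"
      using that by (simp_all add: Bochner_Integration.integral_sum)
    show ?thesis
      unfolding expand
      by (simp only: Bochner_Integration.integral_add Bochner_Integration.integrable_add s[OF i(2)] s[OF i(3)] s[OF i(4)]
          integrable_mult_right i(1) integral_mult_right_zero)
  qed
  also have "\<dots> = Delta \<nu>' \<mu>' (\<lambda>z. LINT w|lebesgue. A z w * f w) z"
    unfolding Delta_def euler_def euler_bar_def K(3,4) fock_kernel_d_z(3)[OF K(2) \<mu> f]
    by (simp add: algebra_simps del: of_real_mult of_real_add of_real_power)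
  finally show ?thesis ..
qed

lemma fock_kernel_herm_mult:
  fixes A :: "complex^'n::finite \<Rightarrow> complex^'n \<Rightarrow> complex"
  assumes A: "fock_kernel \<nu> \<mu> A"
  shows "fock_kernel \<nu> \<mu> (\<lambda>z w. herm (z - w) (z - w) ^ k * A z w)"
proof (induction k)
  case 0
  show ?case using A by simp
next
  case (Suc k)
  let ?B = "\<lambda>z w. herm (z - w) (z - w) ^ k * A z w"
  let ?T = "\<lambda>j z w. (z $ j * cnj (z $ j)) * ?B z w
      + ((w $ j * cnj (w $ j)) * ?B z w + ((-1) * (z $ j * (cnj (w $ j) * ?B z w)) + (-1) * (cnj (z $ j) * (w $ j * ?B z w))))"
  have lin: "bounded_linear (\<lambda>z::complex^'n. z $ j)" "bounded_linear (\<lambda>z::complex^'n. cnj (z $ j))" for j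
    by (rule bounded_linear_vec_nth bounded_linear_cnj_nth)+
  have "fock_kernel \<nu> \<mu> (\<lambda>z w. \<Sum>j\<in>UNIV. ?T j z w)"
    by (intro fock_kernel_sum fock_kernel.add finite fock_kernel_smooth_mult[where h = "\<lambda>z. -1"]
      fock_kernel_smooth_mult[where h = "\<lambda>z. z $ _"] fock_kernel_smooth_mult[where h = "\<lambda>z. cnj (z $ _)"]
      fock_kernel_smooth_mult[where h = "\<lambda>z. z $ _ * cnj (z $ _)"] smooth_mult smooth_rules(1) smooth_rules(3)[OF lin(1)] smooth_rules(3)[OF lin(2)]
      fock_kernel_exp_mult[where q = "\<lambda>w. w $ _"] fock_kernel_exp_mult[where q = "\<lambda>w. cnj (w $ _)"] fock_kernel_exp_mult[where q = "\<lambda>w. w $ _ * cnj (w $ _)"]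
      exp_bdd_mult exp_bdd_linear lin Suc)
  also have "(\<lambda>z w. \<Sum>j\<in>UNIV. ?T j z w) = (\<lambda>z w. herm (z - w) (z - w) ^ Suc k * A z w)"
  proof (intro ext)
    fix z w
    have "herm (z - w) (z - w) ^ Suc k * A z w = herm (z - w) (z - w) * ?B z w" by (simp add: mult.assoc)
    also have "\<dots> = (\<Sum>j\<in>UNIV. ((z - w) $ j * cnj ((z - w) $ j)) * ?B z w)"
      unfolding herm_def[of "z - w" "z - w"] sum_distrib_right ..
    also have "\<dots> = (\<Sum>j\<in>UNIV. ?T j z w)"
    proof (intro sum.cong refl)
      fix j
      have "((a - b) * (a' - b')) * B = (a * a') * B + ((b * b') * B + ((-1) * (a * (b' * B)) + (-1) * (a' * (b * B))))" for a b a' b' B :: complex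
        by (simp add: algebra_simps)
      from this[of "z $ j" "w $ j" "cnj (z $ j)" "cnj (w $ j)" "?B z w"]
      show "((z - w) $ j * cnj ((z - w) $ j)) * ?B z w = ?T j z w"
        by (simp only: vector_minus_component complex_cnj_diff)
    qed
    finally show "(\<Sum>j\<in>UNIV. ?T j z w)
      = herm (z - w) (z - w) ^ Suc k * A z w" ..
  qed
  finally show ?case .
qed

text \<open>Expanding \<open>|z - w|\<^sup>2\<close> splits the Gaussian \<open>exp (- \<mu> |z - w|\<^sup>2 / 2)\<close> into functions of \<open>z\<close> and of \<open>w\<close>
  and a mixed term, which combines with the phase to the holomorphic factor \<open>exp (\<mu> herm z w)\<close>.\<close>

lemma tker_lagq_fock_kernel: "fock_kernel \<nu> \<mu> (tker \<nu> \<mu> (lagq n \<mu> l))"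
proof -
  let ?A = "\<lambda>z w. exp (- (\<i> * of_real \<nu> / 2 + of_real \<mu> / 2) * herm z z) * (1 * fock_weight \<nu> \<mu> z w)"
  have "fock_kernel \<nu> \<mu> (\<lambda>z w. \<Sum>k\<le>l. of_real (lag_coeff n l k * \<mu> ^ k) * (herm (z - w) (z - w) ^ k * ?A z w))"
    by (intro fock_kernel_sum finite_atMost fock_kernel_smooth_mult[where h = "\<lambda>z. of_real _"] smooth_rules(1) fock_kernel_herm_mult
        fock_kernel.base smooth_exp smooth_mult smooth_herm exp_bdd_const)
  also have "(\<lambda>z w. \<Sum>k\<le>l. of_real (lag_coeff n l k * \<mu> ^ k) * (herm (z - w) (z - w) ^ k * ?A z w)) = tker \<nu> \<mu> (lagq n \<mu> l)"
  proof (intro ext)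
    fix z w
    define t where "t = herm (z - w) (z - w)"
    have t: "complex_of_real ((norm (z - w))\<^sup>2) = t" by (simp only: t_def herm_self)
    have "- (\<i> * of_real \<nu> / 2 + of_real \<mu> / 2) * herm z z + (of_real \<mu> * herm z w + (\<i> * of_real \<nu> / 2 - of_real \<mu> / 2) * herm w w)
        = theta \<nu> \<mu> z w + (- (of_real \<mu> / 2) * t)"
      by (simp add: theta_def t_def herm_simps field_simps)
    then have A: "?A z w = phase \<nu> \<mu> z w * exp (- (of_real \<mu> / 2) * t)"
      unfolding fock_weight_def phase_def mult_1 exp_add[symmetric] by simp
    have q: "complex_of_real (lagq n \<mu> l ((norm (z - w))\<^sup>2)) = exp (- (of_real \<mu> / 2) * t) * (\<Sum>k\<le>l. of_real (lag_coeff n l k * \<mu> ^ k) * t ^ k)"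
    proof -
      have "complex_of_real (lagq n \<mu> l s) = exp (- (of_real \<mu> / 2) * of_real s) * (\<Sum>k\<le>l. of_real (lag_coeff n l k * \<mu> ^ k) * of_real s ^ k)" for s
        by (simp add: lagq_def exp_poly_def poly_laguerre exp_of_real[symmetric] power_mult_distrib mult.assoc)
      then show ?thesis unfolding t[symmetric] .
    qed
    show "(\<Sum>k\<le>l. of_real (lag_coeff n l k * \<mu> ^ k) * (herm (z - w) (z - w) ^ k * ?A z w)) = tker \<nu> \<mu> (lagq n \<mu> l) z w"
      unfolding tker_def q A t_def[symmetric] by (simp add: sum_distrib_left mult_ac)
  qed
  finally show ?thesis .
qed

lemma Delta_tker_lagq:
  fixes z w :: "complex^'n::finite"
  shows "Delta \<nu> \<mu> (\<lambda>z. tker \<nu> \<mu> (lagq CARD('n) \<mu> l) z w) z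
    = - 2 * of_real \<mu> * (2 * of_nat l + of_nat CARD('n)) * tker \<nu> \<mu> (lagq CARD('n) \<mu> l) z w"
proof -
  let ?n = "CARD('n)"
  obtain q1 q2 where d: "\<And>x. (lagq ?n \<mu> l has_real_derivative q1 x) (at x)" "\<And>x. (q1 has_real_derivative q2 x) (at x)"
    and r: "radial_op (real ?n) \<mu> (lagq ?n \<mu> l) q1 q2 = (\<lambda>s. (- 2 * \<mu> * (2 * real l + real ?n)) * lagq ?n \<mu> l s)"
    using lagq_radial[where n = ?n and \<mu> = \<mu> and l = l, OF zero_less_card_finite] by blast
  have "Delta \<nu> \<mu> (\<lambda>z. tker \<nu> \<mu> (lagq ?n \<mu> l) z w) z = tker \<nu> \<mu> (radial_op (real ?n) \<mu> (lagq ?n \<mu> l) q1 q2) z w"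
    unfolding radial_op_def[abs_def] by (rule Delta_tker[OF d])
  then show ?thesis unfolding r by (simp add: tker_def)
qed

lemma tint_lagq_in_A2:
  fixes f :: "complex^'n::finite \<Rightarrow> complex"
  assumes \<mu>: "\<mu> > 0" and f: "f \<in> L2"
  shows "tint \<nu> \<mu> (lagq CARD('n) \<mu> l) f \<in> A2 \<nu> \<mu> (of_nat l)"
proof -
  let ?q = "lagq CARD('n) \<mu> l"
  note K = tker_lagq_fock_kernel[of \<nu> \<mu> "CARD('n)" l]
  have e: "tint \<nu> \<mu> ?q f = (\<lambda>z. LINT w|lebesgue. tker \<nu> \<mu> ?q z w * f w)" by (rule ext) (simp add: tint_def)
  have ev: "Delta \<nu> \<mu> (tint \<nu> \<mu> ?q f) z = - 2 * of_real \<mu> * (2 * of_nat l + of_nat CARD('n)) * tint \<nu> \<mu> ?q f z" for z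
    unfolding e fock_kernel_Delta[OF K \<mu> f] Delta_tker_lagq mult.assoc integral_mult_right_zero ..
  have sm: "smooth (tint \<nu> \<mu> ?q f)" unfolding e by (rule fock_kernel_integral_smooth[OF K \<mu> f])
  show ?thesis
    unfolding A2_def mem_Collect_eq using tint_L2[OF gauss_bdd_lagq[OF \<mu>] f] sm ev by blast
qed

lemma fock_kernel_smooth: "fock_kernel \<nu> \<mu> A \<Longrightarrow> smooth (\<lambda>z. A z w)"
proof (induction rule: fock_kernel.induct)
  case (base u p)
  then show ?case
    unfolding fock_weight_def by (intro smooth_mult smooth_exp smooth_rules(1) smooth_herm)
next
  case (add A B)
  show ?case by (rule smooth_rules(2)[OF add.IH])
qed

text \<open>These kernel functions show that none of the eigenspaces for natural numbers is zero.\<close>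

lemma tker_lagq_in_A2:
  assumes \<mu>: "\<mu> > 0"
  shows "(\<lambda>z::complex^'n::finite. tker \<nu> \<mu> (lagq CARD('n) \<mu> l) z w) \<in> A2 \<nu> \<mu> (of_nat l)"
  unfolding A2_def mem_Collect_eq
  using tker_L2[OF gauss_bdd_lagq[OF \<mu>]] fock_kernel_smooth[OF tker_lagq_fock_kernel] Delta_tker_lagq by blast

section \<open>Density of compactly supported continuous functions\<close>

text \<open>The radial retraction onto the disc of radius \<open>k\<close>; it is continuous and makes pointwise approximants
  bounded.\<close>

definition clip :: "real \<Rightarrow> complex \<Rightarrow> complex" where
  "clip k y = (k / max k (norm y)) *\<^sub>R y"

lemma clip_props:
  assumes "k > 0"
  shows "norm (clip k y) \<le> k" "norm (clip k y) \<le> norm y" "norm y \<le> k \<Longrightarrow> clip k y = y"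
    "continuous_on UNIV (clip k)"
proof -
  have m: "max k (norm y) > 0" "k \<le> max k (norm y)" "norm y \<le> max k (norm y)" using assms by auto
  have n: "norm (clip k y) = k * norm y / max k (norm y)" using assms m(1) by (simp add: clip_def)
  have "k * norm y \<le> k * max k (norm y)" using m assms by (intro mult_left_mono) auto
  then show "norm (clip k y) \<le> k" unfolding n using m by (simp add: pos_divide_le_eq)
  have "k * norm y \<le> max k (norm y) * norm y" using m by (intro mult_right_mono) auto
  then show "norm (clip k y) \<le> norm y" unfolding n using m by (simp add: pos_divide_le_eq mult.commute)
  show "clip k y = y" if "norm y \<le> k" using that assms by (simp add: clip_def max_def)
  have "max k (norm x) \<noteq> 0" for x :: complex using assms by (auto simp: max_def)
  then show "continuous_on UNIV (clip k)" unfolding clip_def[abs_def] by (intro continuous_intros) auto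
qed

lemma L2_norm_tendsto_0:
  fixes f :: "nat \<Rightarrow> 'a::euclidean_space \<Rightarrow> complex"
  assumes m: "\<And>n. f n \<in> borel_measurable lebesgue" and w: "integrable lebesgue w"
    and le: "\<And>n x. (norm (f n x))\<^sup>2 \<le> w x" and lim: "AE x in lebesgue. (\<lambda>n. f n x) \<longlonglongrightarrow> 0"
  shows "(\<lambda>n. L2_norm (f n)) \<longlonglongrightarrow> 0"
proof -
  note [measurable] = m
  have "(\<lambda>n. LINT x|lebesgue. (norm (f n x))\<^sup>2) \<longlonglongrightarrow> (LINT x|(lebesgue::'a measure). 0)"
  proof (rule integral_dominated_convergence[OF _ _ w])
    show "AE x in lebesgue. (\<lambda>n. (norm (f n x))\<^sup>2) \<longlonglongrightarrow> 0"
      using lim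
    proof eventually_elim
      case (elim x)
      then have "(\<lambda>n. (norm (f n x))\<^sup>2) \<longlonglongrightarrow> (norm (0::complex))\<^sup>2" by (intro tendsto_intros)
      then show ?case by simp
    qed
  qed (use le in auto)
  then have "(\<lambda>n. sqrt (LINT x|lebesgue. (norm (f n x))\<^sup>2)) \<longlonglongrightarrow> sqrt 0"
    by (intro tendsto_real_sqrt) simp
  then show ?thesis by (simp add: L2_norm_def)
qed

text \<open>A Lebesgue measurable function is almost everywhere the limit of continuous functions \<open>g n\<close>.  Cutting
  off \<open>f\<close> and the \<open>g n\<close> in the same continuous way in range and domain provides dominating functions.\<close>

lemma L2_dense_continuous_compact_support:
  fixes f :: "'a::euclidean_space \<Rightarrow> complex"
  assumes f: "f \<in> L2" and \<epsilon>: "\<epsilon> > 0"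
  shows "\<exists>g R. continuous_on UNIV g \<and> (\<forall>x. norm x > R \<longrightarrow> g x = 0) \<and> g \<in> L2 \<and> L2_norm (\<lambda>x. f x - g x) < \<epsilon>"
proof -
  note mf [measurable] = L2D(1)[OF f]
  have "f measurable_on UNIV"
    using mf measurable_on_iff_borel_measurable[of UNIV f] by (simp add: lebesgue_on_UNIV_eq)
  then obtain N g where N: "negligible N" and g: "\<And>n. continuous_on UNIV (g n)" "\<And>x. x \<notin> N \<Longrightarrow> (\<lambda>n. g n x) \<longlonglongrightarrow> f x"
    unfolding measurable_on_def by auto
  \<comment> \<open>A continuous cutoff in the domain: 1 on the ball of radius \<open>k + 1\<close>, 0 outside that of radius \<open>k + 2\<close>.\<close>
  define X where "X k x = max 0 (min 1 (real (Suc k) + 1 - norm x))" for k and x :: 'a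
  have X: "0 \<le> X k x" "X k x \<le> 1" for k x by (auto simp: X_def)
  have X1: "X k x = 1" if "norm x \<le> real (Suc k)" for k x using that by (simp add: X_def)
  have X0: "X k x = 0" if "norm x > real (Suc k) + 1" for k x using that by (simp add: X_def)
  have cX: "continuous_on UNIV (X k)" for k unfolding X_def[abs_def] by (intro continuous_intros)
  have mX [measurable]: "X k \<in> borel_measurable lebesgue" for k
    by (rule measurable_completion) (use borel_measurable_continuous_onI[OF cX] in simp)
  define F where "F k x = of_real (X k x) * clip (real (Suc k)) (f x)" for k x
  have mclip [measurable]: "clip (real (Suc k)) \<in> borel_measurable borel" for k
    by (rule borel_measurable_continuous_onI) (rule clip_props, simp)
  have mF [measurable]: "F k \<in> borel_measurable lebesgue" for k unfolding F_def[abs_def] by measurable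
  have nF: "norm (F k x) \<le> norm (f x)" for k x
  proof -
    have "norm (F k x) \<le> 1 * norm (clip (real (Suc k)) (f x))"
      unfolding F_def norm_mult using X[of k x] by (intro mult_right_mono) auto
    then show ?thesis using clip_props(2)[of "real (Suc k)" "f x"] by simp
  qed
  have FL: "F k \<in> L2" for k by (rule L2_bound[OF f mF nF])
  have "(\<lambda>k. L2_norm (\<lambda>x. f x - F k x)) \<longlonglongrightarrow> 0"
  proof (rule L2_norm_tendsto_0[where w = "\<lambda>x. 4 * (norm (f x))\<^sup>2"])
    show "integrable lebesgue (\<lambda>x. 4 * (norm (f x))\<^sup>2)" using L2D(2)[OF f] by simp
    show "(norm (f x - F k x))\<^sup>2 \<le> 4 * (norm (f x))\<^sup>2" for k x
    proof -
      have "norm (f x - F k x) \<le> 2 * norm (f x)" using norm_triangle_ineq4[of "f x" "F k x"] nF[of k x] by linarith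
      then have "(norm (f x - F k x))\<^sup>2 \<le> (2 * norm (f x))\<^sup>2" by (intro power_mono) auto
      then show ?thesis by (simp add: power_mult_distrib)
    qed
    have "(\<lambda>k. f x - F k x) \<longlonglongrightarrow> 0" for x
    proof (rule tendsto_eventually)
      obtain K :: nat where K: "max (norm x) (norm (f x)) \<le> real K" using real_arch_simple by blast
      show "\<forall>\<^sub>F k in sequentially. f x - F k x = 0"
        using eventually_ge_at_top[of K]
      proof eventually_elim
        case (elim k)
        then have "norm x \<le> real (Suc k)" "norm (f x) \<le> real (Suc k)" using K by auto
        then show ?case using clip_props(3)[of "real (Suc k)" "f x"] X1[of x k] by (simp add: F_def)
      qed
    qed
    then show "AE x in lebesgue. (\<lambda>k. f x - F k x) \<longlonglongrightarrow> 0" by simp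
  qed measurable
  then have "\<forall>\<^sub>F k in sequentially. L2_norm (\<lambda>x. f x - F k x) < \<epsilon> / 2"
    by (rule order_tendstoD(2)) (use \<epsilon> in simp)
  then obtain k where k: "L2_norm (\<lambda>x. f x - F k x) < \<epsilon> / 2"
    by (meson eventually_happens trivial_limit_sequentially)
  define h where "h n x = of_real (X k x) * clip (real (Suc k)) (g n x)" for n x
  have ch: "continuous_on UNIV (h n)" for n
    unfolding h_def[abs_def]
    by (intro continuous_on_mult continuous_on_of_real cX continuous_on_compose2[OF clip_props(4) g(1)]) auto
  have h0: "h n x = 0" if "norm x > real (Suc k) + 1" for n x using X0[OF that] by (simp add: h_def)
  have bd: "norm (of_real (X k x) * clip (real (Suc k)) y) \<le> real (Suc k)" for x y
  proof -
    have "norm (of_real (X k x) * clip (real (Suc k)) y) \<le> 1 * real (Suc k)"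
      unfolding norm_mult using X[of k x] clip_props(1)[of "real (Suc k)" y] by (intro mult_mono) auto
    then show ?thesis by simp
  qed
  have mh [measurable]: "h n \<in> borel_measurable lebesgue" for n
    by (rule measurable_completion) (use borel_measurable_continuous_onI[OF ch] in simp)
  have ib: "integrable lebesgue (\<lambda>x::'a. c * indicat_real (cball 0 (real (Suc k) + 1)) x)" for c
  proof (intro integrable_mult_right integrable_real_indicator)
    show "cball 0 (real (Suc k) + 1) \<in> sets (lebesgue :: 'a measure)" by (rule sets_completionI_sets) simp
    show "emeasure lebesgue (cball (0::'a) (real (Suc k) + 1)) < \<infinity>"
      using emeasure_lborel_cball_finite[of "0::'a" "real (Suc k) + 1"] by simp
  qed
  have hL: "h n \<in> L2" for n
  proof (rule L2I[OF mh])
    show "integrable lebesgue (\<lambda>x. (norm (h n x))\<^sup>2)"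
    proof (rule Bochner_Integration.integrable_bound[OF ib[of "(real (Suc k))\<^sup>2"] _ AE_I2])
      fix x
      have "(norm (h n x))\<^sup>2 \<le> (real (Suc k))\<^sup>2" using bd[of x "g n x"] unfolding h_def by (intro power_mono) auto
      then show "norm ((norm (h n x))\<^sup>2) \<le> norm ((real (Suc k))\<^sup>2 * indicat_real (cball 0 (real (Suc k) + 1)) x)"
        using h0[of x n] by (auto simp: indicator_def)
    qed measurable
  qed
  have "(\<lambda>n. L2_norm (\<lambda>x. F k x - h n x)) \<longlonglongrightarrow> 0"
  proof (rule L2_norm_tendsto_0[OF _ ib[of "(2 * real (Suc k))\<^sup>2"]])
    show "(\<lambda>x. F k x - h n x) \<in> borel_measurable lebesgue" for n by measurable
    show "(norm (F k x - h n x))\<^sup>2 \<le> (2 * real (Suc k))\<^sup>2 * indicat_real (cball 0 (real (Suc k) + 1)) x" for n x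
    proof (cases "norm x \<le> real (Suc k) + 1")
      case True
      have "norm (F k x - h n x) \<le> 2 * real (Suc k)"
        using order_trans[OF norm_triangle_ineq4 add_mono[OF bd[of x "f x"] bd[of x "g n x"]]]
        by (simp only: F_def h_def mult_2)
      then show ?thesis using True by (auto simp: indicator_def intro!: power_mono)
    next
      case False
      then show ?thesis using X0[of k x] by (simp add: F_def h_def indicator_def)
    qed
    have "AE x in lebesgue. x \<notin> N"
      using N by (simp add: negligible_iff_null_sets AE_not_in)
    then show "AE x in lebesgue. (\<lambda>n. F k x - h n x) \<longlonglongrightarrow> 0"
    proof eventually_elim
      case (elim x)
      have "isCont (clip (real (Suc k))) (f x)"
        using clip_props(4)[of "real (Suc k)"] by (simp add: continuous_on_eq_continuous_at)
      then have "(\<lambda>n. clip (real (Suc k)) (g n x)) \<longlonglongrightarrow> clip (real (Suc k)) (f x)"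
        by (rule isCont_tendsto_compose[OF _ g(2)[OF elim]])
      then have "(\<lambda>n. F k x - h n x) \<longlonglongrightarrow> F k x - of_real (X k x) * clip (real (Suc k)) (f x)"
        unfolding h_def by (intro tendsto_intros)
      then show ?case by (simp add: F_def)
    qed
  qed
  then have "\<forall>\<^sub>F n in sequentially. L2_norm (\<lambda>x. F k x - h n x) < \<epsilon> / 2"
    by (rule order_tendstoD(2)) (use \<epsilon> in simp)
  then obtain n where n: "L2_norm (\<lambda>x. F k x - h n x) < \<epsilon> / 2"
    by (meson eventually_happens trivial_limit_sequentially)
  have "L2_norm (\<lambda>x. f x - h n x) < \<epsilon>"
    using L2_dist_triangle[OF f FL[of k] hL[of n]] k n by (simp add: L2_dist_def)
  then show ?thesis using ch h0 hL by (intro exI[of _ "h n"] exI[of _ "real (Suc k) + 1"]) auto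
qed

section \<open>The spectral projections\<close>

lemma gauss_int_bound:
  fixes g :: "complex^'n::finite \<Rightarrow> complex"
  assumes \<mu>: "\<mu> > 0" and a: "a > 0" and g: "g \<in> L2" and B: "\<And>w. norm (g w) \<le> B"
  shows "norm (gauss_int \<nu> \<mu> g z a) \<le> B * (pi / (\<mu> * a)) ^ CARD('n)"
proof -
  have c: "\<mu> * a > 0" using \<mu> a by simp
  have le: "norm (tker \<nu> \<mu> (\<lambda>s. exp (- (\<mu> * a) * s)) z w * g w) \<le> B * exp (- (\<mu> * a) * (norm (z - w))\<^sup>2)" for w
    using mult_right_mono[OF B[of w], of "exp (- (\<mu> * a) * (norm (z - w))\<^sup>2)"] by (simp add: norm_mult norm_tker mult.commute)
  have i: "integrable lebesgue (\<lambda>w. B * exp (- (\<mu> * a) * (norm (z - w))\<^sup>2))"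
    by (rule integrable_mult_right[OF gaussian_shift_integral(1)[OF c]])
  have "norm (gauss_int \<nu> \<mu> g z a) \<le> (LINT w|lebesgue. B * exp (- (\<mu> * a) * (norm (z - w))\<^sup>2))"
    unfolding gauss_int_def tint_def
    by (rule order_trans[OF integral_norm_bound integral_mono[OF integrable_norm[OF tint_integrable[OF gauss_bdd_exp[OF c] g]] i le]])
  then show ?thesis unfolding integral_mult_right_zero gaussian_shift_integral(2)[OF c] .
qed

text \<open>The constant makes \<open>landau_proj\<close> the identity on the eigenspace of \<open>l\<close>.\<close>

definition landau_proj :: "real \<Rightarrow> real \<Rightarrow> nat \<Rightarrow> (complex^'n::finite \<Rightarrow> complex) \<Rightarrow> complex^'n \<Rightarrow> complex" where
  "landau_proj \<nu> \<mu> l f z = of_real ((\<mu> / pi) ^ CARD('n)) * tint \<nu> \<mu> (lagq CARD('n) \<mu> l) f z"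

context
  fixes \<nu> \<mu> :: real
  assumes \<mu>: "\<mu> > 0"
begin

abbreviation P :: "nat \<Rightarrow> (complex^'n::finite \<Rightarrow> complex) \<Rightarrow> complex^'n \<Rightarrow> complex" where
  "P \<equiv> landau_proj \<nu> \<mu>"

lemma landau_proj_diff:
  "f \<in> L2 \<Longrightarrow> g \<in> L2 \<Longrightarrow> P l (\<lambda>x. f x - g x) z = P l f z - P l g z"
  unfolding landau_proj_def tint_linear[OF gauss_bdd_lagq[OF \<mu>]] by (rule right_diff_distrib)

lemma landau_proj_add:
  assumes "f \<in> L2" "g \<in> L2"
  shows "P l (\<lambda>x. f x + g x) z = P l f z + P l g z"
  unfolding landau_proj_def tint_eq_inner
    L2_inner_add(1)[OF assms tker_L2[OF gauss_bdd_lagq[OF \<mu>]]] by (rule distrib_left)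

lemma tint_cmult_fun: "tint \<nu> \<mu> q (\<lambda>x. c * f x) z = c * tint \<nu> \<mu> q f z"
  unfolding tint_def mult.left_commute[of _ c] by (rule integral_mult_right_zero)

lemma landau_proj_cmult: "P l (\<lambda>x. c * f x) z = c * P l f z"
  unfolding landau_proj_def tint_cmult_fun by (rule mult.left_commute)

lemma landau_proj_in_A2:
  fixes f :: "complex^'n::finite \<Rightarrow> complex"
  assumes "f \<in> L2" shows "P l f \<in> A2 \<nu> \<mu> (of_nat l)"
proof -
  have "P l f = tint \<nu> \<mu> (lagq CARD('n) \<mu> l) (\<lambda>x. of_real ((\<mu> / pi) ^ CARD('n)) * f x)"
    by (rule ext) (simp only: landau_proj_def tint_cmult_fun)
  then show ?thesis using tint_lagq_in_A2[OF \<mu> L2_cmult[OF assms]] by simp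
qed

lemma landau_proj_L2: "f \<in> L2 \<Longrightarrow> P l f \<in> L2"
  using landau_proj_in_A2 A2_D(1) by blast

lemma landau_proj_eigen:
  fixes F :: "complex^'n::finite \<Rightarrow> complex"
  assumes "F \<in> A2 \<nu> \<mu> (of_nat l)"
  shows "P m F = (if m = l then F else (\<lambda>z. 0))"
proof (cases "m = l")
  case True
  have "complex_of_real ((\<mu> / pi) ^ CARD('n)) * of_real ((pi / \<mu>) ^ CARD('n)) = 1"
    unfolding of_real_mult[symmetric] power_mult_distrib[symmetric] using \<mu> by simp
  then have "P l F z = F z" for z
    unfolding landau_proj_def A2_reproducing[OF \<mu> assms] mult.assoc[symmetric] by simp
  then show ?thesis using True by auto
next
  case False
  then have "P m F z = 0" for z
    using A2_tint_lagq_zero[OF \<mu> assms, of m z] by (simp add: landau_proj_def)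
  then show ?thesis using False by auto
qed

text \<open>From here on the eigenspaces are treated as fixed spaces of integral operators: closure under limits and
  linear combinations no longer involves derivatives.\<close>

lemma A2_iff_landau_proj:
  "F \<in> A2 \<nu> \<mu> (of_nat l) \<longleftrightarrow> F \<in> L2 \<and> P l F = F"
proof
  show "F \<in> A2 \<nu> \<mu> (of_nat l) \<Longrightarrow> F \<in> L2 \<and> P l F = F"
    using landau_proj_eigen[of F l l] A2_D(1)[of F] by simp
  show "F \<in> L2 \<and> P l F = F \<Longrightarrow> F \<in> A2 \<nu> \<mu> (of_nat l)"
    using landau_proj_in_A2[of F l] by simp
qed

lemma landau_proj_self_adjoint:
  fixes f g :: "complex^'n::finite \<Rightarrow> complex"
  assumes "f \<in> L2" "g \<in> L2"
  shows "L2_inner (P l f) g = L2_inner f (P l g)"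
proof -
  let ?c = "(\<mu> / pi) ^ CARD('n)"
  have "L2_inner (P l f) g = of_real ?c * L2_inner (tint \<nu> \<mu> (lagq CARD('n) \<mu> l) f) g"
    unfolding L2_inner_def landau_proj_def mult.assoc by (rule integral_mult_right_zero)
  also have "\<dots> = of_real ?c * L2_inner f (tint \<nu> \<mu> (lagq CARD('n) \<mu> l) g)"
    unfolding tint_self_adjoint[OF gauss_bdd_lagq[OF \<mu>] assms] ..
  also have "\<dots> = L2_inner f (P l g)"
    unfolding L2_inner_def landau_proj_def complex_cnj_mult complex_cnj_complex_of_real mult.left_commute[of _ "of_real ?c"]
    by (rule integral_mult_right_zero[symmetric])
  finally show ?thesis .
qed

lemma A2_orthogonal:
  assumes F: "F \<in> A2 \<nu> \<mu> (of_nat l)" and G: "G \<in> A2 \<nu> \<mu> (of_nat m)" and "l \<noteq> m"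
  shows "L2_inner F G = 0"
proof -
  have "L2_inner F G = L2_inner (P l F) G" using landau_proj_eigen[OF F, of l] by simp
  also have "\<dots> = L2_inner F (P l G)" by (rule landau_proj_self_adjoint[OF A2_D(1)[OF F] A2_D(1)[OF G]])
  also have "\<dots> = 0" using landau_proj_eigen[OF G, of l] assms(3) by (simp add: L2_inner_def)
  finally show ?thesis .
qed

lemma landau_proj_norm:
  assumes "f \<in> L2"
  shows "L2_inner f (P l f) = of_real ((L2_norm (P l f))\<^sup>2)"
proof -
  have "P l (P l f) = P l f" using landau_proj_eigen[OF landau_proj_in_A2[OF assms], of l l] by simp
  then have "L2_inner f (P l f) = L2_inner (P l f) (P l f)"
    using landau_proj_self_adjoint[OF assms landau_proj_L2[OF assms, of l], of l] by simp
  then show ?thesis by (simp only: L2_inner_self)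
qed

definition landau_sum :: "nat \<Rightarrow> (complex^'n::finite \<Rightarrow> complex) \<Rightarrow> complex^'n \<Rightarrow> complex" where
  "landau_sum N f x = (\<Sum>l<N. P l f x)"

lemma landau_sum_L2: "f \<in> L2 \<Longrightarrow> landau_sum N f \<in> L2"
  unfolding landau_sum_def[abs_def] by (rule L2_sum) (rule landau_proj_L2)

lemma landau_sum_defect:
  assumes "f \<in> L2"
  shows "(L2_norm (\<lambda>x. f x - landau_sum N f x))\<^sup>2 = (L2_norm f)\<^sup>2 - (\<Sum>l<N. (L2_norm (P l f))\<^sup>2)"
proof -
  let ?S = "\<Sum>l<N. (L2_norm (P l f))\<^sup>2"
  have "L2_inner f (landau_sum N f) = cnj (\<Sum>l<N. L2_inner (P l f) f)"
    unfolding L2_inner_commute[of f] landau_sum_def[abs_def] L2_inner_sum[OF landau_proj_L2[OF assms] assms] ..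
  also have "\<dots> = (\<Sum>l<N. L2_inner f (P l f))" unfolding cnj_sum L2_inner_commute[of f, symmetric] ..
  also have "\<dots> = of_real ?S" unfolding landau_proj_norm[OF assms] by simp
  finally have 1: "L2_inner f (landau_sum N f) = of_real ?S" .
  have "L2_inner (landau_sum N f) (landau_sum N f) = (\<Sum>l<N. L2_inner (P l f) (landau_sum N f))"
    unfolding landau_sum_def[of N f, abs_def]
    by (rule L2_inner_sum[OF landau_proj_L2[OF assms] L2_sum[OF landau_proj_L2[OF assms]]])
  also have "\<dots> = (\<Sum>l<N. of_real ((L2_norm (P l f))\<^sup>2))"
  proof (rule sum.cong[OF refl])
    fix l assume l: "l \<in> {..<N}"
    have "L2_inner (P l f) (landau_sum N f) = cnj (\<Sum>m<N. L2_inner (P m f) (P l f))"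
      unfolding L2_inner_commute[of "P l f"] landau_sum_def[abs_def] L2_inner_sum[OF landau_proj_L2[OF assms] landau_proj_L2[OF assms]] ..
    also have "(\<Sum>m<N. L2_inner (P m f) (P l f)) = (\<Sum>m<N. if m = l then L2_inner (P l f) (P l f) else 0)"
      by (intro sum.cong refl) (auto intro: A2_orthogonal[OF landau_proj_in_A2[OF assms] landau_proj_in_A2[OF assms]])
    also have "\<dots> = L2_inner (P l f) (P l f)" using l by simp
    finally show "L2_inner (P l f) (landau_sum N f) = of_real ((L2_norm (P l f))\<^sup>2)" by (simp add: L2_inner_self)
  qed
  finally have "complex_of_real ((L2_norm (landau_sum N f))\<^sup>2) = of_real ?S" by (simp add: L2_inner_self)
  then have 2: "(L2_norm (landau_sum N f))\<^sup>2 = ?S" by (simp only: of_real_eq_iff)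
  show ?thesis
    using 1 2 by (simp add: L2_norm_diff_power2[OF assms landau_sum_L2[OF assms]])
qed

lemma Bessel:
  assumes "f \<in> L2"
  shows "(\<Sum>l<N. (L2_norm (P l f))\<^sup>2) \<le> (L2_norm f)\<^sup>2"
  using landau_sum_defect[OF assms, of N] zero_le_power2[of "L2_norm (\<lambda>x. f x - landau_sum N f x)"] by linarith

lemma landau_proj_norm_summable:
  assumes "f \<in> L2"
  shows "summable (\<lambda>l. (L2_norm (P l f))\<^sup>2)"
  by (rule summableI_nonneg_bounded[of _ "(L2_norm f)\<^sup>2"]) (use Bessel[OF assms] in auto)

text \<open>Let \<open>A\<close> be the sum on the right.  For \<open>0 \<le> r < 1\<close> the number \<open>\<langle>M\<^sub>r g, g\<rangle> = \<Sum>\<^sub>l r\<^sup>l \<parallel>P\<^sub>l g\<parallel>\<^sup>2\<close> is at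
  most \<open>A\<close>, and it tends to \<open>\<parallel>g\<parallel>\<^sup>2\<close> as \<open>r\<close> tends to \<open>1\<close>.  In the proof \<open>M a\<close> is \<open>M\<^sub>r\<close> applied to \<open>g\<close>, with
  \<open>r = (a - 1/2) / (a + 1/2)\<close>, and the normalisation \<open>(a + 1/2)\<^sup>n\<close> of \<open>M\<^sub>r\<close> differs from the factor \<open>a\<^sup>n\<close>
  that normalises the Gaussian by the bounded factor \<open>q m\<close>.\<close>

lemma Parseval_compact_support:
  fixes g :: "complex^'n::finite \<Rightarrow> complex"
  assumes cg: "continuous_on UNIV g" and supp: "\<And>x. norm x > R \<Longrightarrow> g x = 0" and g: "g \<in> L2"
  shows "(L2_norm g)\<^sup>2 \<le> (\<Sum>l. (L2_norm (P l g))\<^sup>2)"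
proof -
  let ?n = "CARD('n)"
  let ?A = "\<Sum>l. (L2_norm (P l g))\<^sup>2"
  define c where "c = (\<mu> / pi) ^ ?n"
  have c0: "c \<ge> 0" using \<mu> by (simp add: c_def)
  obtain B where B: "\<And>x. norm (g x) \<le> B" using integrable_continuous_compact_support(2)[OF cg supp] by blast
  have mgb: "g \<in> borel_measurable lborel" using borel_measurable_continuous_onI[OF cg] by simp
  have ig: "integrable lebesgue g"
    unfolding integrable_completion[OF mgb] by (rule integrable_continuous_compact_support(1)[OF cg supp])
  note mg = L2D(1)[OF g]
  define M where "M a z = of_real ((\<mu> * (a + 1/2) / pi) ^ ?n) * gauss_int \<nu> \<mu> g z a" for a z
  have mM: "M a \<in> borel_measurable lebesgue" if "a > 0" for a
  proof -
    have "\<mu> * a > 0" using \<mu> that by simp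
    then have "tint \<nu> \<mu> (\<lambda>s. exp (- (\<mu> * a) * s)) g \<in> L2" by (intro tint_L2 gauss_bdd_exp g)
    from L2_cmult[OF this] show ?thesis unfolding M_def[abs_def] gauss_int_def by (rule L2D(1))
  qed
  have bound: "norm (L2_inner (M a) g) \<le> ?A" if a: "a > 1/2" for a
  proof -
    define r where "r = (a - 1/2) / (a + 1/2)"
    have r: "0 \<le> r" "r < 1" using a by (auto simp: r_def)
    have r1: "1 / (1 - r) = a + 1/2"
      using a by (simp add: r_def field_simps)
    have r2: "(1 + r) / (2 * (1 - r)) = a"
    proof -
      have "(1 + r) / (2 * (1 - r)) = (1 + r) * (1 / (1 - r)) / 2" by simp
      moreover have "(1 + r) * (a + 1/2) = 2 * a" using a by (simp add: r_def field_simps)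
      ultimately show ?thesis unfolding r1 by simp
    qed
    define G where "G N z = (\<Sum>l<N. of_real (r ^ l) * P l g z)" for N z
    have Gc: "G N z = of_real c * (\<Sum>l<N. of_real (r ^ l) * tint \<nu> \<mu> (lagq ?n \<mu> l) g z)" for N z
      by (simp add: G_def landau_proj_def c_def sum_distrib_left mult.left_commute)
    obtain K where K: "\<And>N z. norm z \<le> R \<Longrightarrow> norm (\<Sum>l<N. of_real (r ^ l) * tint \<nu> \<mu> (lagq ?n \<mu> l) g z) \<le> K"
      using laguerre_series_compact(2)[OF \<mu> g ig supp r] by blast
    have GL: "G N \<in> L2" for N
      unfolding G_def[abs_def] by (intro L2_sum L2_cmult landau_proj_L2 g)
    have "(\<lambda>N. LINT z|lebesgue. G N z * cnj (g z)) \<longlonglongrightarrow> (LINT z|lebesgue. M a z * cnj (g z))"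
    proof (rule integral_dominated_convergence[where w = "\<lambda>z. (c * K) * norm (g z)"])
      show "integrable lebesgue (\<lambda>z. (c * K) * norm (g z))" using ig by simp
      show "(\<lambda>z. G N z * cnj (g z)) \<in> borel_measurable lebesgue" for N
        by (intro borel_measurable_times borel_measurable_cnj mg L2D(1)[OF GL])
      show "(\<lambda>z. M a z * cnj (g z)) \<in> borel_measurable lebesgue"
        by (intro borel_measurable_times borel_measurable_cnj mg mM) (use a in simp)
      have "(\<lambda>N. G N z * cnj (g z)) \<longlonglongrightarrow> M a z * cnj (g z)" for z
      proof (cases "norm z \<le> R")
        case True
        have "(\<lambda>N. of_real c * (\<Sum>l<N. of_real (r ^ l) * tint \<nu> \<mu> (lagq ?n \<mu> l) g z)) \<longlonglongrightarrow> of_real c * (of_real ((a + 1/2) ^ ?n) * gauss_int \<nu> \<mu> g z a)"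
          using laguerre_series_compact(1)[OF \<mu> g ig supp r True, of \<nu>] unfolding r1 r2 by (intro tendsto_intros)
        moreover have "of_real c * (of_real ((a + 1/2) ^ ?n) * gauss_int \<nu> \<mu> g z a) = M a z"
          unfolding M_def c_def mult.assoc[symmetric] of_real_mult[symmetric] power_mult_distrib[symmetric] by (simp add: mult.commute)
        ultimately have "(\<lambda>N. G N z) \<longlonglongrightarrow> M a z" unfolding Gc by simp
        then show ?thesis by (intro tendsto_intros)
      qed (simp add: supp)
      then show "AE z in lebesgue. (\<lambda>N. G N z * cnj (g z)) \<longlonglongrightarrow> M a z * cnj (g z)" by simp
      have "norm (G N z * cnj (g z)) \<le> (c * K) * norm (g z)" for N z
      proof (cases "norm z \<le> R")
        case True
        have "norm (G N z) \<le> c * K"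
          unfolding Gc norm_mult norm_of_real abs_of_nonneg[OF c0] by (rule mult_left_mono[OF K[OF True] c0])
        then show ?thesis unfolding norm_mult by (simp add: mult_right_mono)
      qed (simp add: supp)
      then show "AE z in lebesgue. norm (G N z * cnj (g z)) \<le> (c * K) * norm (g z)" for N by simp
    qed
    then have lim: "(\<lambda>N. L2_inner (G N) g) \<longlonglongrightarrow> L2_inner (M a) g" unfolding L2_inner_def .
    have "norm (L2_inner (G N) g) \<le> ?A" for N
    proof -
      have e: "L2_inner (\<lambda>z. of_real (r ^ l) * P l g z) g = of_real (r ^ l * (L2_norm (P l g))\<^sup>2)" for l
      proof -
        have "L2_inner (\<lambda>z. of_real (r ^ l) * P l g z) g = of_real (r ^ l) * L2_inner (P l g) g"
          unfolding L2_inner_def mult.assoc by (rule integral_mult_right_zero)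
        also have "L2_inner (P l g) g = L2_inner g (P l g)" by (rule landau_proj_self_adjoint[OF g g])
        finally show ?thesis unfolding landau_proj_norm[OF g] of_real_mult .
      qed
      have "L2_inner (G N) g = (\<Sum>l<N. L2_inner (\<lambda>z. of_real (r ^ l) * P l g z) g)"
        unfolding G_def[abs_def] by (intro L2_inner_sum L2_cmult landau_proj_L2 g)
      also have "\<dots> = of_real (\<Sum>l<N. r ^ l * (L2_norm (P l g))\<^sup>2)" unfolding e of_real_sum ..
      finally have "norm (L2_inner (G N) g) = (\<Sum>l<N. r ^ l * (L2_norm (P l g))\<^sup>2)"
        using r by (simp only: norm_of_real abs_of_nonneg[OF sum_nonneg[OF mult_nonneg_nonneg[OF zero_le_power zero_le_power2]]])
      also have "\<dots> \<le> (\<Sum>l<N. 1 * (L2_norm (P l g))\<^sup>2)"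
        using r by (intro sum_mono mult_right_mono power_le_one) auto
      also have "\<dots> \<le> ?A" unfolding mult_1 by (rule sum_le_suminf[OF landau_proj_norm_summable[OF g]]) auto
      finally show ?thesis .
    qed
    then show ?thesis by (intro Lim_norm_ubound[OF _ lim] always_eventually) auto
  qed
  define a where "a m = real (Suc m)" for m
  have a: "a m \<ge> 1" for m by (simp add: a_def)
  have "filterlim a at_top sequentially" unfolding a_def
    by (rule filterlim_compose[OF filterlim_real_sequentially filterlim_Suc])
  note at = this
  define q where "q m = ((a m + 1/2) / a m) ^ ?n" for m
  have Mq: "M (a m) z = of_real (q m) * (of_real ((\<mu> * a m / pi) ^ ?n) * gauss_int \<nu> \<mu> g z (a m))" for m z
  proof -
    have "\<mu> * (a m + 1/2) / pi = (a m + 1/2) / a m * (\<mu> * a m / pi)" using a[of m] by simp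
    then show ?thesis unfolding M_def q_def by (simp only: power_mult_distrib of_real_mult mult.assoc)
  qed
  have q2: "0 \<le> q m" "q m \<le> 2 ^ ?n" for m
  proof -
    have "(a m + 1/2) / a m \<le> 2" using a[of m] by (simp add: divide_le_eq)
    then show "q m \<le> 2 ^ ?n" unfolding q_def using a[of m] by (intro power_mono) auto
  qed (use a[of m] in \<open>simp add: q_def\<close>)
  have q1: "q \<longlonglongrightarrow> 1"
  proof -
    have "((\<lambda>x::real. (x + 1/2) / x) \<longlongrightarrow> 1) at_top" by real_asymp
    from tendsto_power[OF filterlim_compose[OF this at], of ?n] show ?thesis unfolding q_def[abs_def] by simp
  qed
  have "(\<lambda>m. LINT z|lebesgue. M (a m) z * cnj (g z)) \<longlonglongrightarrow> (LINT z|lebesgue. g z * cnj (g z))"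
  proof (rule integral_dominated_convergence[where w = "\<lambda>z. (2 ^ ?n * B) * norm (g z)"])
    show "integrable lebesgue (\<lambda>z. (2 ^ ?n * B) * norm (g z))" using ig by simp
    show "(\<lambda>z. M (a m) z * cnj (g z)) \<in> borel_measurable lebesgue" for m
      by (intro borel_measurable_times borel_measurable_cnj mg mM) (use a[of m] in simp)
    show "(\<lambda>z. g z * cnj (g z)) \<in> borel_measurable lebesgue"
      by (intro borel_measurable_times borel_measurable_cnj mg)
    have "(\<lambda>m. M (a m) z * cnj (g z)) \<longlonglongrightarrow> (of_real 1 * g z) * cnj (g z)" for z
      unfolding Mq by (intro tendsto_intros q1 filterlim_compose[OF gauss_int_tendsto[OF \<mu> g cg] at])
    then show "AE z in lebesgue. (\<lambda>m. M (a m) z * cnj (g z)) \<longlonglongrightarrow> g z * cnj (g z)" by simp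
    have "norm (M (a m) z * cnj (g z)) \<le> (2 ^ ?n * B) * norm (g z)" for m z
    proof -
      have p: "\<mu> * a m > 0" using \<mu> a[of m] by simp
      have "(\<mu> * a m / pi) ^ ?n * norm (gauss_int \<nu> \<mu> g z (a m)) \<le> (\<mu> * a m / pi) ^ ?n * (B * (pi / (\<mu> * a m)) ^ ?n)"
        using p a[of m] by (intro mult_left_mono gauss_int_bound \<mu> g B) auto
      also have "\<dots> = B * ((\<mu> * a m / pi) * (pi / (\<mu> * a m))) ^ ?n" by (simp only: power_mult_distrib mult_ac)
      also have "(\<mu> * a m / pi) * (pi / (\<mu> * a m)) = 1" using \<mu> a[of m] by simp
      finally have "norm (of_real ((\<mu> * a m / pi) ^ ?n) * gauss_int \<nu> \<mu> g z (a m)) \<le> B"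
        unfolding norm_mult norm_of_real using p by simp
      then have "norm (M (a m) z) \<le> 2 ^ ?n * B"
        unfolding Mq norm_mult[of "of_real (q m)"] norm_of_real using q2[of m] by (intro mult_mono) auto
      then show ?thesis unfolding norm_mult by (simp add: mult_right_mono)
    qed
    then show "AE z in lebesgue. norm (M (a m) z * cnj (g z)) \<le> (2 ^ ?n * B) * norm (g z)" for m by simp
  qed
  then have "(\<lambda>m. L2_inner (M (a m)) g) \<longlonglongrightarrow> L2_inner g g" unfolding L2_inner_def .
  then have "norm (L2_inner g g) \<le> ?A"
  proof (rule Lim_norm_ubound[OF trivial_limit_sequentially _ always_eventually], intro allI)
    show "norm (L2_inner (M (a m)) g) \<le> ?A" for m using bound[of "a m"] a[of m] by simp
  qed
  then show ?thesis by (simp add: L2_inner_self del: of_real_power)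
qed

text \<open>The remainder of the expansion is a contraction, so an approximation of \<open>f\<close> by a function \<open>g\<close> with
  compact support is good enough.\<close>

lemma landau_sum_tendsto:
  fixes f :: "complex^'n::finite \<Rightarrow> complex"
  assumes f: "f \<in> L2"
  shows "(\<lambda>N. L2_dist f (landau_sum N f)) \<longlonglongrightarrow> 0"
proof -
  have cont: "L2_norm (\<lambda>x. h x - landau_sum N h x) \<le> L2_norm h" if "h \<in> L2" for h :: "complex^'n \<Rightarrow> complex" and N
  proof (rule power2_le_imp_le)
    have "0 \<le> (\<Sum>l<N. (L2_norm (P l h))\<^sup>2)" by (intro sum_nonneg) simp
    then show "(L2_norm (\<lambda>x. h x - landau_sum N h x))\<^sup>2 \<le> (L2_norm h)\<^sup>2"
      unfolding landau_sum_defect[OF that] by simp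
  qed simp
  show ?thesis
  proof (rule LIMSEQ_I)
    fix \<epsilon> :: real assume \<epsilon>: "\<epsilon> > 0"
    obtain g R where g: "continuous_on UNIV g" "\<And>x. norm x > R \<Longrightarrow> g x = 0" "g \<in> L2" and d: "L2_norm (\<lambda>x. f x - g x) < \<epsilon> / 2"
      using L2_dense_continuous_compact_support[OF f, of "\<epsilon> / 2"] \<epsilon> by auto
    have par: "(L2_norm g)\<^sup>2 \<le> (\<Sum>l. (L2_norm (P l g))\<^sup>2)"
      by (rule Parseval_compact_support[OF g(1) _ g(3)]) (rule g(2))
    have "(\<lambda>N. (L2_norm g)\<^sup>2 - (\<Sum>l<N. (L2_norm (P l g))\<^sup>2)) \<longlonglongrightarrow> (L2_norm g)\<^sup>2 - (\<Sum>l. (L2_norm (P l g))\<^sup>2)"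
      by (intro tendsto_intros summable_LIMSEQ landau_proj_norm_summable g)
    moreover have "(L2_norm g)\<^sup>2 - (\<Sum>l. (L2_norm (P l g))\<^sup>2) < (\<epsilon> / 2)\<^sup>2"
      using par \<epsilon> zero_less_power[of "\<epsilon> / 2" 2] by linarith
    ultimately have "\<forall>\<^sub>F N in sequentially. (L2_norm g)\<^sup>2 - (\<Sum>l<N. (L2_norm (P l g))\<^sup>2) < (\<epsilon> / 2)\<^sup>2"
      by (rule order_tendstoD(2))
    then obtain N0 where N0: "\<And>N. N \<ge> N0 \<Longrightarrow> (L2_norm (\<lambda>x. g x - landau_sum N g x))\<^sup>2 < (\<epsilon> / 2)\<^sup>2"
      unfolding landau_sum_defect[OF g(3)] eventually_sequentially by blast
    show "\<exists>N0. \<forall>N\<ge>N0. norm (L2_dist f (landau_sum N f) - 0) < \<epsilon>"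
    proof (intro exI[of _ N0] allI impI)
      fix N assume "N \<ge> N0"
      then have gN: "L2_norm (\<lambda>x. g x - landau_sum N g x) < \<epsilon> / 2"
        using N0 \<epsilon> by (intro power2_less_imp_less[of _ "\<epsilon> / 2"]) auto
      let ?h = "\<lambda>x. f x - g x"
      have hL: "?h \<in> L2" by (rule L2_diff[OF f g(3)])
      have "landau_sum N ?h x = landau_sum N f x - landau_sum N g x" for x
        unfolding landau_sum_def landau_proj_diff[OF f g(3)] by (rule sum_subtractf)
      then have e: "(\<lambda>x. f x - landau_sum N f x) = (\<lambda>x. (?h x - landau_sum N ?h x) - (landau_sum N g x - g x))"
        by (auto simp: algebra_simps)
      have "L2_norm (\<lambda>x. f x - landau_sum N f x) \<le> L2_norm (\<lambda>x. ?h x - landau_sum N ?h x) + L2_norm (\<lambda>x. landau_sum N g x - g x)"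
        unfolding e by (rule L2_norm_triangle_diff[OF L2_diff[OF hL landau_sum_L2[OF hL]] L2_diff[OF landau_sum_L2[OF g(3)] g(3)]])
      also have "\<dots> < \<epsilon>"
        using cont[OF hL, of N] d gN L2_norm_minus_commute[of g "landau_sum N g"] by linarith
      finally show "norm (L2_dist f (landau_sum N f) - 0) < \<epsilon>" by (simp add: L2_dist_def)
    qed
  qed
qed

lemma A2_zero: "(\<lambda>z::complex^'n::finite. 0) \<in> A2 \<nu> \<mu> lam"
proof -
  have "d_z j (\<lambda>z. 0) = (\<lambda>z. 0)" "d_zbar j (\<lambda>z. 0) = (\<lambda>z. 0)" for j :: 'n by auto
  then have "Delta \<nu> \<mu> (\<lambda>z::complex^'n. 0) z = 0" for z
    by (simp add: Delta_def euler_def euler_bar_def)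
  then show ?thesis by (simp add: A2_def L2_zero smooth_rules(1))
qed

text \<open>Point evaluation is continuous on each eigenspace; this makes \<open>L\<^sup>2\<close> limits of eigenfunctions pointwise
  limits, determines them everywhere and not just almost everywhere, and shows that they are fixed by the
  projection.\<close>

lemma A2_pointwise_bound:
  fixes z :: "complex^'n::finite"
  shows "\<exists>C\<ge>0. \<forall>F\<in>L2. norm (P l F z) \<le> C * L2_norm F"
proof -
  let ?k = "L2_norm (\<lambda>w. tker \<nu> \<mu> (lagq CARD('n) \<mu> l) w (z::complex^'n))"
  let ?c = "(\<mu> / pi) ^ CARD('n)"
  have "norm (P l F z) \<le> (?c * ?k) * L2_norm F" if "F \<in> L2" for F :: "complex^'n \<Rightarrow> complex"
  proof -
    have c0: "0 \<le> ?c" using \<mu> by simp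
    have "norm (tint \<nu> \<mu> (lagq CARD('n) \<mu> l) F z) \<le> L2_norm F * ?k"
      by (rule tint_pointwise_bound[OF gauss_bdd_lagq[OF \<mu>] that])
    from mult_left_mono[OF this c0] show ?thesis
      unfolding landau_proj_def norm_mult norm_of_real abs_of_nonneg[OF c0] by (simp only: mult_ac)
  qed
  then show ?thesis using \<mu> by (intro exI[of _ "?c * ?k"]) auto
qed

lemma A2_norm_zero:
  fixes F :: "complex^'n::finite \<Rightarrow> complex"
  assumes "F \<in> A2 \<nu> \<mu> (of_nat l)" "L2_norm F = 0" shows "F = (\<lambda>z. 0)"
proof
  fix z :: "complex^'n"
  obtain C where "\<forall>F\<in>L2. norm (P l F z) \<le> C * L2_norm F" using A2_pointwise_bound by blast
  then show "F z = 0" using assms by (fastforce simp: A2_iff_landau_proj)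
qed

text \<open>The pointwise limit \<open>F\<close> of the sequence is also its \<open>L\<^sup>2\<close> limit by Fatou's lemma, and \<open>P l F = F\<close> follows
  by continuity of the projection at each point.\<close>

lemma A2_complete:
  fixes \<sigma> :: "nat \<Rightarrow> complex^'n::finite \<Rightarrow> complex"
  assumes \<sigma>: "\<And>n. \<sigma> n \<in> A2 \<nu> \<mu> (of_nat l)"
    and Cauchy: "\<And>\<epsilon>. \<epsilon> > 0 \<Longrightarrow> \<exists>N. \<forall>m\<ge>N. \<forall>n\<ge>N. L2_dist (\<sigma> m) (\<sigma> n) < \<epsilon>"
  shows "\<exists>F\<in>A2 \<nu> \<mu> (of_nat l). \<forall>\<epsilon>>0. \<exists>N. \<forall>n\<ge>N. L2_dist (\<sigma> n) F < \<epsilon>"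
proof -
  have L: "\<sigma> n \<in> L2" "P l (\<sigma> n) = \<sigma> n" for n using \<sigma>[of n] by (simp_all add: A2_iff_landau_proj)
  have pt: "norm (\<sigma> m z - \<sigma> n z) = norm (P l (\<lambda>x. \<sigma> m x - \<sigma> n x) z)" for m n z
    unfolding landau_proj_diff[OF L(1) L(1)] L(2) ..
  have "convergent (\<lambda>n. \<sigma> n z)" for z
  proof -
    obtain C where C: "C \<ge> 0" "\<forall>F\<in>L2. norm (P l F z) \<le> C * L2_norm F" using A2_pointwise_bound by blast
    have "Cauchy (\<lambda>n. \<sigma> n z)"
    proof (rule CauchyI)
      fix e :: real assume e: "e > 0"
      obtain N where N: "\<forall>m\<ge>N. \<forall>n\<ge>N. L2_dist (\<sigma> m) (\<sigma> n) < e / (C + 1)"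
        using Cauchy[of "e / (C + 1)"] e C(1) by auto
      have "norm (\<sigma> m z - \<sigma> n z) < e" if "m \<ge> N" "n \<ge> N" for m n
      proof -
        have d: "L2_norm (\<lambda>x. \<sigma> m x - \<sigma> n x) < e / (C + 1)" using N that by (auto simp: L2_dist_def)
        have "norm (\<sigma> m z - \<sigma> n z) \<le> C * L2_norm (\<lambda>x. \<sigma> m x - \<sigma> n x)"
          unfolding pt using C(2) L2_diff[OF L(1) L(1)] by blast
        also have "\<dots> \<le> (C + 1) * L2_norm (\<lambda>x. \<sigma> m x - \<sigma> n x)" by (intro mult_right_mono) auto
        also have "\<dots> < e" using d C(1) by (simp add: pos_less_divide_eq mult.commute)
        finally show ?thesis .
      qed
      then show "\<exists>N. \<forall>m\<ge>N. \<forall>n\<ge>N. norm (\<sigma> m z - \<sigma> n z) < e" by blast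
    qed
    then show ?thesis by (rule Cauchy_convergent)
  qed
  then obtain F where F: "\<And>z. (\<lambda>n. \<sigma> n z) \<longlonglongrightarrow> F z" unfolding convergent_def by metis
  have mF: "F \<in> borel_measurable lebesgue"
    by (rule borel_measurable_LIMSEQ_metric[OF L2D(1)[OF L(1)] F])
  have close: "(\<lambda>x. F x - \<sigma> n x) \<in> L2 \<and> L2_norm (\<lambda>x. F x - \<sigma> n x) \<le> e"
    if e: "e > 0" and N: "\<forall>m\<ge>N. \<forall>n\<ge>N. L2_dist (\<sigma> m) (\<sigma> n) < e" and n: "n \<ge> N" for e N n
  proof -
    have m: "(\<lambda>x. ennreal ((norm (\<sigma> m x - \<sigma> n x))\<^sup>2)) \<in> borel_measurable lebesgue" for m
      using L2D(1)[OF L(1)[of m]] L2D(1)[OF L(1)[of n]] by measurable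
    have "(\<integral>\<^sup>+x. ennreal ((norm (F x - \<sigma> n x))\<^sup>2) \<partial>lebesgue) = (\<integral>\<^sup>+x. liminf (\<lambda>m. ennreal ((norm (\<sigma> m x - \<sigma> n x))\<^sup>2)) \<partial>lebesgue)"
    proof (rule nn_integral_cong)
      fix x
      have "(\<lambda>m. ennreal ((norm (\<sigma> m x - \<sigma> n x))\<^sup>2)) \<longlonglongrightarrow> ennreal ((norm (F x - \<sigma> n x))\<^sup>2)"
        by (intro tendsto_ennrealI tendsto_intros F)
      then show "ennreal ((norm (F x - \<sigma> n x))\<^sup>2) = liminf (\<lambda>m. ennreal ((norm (\<sigma> m x - \<sigma> n x))\<^sup>2))"
        by (rule lim_imp_Liminf[OF trivial_limit_sequentially, symmetric])
    qed
    also have "\<dots> \<le> liminf (\<lambda>m. \<integral>\<^sup>+x. ennreal ((norm (\<sigma> m x - \<sigma> n x))\<^sup>2) \<partial>lebesgue)"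
      by (rule nn_integral_liminf[OF m])
    also have "\<dots> \<le> ennreal (e\<^sup>2)"
    proof (rule Liminf_le[OF trivial_limit_sequentially])
      show "\<forall>\<^sub>F m in sequentially. (\<integral>\<^sup>+x. ennreal ((norm (\<sigma> m x - \<sigma> n x))\<^sup>2) \<partial>lebesgue) \<le> ennreal (e\<^sup>2)"
        using eventually_ge_at_top[of N]
      proof eventually_elim
        case (elim m)
        have "L2_norm (\<lambda>x. \<sigma> m x - \<sigma> n x) \<le> e" using N elim n unfolding L2_dist_def by (meson less_imp_le)
        then have "(L2_norm (\<lambda>x. \<sigma> m x - \<sigma> n x))\<^sup>2 \<le> e\<^sup>2" by (intro power_mono) auto
        then show ?case
          using nn_integral_eq_integral[OF L2D(2)[OF L2_diff[OF L(1)[of m] L(1)[of n]]]]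
          by (simp add: L2_norm_power2 ennreal_leI)
      qed
    qed
    finally have b: "(\<integral>\<^sup>+x. ennreal ((norm (F x - \<sigma> n x))\<^sup>2) \<partial>lebesgue) \<le> ennreal (e\<^sup>2)" .
    have mm: "(\<lambda>x. F x - \<sigma> n x) \<in> borel_measurable lebesgue" using mF L2D(1)[OF L(1)[of n]] by measurable
    show ?thesis using L2_norm_mono_nn[OF mm b] e by simp
  qed
  obtain N1 where N1: "\<forall>m\<ge>N1. \<forall>n\<ge>N1. L2_dist (\<sigma> m) (\<sigma> n) < 1" using Cauchy[of 1] by auto
  have FL: "F \<in> L2"
    using L2_add[OF conjunct1[OF close[OF _ N1, of N1]] L(1)[of N1]] by simp
  have conv: "\<exists>N. \<forall>n\<ge>N. L2_dist (\<sigma> n) F < e" if e: "e > 0" for e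
  proof -
    obtain N where N: "\<forall>m\<ge>N. \<forall>n\<ge>N. L2_dist (\<sigma> m) (\<sigma> n) < e / 2" using Cauchy[of "e / 2"] e by auto
    have "L2_dist (\<sigma> n) F < e" if "n \<ge> N" for n
      using close[OF _ N that] e by (simp add: L2_dist_def L2_norm_minus_commute[of "\<sigma> n"])
    then show ?thesis by blast
  qed
  have "P l F z = F z" for z
  proof -
    obtain C where C: "C \<ge> 0" "\<forall>F\<in>L2. norm (P l F z) \<le> C * L2_norm F" using A2_pointwise_bound by blast
    have "(\<lambda>n. L2_dist (\<sigma> n) F) \<longlonglongrightarrow> 0"
      by (rule LIMSEQ_I) (use conv in \<open>auto simp: L2_dist_def\<close>)
    then have C0: "(\<lambda>n. C * L2_dist (\<sigma> n) F) \<longlonglongrightarrow> 0" using tendsto_mult_right_zero by blast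
    have "norm (\<sigma> n z - P l F z) \<le> C * L2_dist (\<sigma> n) F" for n
    proof -
      have "\<sigma> n z - P l F z = P l (\<lambda>x. \<sigma> n x - F x) z" unfolding landau_proj_diff[OF L(1) FL] L(2) ..
      then show ?thesis using C(2) L2_diff[OF L(1) FL] by (simp add: L2_dist_def)
    qed
    then have "(\<lambda>n. \<sigma> n z - P l F z) \<longlonglongrightarrow> 0"
      by (intro Lim_null_comparison[OF _ C0] always_eventually) auto
    then have "(\<lambda>n. \<sigma> n z) \<longlonglongrightarrow> P l F z" by (simp add: LIM_zero_iff)
    then show ?thesis using F LIMSEQ_unique by blast
  qed
  then have "F \<in> A2 \<nu> \<mu> (of_nat l)" using FL by (auto simp: A2_iff_landau_proj)
  then show ?thesis using conv by blast
qed

lemma A2_eq_zero_space: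
  assumes "\<And>l::nat. lam \<noteq> of_nat l"
  shows "A2 \<nu> \<mu> lam = {\<lambda>z::complex^'n::finite. 0}"
  using A2_trivial[OF \<mu> _ assms] A2_zero by (auto simp: fun_eq_iff)

lemma A2_nonzero: "A2 \<nu> \<mu> (of_nat l) \<noteq> {\<lambda>z::complex^'n::finite. 0}"
proof
  assume "A2 \<nu> \<mu> (of_nat l) = {\<lambda>z::complex^'n. 0}"
  then have "tker \<nu> \<mu> (lagq CARD('n) \<mu> l) (0::complex^'n) 0 = 0"
    using tker_lagq_in_A2[OF \<mu>, of \<nu> l "0::complex^'n"] by (auto dest: fun_cong[of _ _ 0])
  then have "lag_coeff CARD('n) l 0 = 0"
    by (simp add: tker_def lagq_def exp_poly_def poly_0_coeff_0 coeff_laguerre)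
  moreover have "l \<le> l + CARD('n) - 1" using zero_less_card_finite[where 'a='n] by linarith
  ultimately show False by (simp add: lag_coeff_def)
qed

lemma A2_Hilbert_space: "L2_Hilbert_space (A2 \<nu> \<mu> lam :: (complex^'n::finite \<Rightarrow> complex) set)"
proof -
  let ?V = "A2 \<nu> \<mu> lam :: (complex^'n \<Rightarrow> complex) set"
  have sub: "?V \<subseteq> L2" by (auto simp: A2_def)
  have "(\<exists>l::nat. lam = of_nat l) \<or> ?V = {\<lambda>z. 0}" using A2_eq_zero_space by blast
  then have props: "(\<forall>f\<in>?V. \<forall>g\<in>?V. (\<lambda>x. f x + g x) \<in> ?V) \<and> (\<forall>c. \<forall>f\<in>?V. (\<lambda>x. c * f x) \<in> ?V) \<and>
     (\<forall>F\<in>?V. L2_norm F = 0 \<longrightarrow> F = (\<lambda>z. 0)) \<and>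
     (\<forall>\<sigma> :: nat \<Rightarrow> _. (\<forall>n. \<sigma> n \<in> ?V) \<longrightarrow> (\<forall>\<epsilon>>0. \<exists>N. \<forall>m\<ge>N. \<forall>n\<ge>N. L2_dist (\<sigma> m) (\<sigma> n) < \<epsilon>) \<longrightarrow>
        (\<exists>F\<in>?V. \<forall>\<epsilon>>0. \<exists>N. \<forall>n\<ge>N. L2_dist (\<sigma> n) F < \<epsilon>))"
  proof
    assume "\<exists>l::nat. lam = of_nat l"
    then obtain l :: nat where l: "lam = of_nat l" by blast
    show ?thesis
      unfolding l
    proof (intro conjI ballI allI impI)
      fix f g :: "complex^'n \<Rightarrow> complex"
      assume "f \<in> A2 \<nu> \<mu> (of_nat l)" "g \<in> A2 \<nu> \<mu> (of_nat l)"
      then have f: "f \<in> L2" "P l f = f" and g: "g \<in> L2" "P l g = g" by (simp_all add: A2_iff_landau_proj)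
      show "(\<lambda>x. f x + g x) \<in> A2 \<nu> \<mu> (of_nat l)"
        unfolding A2_iff_landau_proj using L2_add[OF f(1) g(1)] landau_proj_add[OF f(1) g(1), of l] f(2) g(2) by auto
    next
      fix c and f :: "complex^'n \<Rightarrow> complex"
      assume "f \<in> A2 \<nu> \<mu> (of_nat l)"
      then have f: "f \<in> L2" "P l f = f" by (simp_all add: A2_iff_landau_proj)
      show "(\<lambda>x. c * f x) \<in> A2 \<nu> \<mu> (of_nat l)"
        unfolding A2_iff_landau_proj using L2_cmult[OF f(1)] landau_proj_cmult[of l c f] f(2) by auto
    next
      fix f :: "complex^'n \<Rightarrow> complex"
      assume "f \<in> A2 \<nu> \<mu> (of_nat l)" "L2_norm f = 0"
      then show "f = (\<lambda>z. 0)" by (rule A2_norm_zero)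
    next
      fix \<sigma> :: "nat \<Rightarrow> complex^'n \<Rightarrow> complex"
      assume "\<forall>n. \<sigma> n \<in> A2 \<nu> \<mu> (of_nat l)" "\<forall>\<epsilon>>0. \<exists>N. \<forall>m\<ge>N. \<forall>n\<ge>N. L2_dist (\<sigma> m) (\<sigma> n) < \<epsilon>"
      then show "\<exists>F\<in>A2 \<nu> \<mu> (of_nat l). \<forall>\<epsilon>>0. \<exists>N. \<forall>n\<ge>N. L2_dist (\<sigma> n) F < \<epsilon>"
        by (intro A2_complete) auto
    qed
  next
    assume "?V = {\<lambda>z. 0}"
    then show ?thesis by (simp add: L2_dist_def L2_norm_def)
  qed
  note padd = props[THEN conjunct1, rule_format]
    and pcmult = props[THEN conjunct2, THEN conjunct1, rule_format]
    and pzero = props[THEN conjunct2, THEN conjunct2, THEN conjunct1, rule_format]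
    and pcomplete = props[THEN conjunct2, THEN conjunct2, THEN conjunct2, rule_format]
  have diff: "(\<lambda>x. f x - g x) \<in> ?V" if "f \<in> ?V" "g \<in> ?V" for f g
  proof -
    have "(\<lambda>x. f x + -1 * g x) \<in> ?V" by (rule padd[OF that(1) pcmult[OF that(2)]])
    then show ?thesis by simp
  qed
  have M: "Metric_space ?V L2_dist"
  proof
    show "0 \<le> L2_dist f g" for f g by (simp add: L2_dist_def)
    show "L2_dist f g = L2_dist g f" for f g unfolding L2_dist_def by (rule L2_norm_minus_commute)
    show "L2_dist f g = 0 \<longleftrightarrow> f = g" if "f \<in> ?V" "g \<in> ?V" for f g
    proof
      assume "L2_dist f g = 0"
      then have "(\<lambda>x. f x - g x) = (\<lambda>z. 0)" using pzero[OF diff[OF that]] by (simp add: L2_dist_def)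
      then show "f = g" by (simp add: fun_eq_iff)
    qed (simp add: L2_dist_def L2_norm_def)
    show "L2_dist f h \<le> L2_dist f g + L2_dist g h" if "f \<in> ?V" "g \<in> ?V" "h \<in> ?V" for f g h
      using that sub by (intro L2_dist_triangle) auto
  qed
  have "Metric_space.mcomplete ?V L2_dist"
    unfolding Metric_space.mcomplete_def[OF M]
  proof (intro allI impI)
    fix \<sigma> assume "Metric_space.MCauchy ?V L2_dist \<sigma>"
    then have c: "range \<sigma> \<subseteq> ?V \<and> (\<forall>\<epsilon>>0. \<exists>N. \<forall>n n'. N \<le> n \<longrightarrow> N \<le> n' \<longrightarrow> L2_dist (\<sigma> n) (\<sigma> n') < \<epsilon>)"
      unfolding Metric_space.MCauchy_def[OF M] .
    have mem: "\<sigma> n \<in> ?V" for n using conjunct1[OF c] by (rule subsetD) simp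
    have "\<exists>F\<in>?V. \<forall>\<epsilon>>0. \<exists>N. \<forall>n\<ge>N. L2_dist (\<sigma> n) F < \<epsilon>"
    proof (rule pcomplete[OF mem])
      fix \<epsilon> :: real assume "\<epsilon> > 0"
      then obtain N where "\<forall>n n'. N \<le> n \<longrightarrow> N \<le> n' \<longrightarrow> L2_dist (\<sigma> n) (\<sigma> n') < \<epsilon>"
        using conjunct2[OF c] by auto
      then show "\<exists>N. \<forall>m\<ge>N. \<forall>n\<ge>N. L2_dist (\<sigma> m) (\<sigma> n) < \<epsilon>" by (intro exI[of _ N]) simp
    qed
    then obtain F where F: "F \<in> ?V" "\<forall>\<epsilon>>0. \<exists>N. \<forall>n\<ge>N. L2_dist (\<sigma> n) F < \<epsilon>" ..
    show "\<exists>F. limitin (Metric_space.mtopology ?V L2_dist) \<sigma> F sequentially"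
      unfolding Metric_space.limit_metric_sequentially[OF M]
      using F mem by (intro exI[of _ F]) simp
  qed
  moreover have "(\<forall>f\<in>?V. \<forall>g\<in>?V. (\<lambda>x. f x + g x) \<in> ?V)" "(\<forall>c. \<forall>f\<in>?V. (\<lambda>x. c * f x) \<in> ?V)"
    by (rule props[THEN conjunct1], rule props[THEN conjunct2, THEN conjunct1])
  ultimately show ?thesis
    unfolding L2_Hilbert_space_def by (intro conjI sub A2_zero M)
qed

lemma L2_eq_Hilbert_sum: "(L2 :: (complex^'n::finite \<Rightarrow> complex) set) = L2_Hilbert_sum (\<lambda>l. A2 \<nu> \<mu> (of_nat l))"
proof
  show "L2_Hilbert_sum (\<lambda>l. A2 \<nu> \<mu> (of_nat l)) \<subseteq> (L2 :: (complex^'n \<Rightarrow> complex) set)"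
    by (auto simp: L2_Hilbert_sum_def)
  show "(L2 :: (complex^'n \<Rightarrow> complex) set) \<subseteq> L2_Hilbert_sum (\<lambda>l. A2 \<nu> \<mu> (of_nat l))"
  proof
    fix f :: "complex^'n \<Rightarrow> complex" assume f: "f \<in> L2"
    show "f \<in> L2_Hilbert_sum (\<lambda>l. A2 \<nu> \<mu> (of_nat l))"
      unfolding L2_Hilbert_sum_def mem_Collect_eq
      using f landau_proj_in_A2[OF f] landau_proj_norm_summable[OF f] landau_sum_tendsto[OF f, unfolded landau_sum_def[abs_def]]
      by (intro conjI exI[of _ "\<lambda>l. P l f"]) auto
  qed
qed

end

theorem proposition5p5:
  fixes \<nu> \<mu> :: real and lam :: complex
  assumes "\<mu> > 0"
  shows "L2_Hilbert_space (A2 \<nu> \<mu> lam :: (complex^'n::finite \<Rightarrow> complex) set) \<and>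
    ((A2 \<nu> \<mu> lam :: (complex^'n \<Rightarrow> complex) set) \<noteq> {\<lambda>z. 0} \<longleftrightarrow> (\<exists>l::nat. lam = of_nat l)) \<and>
    (\<forall>l m :: nat. l \<noteq> m \<longrightarrow>
       L2_orthogonal (A2 \<nu> \<mu> (of_nat l) :: (complex^'n \<Rightarrow> complex) set) (A2 \<nu> \<mu> (of_nat m))) \<and>
    (L2 :: (complex^'n \<Rightarrow> complex) set) = L2_Hilbert_sum (\<lambda>l. A2 \<nu> \<mu> (of_nat l))"
proof (intro conjI allI impI)
  show "L2_Hilbert_space (A2 \<nu> \<mu> lam :: (complex^'n \<Rightarrow> complex) set)"
    by (rule A2_Hilbert_space[OF assms])
  show "(A2 \<nu> \<mu> lam :: (complex^'n \<Rightarrow> complex) set) \<noteq> {\<lambda>z. 0} \<longleftrightarrow> (\<exists>l::nat. lam = of_nat l)"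
    using A2_nonzero[OF assms] A2_eq_zero_space[OF assms] by blast
  show "L2_orthogonal (A2 \<nu> \<mu> (of_nat l) :: (complex^'n \<Rightarrow> complex) set) (A2 \<nu> \<mu> (of_nat m))" if "l \<noteq> m" for l m :: nat
    unfolding L2_orthogonal_def using A2_orthogonal[OF assms _ _ that] by blast
  show "(L2 :: (complex^'n \<Rightarrow> complex) set) = L2_Hilbert_sum (\<lambda>l. A2 \<nu> \<mu> (of_nat l))"
    by (rule L2_eq_Hilbert_sum[OF assms])
qed

end
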